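(* Let $(Y_t)_{t\in\mathbb Z}$ and $(X_t)_{t\in\mathbb Z}$ be stationary real-valued time series with $Y_t=\Phi(Y_{t-1},\epsilon_t)$ and $X_t=\Psi(Y_t,\epsilon_{t+1},\dots,\epsilon_{t+s})$, $t\in\mathbb Z$, in the setting described in the context, and let Conditions 1, 2 and 3 (see context) hold. Then for all integers $m\ge 0$ and $n\ge 0$ we have, in the sense of weak convergence, $$\lim_{x\to\infty}\mathcal L\left(\frac{Y_{-m}}{x},\dots,\frac{Y_{s+n}}{x}\;\middle|\;|X_0|>x\right)=\mathcal L\left(Y_{-m}^{(X)},\dots,Y_{s+n}^{(X)}\right),$$ where $(Y_0^{(X)},\dots,Y_s^{(X)})$ is the random vector of Condition 3 and $$Y_t^{(X)}=h(Y_{t-1}^{(X)},A_t,B_t),\quad t>s,\qquad Y_{-t}^{(X)}=h(Y_{-t+1}^{(X)},A_{-t},B_{-t}),\quad t>0,$$ with $h(y,a,b)=y\left(a\mathbf 1_{(0,\infty)}(y)+b\mathbf 1_{(-\infty,0)}(y)\right)$. Here the pairs $(A_t,B_t)$, $t\in\mathbb Z\setminus\{0\}$, are independent, and independent of $(Y_0^{(X)},\dots,Y_s^{(X)})$, with $\mathcal L(A_t,B_t)=\mathcal L(A_1,B_1)$ for $t\ge 1$ and $\mathcal L(A_t,B_t)=\mathcal L(A_{-1},B_{-1})$ for $t\le -1$, where the laws $\mathcal L(A_1,B_1)$ and $\mathcal L(A_{-1},B_{-1})$ are those defined in the context.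
   Context: Setting: $s\ge 1$ is an integer, $\mathbb S$ is a separable metric space with its Borel $\sigma$-algebra, $(\epsilon_t)_{t\in\mathbb Z}$ is an i.i.d. sequence of $\mathbb S$-valued random variables, $\Phi:\mathbb R\times\mathbb S\to\mathbb R$ and $\Psi:\mathbb R\times\mathbb S^{s}\to\mathbb R$ are measurable, and for every $r\in\mathbb Z$ the innovations $(\epsilon_t)_{t>r}$ are independent of $(Y_t)_{t\le r}$. Conventions: $\operatorname{sign}(w)=1$ if $w\ge 0$ and $-1$ if $w<0$; $(x)_+=\max(x,0)$ and $(x)_+^\alpha=((x)_+)^\alpha$. Condition 1: there are $\alpha>0$, $p,p'\in[0,1]$ and $C\in(0,\infty)$ with (1.a) $\lim_{x\to\infty}P(|Y_0|>ux)/P(|Y_0|>x)=u^{-\alpha}$ for all $u>0$ and $\lim_{x\to\infty}P(Y_0>x)/P(|Y_0|>x)=p$; (1.b) $\lim_{x\to\infty}P(|X_0|>ux)/P(|X_0|>x)=u^{-\alpha}$ for all $u>0$ and $\lim_{x\to\infty}P(X_0>x)/P(|X_0|>x)=p'$; and $\lim_{x\to\infty}P(|X_0|>x)/P(|Y_0|>x)=C$. Condition 2: (2.a) there is a function $\phi:\mathbb S\times\{-1,1\}\to\mathbb R$ such that $\lim_{y\to\infty}\Phi(y\,w(y),v(y))/y=w\,\phi(v,\operatorname{sign}(w))$ whenever $w(y)\to w\in\mathbb R$ and $v(y)\to v\in\mathbb S$; (2.b) there is a function $\psi:\mathbb S^s\times\{-1,1\}\to\mathbb R$ such that $\lim_{y\to\infty}\Psi(y\,w(y),v(y))/y=w\,\psi(v,\operatorname{sign}(w))$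 whenever $w(y)\to w\in\mathbb R$ and $v(y)\to v\in\mathbb S^s$. Condition 3: there is a random vector $(Y_0^{(X)},\dots,Y_s^{(X)})$ such that $\mathcal L(Y_0/x,\dots,Y_s/x\mid|X_0|>x)$ converges weakly to $\mathcal L(Y_0^{(X)},\dots,Y_s^{(X)})$ as $x\to\infty$. The laws of $(A_{\pm1},B_{\pm1})$: let $M_0$ and $\epsilon_1^{(Y)}$ be independent with $P(M_0=1)=p=1-P(M_0=-1)$ and $\mathcal L(\epsilon_1^{(Y)})=\mathcal L(\epsilon_1)$, and let $M_1=M_0\,\phi(\epsilon_1^{(Y)},\operatorname{sign}(M_0))$. Let $M_{-1}$ be a random variable such that the law of $(M_0,M_{-1})$ is adjoint to that of $(M_0,M_1)$, i.e. $$E\left(\min\left((xM_0)_+^\alpha,(yM_1)_+^\alpha\right)\right)=E\left(\min\left((xM_{-1})_+^\alpha,(yM_0)_+^\alpha\right)\right)\quad\forall x,y\in\mathbb R.$$ (Known fact: under Conditions 1.a and 2.a and stationarity such a law exists and is unique; for $\sigma\in\{-1,1\}$ with $P(M_0=\sigma)>0$ and suitable $f$ it is given by $E(f(M_{-1}/M_0)\mid M_0=\sigma)=P(M_0=\sigma)^{-1}E(f(M_0/M_1)(\sigma M_1)_+^\alpha)+[1-P(M_0=\sigma)^{-1}E((\sigma M_1)_+^\alpha)]f(0)$, the first expectand being $0$ where $M_1=0$.) Then $A_1,B_1$ are independent with $\mathcal L(A_1)=\mathcal L(M_1/M_0\mid M_0=1)$, $\mathcal L(B_1)=\mathcal L(M_1/M_0\mid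 M_0=-1)$, and $A_{-1},B_{-1}$ are independent with $\mathcal L(A_{-1})=\mathcal L(M_{-1}/M_0\mid M_0=1)$, $\mathcal L(B_{-1})=\mathcal L(M_{-1}/M_0\mid M_0=-1)$. If $P(M_0=1)=0$ (resp. $P(M_0=-1)=0$), the laws of $A_{\pm1}$ (resp. $B_{\pm1}$) may be chosen arbitrarily. *)

theory Defs
  imports "HOL-Probability.Probability"
begin

text \<open>Vectors indexed by a set \<open>I\<close> are extensional functions on \<open>I\<close>.  Thus \<open>\<real>\<^sup>I\<close> carries the topology
  \<^term>\<open>product_topology (\<lambda>_. euclideanreal) I\<close> and the \<open>\<sigma>\<close>-algebra of \<^term>\<open>PiM I (\<lambda>_. borel)\<close>,
  which is its Borel \<open>\<sigma>\<close>-algebra when \<open>I\<close> is countable; similarly for powers of a separable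
  metric space.\<close>

definition vec_of :: "'i set \<Rightarrow> ('i \<Rightarrow> 'a \<Rightarrow> 'b) \<Rightarrow> 'a \<Rightarrow> 'i \<Rightarrow> 'b" where
  "vec_of I Z \<omega> = (\<lambda>i\<in>I. Z i \<omega>)"

definition law_vec :: "'a measure \<Rightarrow> 'i set \<Rightarrow> ('i \<Rightarrow> 'a \<Rightarrow> real) \<Rightarrow> ('i \<Rightarrow> real) measure" where
  "law_vec M I Z = distr M (PiM I (\<lambda>_. borel)) (vec_of I Z)"

definition weakly_tendsto ::
    "'b topology \<Rightarrow> ('c \<Rightarrow> 'b measure) \<Rightarrow> 'b measure \<Rightarrow> 'c filter \<Rightarrow> bool" where
  "weakly_tendsto T \<mu> \<nu> F \<longleftrightarrow>
     (\<forall>f :: 'b \<Rightarrow> real. continuous_map T euclideanreal f \<longrightarrow> bounded (f ` topspace T) \<longrightarrow>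
        ((\<lambda>x. \<integral>z. f z \<partial>\<mu> x) \<longlongrightarrow> (\<integral>z. f z \<partial>\<nu>)) F)"

text \<open>The integrals in \<^const>\<open>weakly_tendsto\<close> are genuine for laws on \<open>\<real>\<^sup>I\<close>: test functions are measurable.\<close>

lemma continuous_map_imp_measurable_PiM:
  fixes f :: "('i :: countable \<Rightarrow> real) \<Rightarrow> real"
  assumes "continuous_map (product_topology (\<lambda>_. euclideanreal) I) euclideanreal f"
  shows "f \<in> borel_measurable (PiM I (\<lambda>_. borel))"
proof -
  have "continuous_map (product_topology (\<lambda>_. euclideanreal) UNIV)
      (product_topology (\<lambda>_. euclideanreal) I) (\<lambda>z. restrict z I)"
    by (auto simp: continuous_map_componentwise intro: continuous_map_product_projection)
  from continuous_map_compose[OF this assms]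
  have "continuous_on UNIV (\<lambda>z. f (restrict z I))"
    by (simp add: euclidean_product_topology o_def)
  then have "(\<lambda>z. f (restrict z I)) \<in> borel_measurable (PiM UNIV (\<lambda>_. borel))"
    using borel_measurable_continuous_onI sets_PiM_equal_borel measurable_cong_sets by blast
  moreover have "(\<lambda>z i. if i \<in> I then z i else 0) \<in> PiM I (\<lambda>_. borel) \<rightarrow>\<^sub>M PiM UNIV (\<lambda>_. borel :: real measure)"
  proof (rule measurable_PiM_single')
    show "(\<lambda>z. if i \<in> I then z i else 0) \<in> PiM I (\<lambda>_. borel) \<rightarrow>\<^sub>M (borel :: real measure)" for i
      by (cases "i \<in> I") auto
  qed auto
  ultimately have "(\<lambda>z. f (restrict (\<lambda>i. if i \<in> I then z i else 0) I)) \<in> borel_measurable (PiM I (\<lambda>_. borel))"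
    by (rule measurable_compose[rotated])
  moreover have "restrict (\<lambda>i. if i \<in> I then z i else 0) I = z" if "z \<in> space (PiM I (\<lambda>_. borel))" for z :: "'i \<Rightarrow> real"
    using that by (auto simp: space_PiM PiE_def extensional_def fun_eq_iff)
  ultimately show ?thesis
    by (simp cong: measurable_cong)
qed

definition stationary :: "'a measure \<Rightarrow> (int \<Rightarrow> 'a \<Rightarrow> real) \<Rightarrow> bool" where
  "stationary M Z \<longleftrightarrow>
     (\<forall>t. Z t \<in> borel_measurable M) \<and>
     (\<forall>h. law_vec M UNIV (\<lambda>t. Z (t + h)) = law_vec M UNIV Z)"

text \<open>The library's \<^const>\<open>prob_space.indep_var\<close> requires both variables to take values in the same type.\<close>

definition indep_rv ::
    "'a measure \<Rightarrow> 'b measure \<Rightarrow> ('a \<Rightarrow> 'b) \<Rightarrow> 'c measure \<Rightarrow> ('a \<Rightarrow> 'c) \<Rightarrow> bool" where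
  "indep_rv M S U T V \<longleftrightarrow>
     U \<in> measurable M S \<and> V \<in> measurable M T \<and>
     prob_space.indep_set M {U -` A \<inter> space M | A. A \<in> sets S} {V -` A \<inter> space M | A. A \<in> sets T}"

definition iid :: "'a measure \<Rightarrow> (int \<Rightarrow> 'a \<Rightarrow> 's :: topological_space) \<Rightarrow> bool" where
  "iid M \<epsilon> \<longleftrightarrow>
     prob_space.indep_vars M (\<lambda>_. borel) \<epsilon> UNIV \<and>
     (\<forall>t. distr M borel (\<epsilon> t) = distr M borel (\<epsilon> 0))"

text \<open>Unlike \<^const>\<open>sgn\<close>, this has value 1 at 0.\<close>

definition sign_ge :: "real \<Rightarrow> real" where
  "sign_ge w = (if w \<ge> 0 then 1 else -1)"

definition pos_powr :: "real \<Rightarrow> real \<Rightarrow> real" where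
  "pos_powr x \<alpha> = max x 0 powr \<alpha>"

definition regularly_varying_tails :: "'a measure \<Rightarrow> ('a \<Rightarrow> real) \<Rightarrow> real \<Rightarrow> real \<Rightarrow> bool" where
  "regularly_varying_tails M Z \<alpha> p \<longleftrightarrow>
     (\<forall>u>0. ((\<lambda>x. \<P>(\<omega> in M. \<bar>Z \<omega>\<bar> > u * x) / \<P>(\<omega> in M. \<bar>Z \<omega>\<bar> > x)) \<longlongrightarrow> u powr (- \<alpha>)) at_top) \<and>
     ((\<lambda>x. \<P>(\<omega> in M. Z \<omega> > x) / \<P>(\<omega> in M. \<bar>Z \<omega>\<bar> > x)) \<longlongrightarrow> p) at_top"

text \<open>The limit function \<open>g\<close> stands for a function on \<open>T \<times> {-1, 1}\<close>: its second argument is a sign.\<close>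

definition asymptotically_homogeneous ::
    "'v topology \<Rightarrow> (real \<Rightarrow> 'v \<Rightarrow> real) \<Rightarrow> ('v \<Rightarrow> real \<Rightarrow> real) \<Rightarrow> bool" where
  "asymptotically_homogeneous T G g \<longleftrightarrow>
     (\<forall>w v w0 v0. (w \<longlongrightarrow> w0) at_top \<longrightarrow> limitin T v v0 at_top \<longrightarrow>
        ((\<lambda>y. G (y * w y) (v y) / y) \<longlongrightarrow> w0 * g v0 (sign_ge w0)) at_top)"

text \<open>A junk value if the event \<open>E\<close> is null.  In \<open>exceedance_limit\<close> below this is harmless: regularly
  varying tails are positive.\<close>

definition cond_law :: "'a measure \<Rightarrow> 'a set \<Rightarrow> 'b measure \<Rightarrow> ('a \<Rightarrow> 'b) \<Rightarrow> 'b measure" where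
  "cond_law M E S U = distr (uniform_measure M E) S U"

text \<open>Weak convergence of the conditional laws of \<open>(Y\<^sub>i / x)\<^sub>i\<close> given \<open>|X\<^sub>0| > x\<close>, with \<open>i\<close> ranging over \<open>I\<close>,
  as \<open>x\<close> tends to infinity, to the law of \<open>(Z\<^sub>i)\<^sub>i\<close>, which may live on another probability space.\<close>

definition exceedance_limit ::
    "'a measure \<Rightarrow> (int \<Rightarrow> 'a \<Rightarrow> real) \<Rightarrow> (int \<Rightarrow> 'a \<Rightarrow> real) \<Rightarrow> int set \<Rightarrow>
     'b measure \<Rightarrow> (int \<Rightarrow> 'b \<Rightarrow> real) \<Rightarrow> bool" where
  "exceedance_limit M X Y I N Z \<longleftrightarrow>
     weakly_tendsto (product_topology (\<lambda>_. euclideanreal) I)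
       (\<lambda>x. cond_law M {\<omega> \<in> space M. \<bar>X 0 \<omega>\<bar> > x} (PiM I (\<lambda>_. borel)) (vec_of I (\<lambda>i \<omega>. Y i \<omega> / x)))
       (law_vec N I Z) at_top"

definition adjoint_law ::
    "'a measure \<Rightarrow> real \<Rightarrow> ('a \<Rightarrow> real) \<Rightarrow> ('a \<Rightarrow> real) \<Rightarrow> ('a \<Rightarrow> real) \<Rightarrow> bool" where
  "adjoint_law K \<alpha> M0 M1 Mneg \<longleftrightarrow>
     (\<forall>x y. (\<integral>\<omega>. min (pos_powr (x * M0 \<omega>) \<alpha>) (pos_powr (y * M1 \<omega>) \<alpha>) \<partial>K) =
            (\<integral>\<omega>. min (pos_powr (x * Mneg \<omega>) \<alpha>) (pos_powr (y * M0 \<omega>) \<alpha>) \<partial>K))"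

text \<open>\<open>A\<close> and \<open>B\<close> are independent, with the laws of \<open>M' / M0\<close> given \<open>M0 = 1\<close> and given \<open>M0 = -1\<close>
  respectively; a law is left arbitrary when its conditioning event is null.\<close>

definition ratio_laws ::
    "'b measure \<Rightarrow> ('b \<Rightarrow> real) \<Rightarrow> ('b \<Rightarrow> real) \<Rightarrow> 'a measure \<Rightarrow> ('a \<Rightarrow> real) \<Rightarrow> ('a \<Rightarrow> real) \<Rightarrow> bool" where
  "ratio_laws N A B K M0 M' \<longleftrightarrow>
     prob_space.indep_var N borel A borel B \<and>
     (\<P>(\<omega> in K. M0 \<omega> = 1) > 0 \<longrightarrow>
        distr N borel A = cond_law K {\<omega> \<in> space K. M0 \<omega> = 1} borel (\<lambda>\<omega>. M' \<omega> / M0 \<omega>)) \<and>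
     (\<P>(\<omega> in K. M0 \<omega> = -1) > 0 \<longrightarrow>
        distr N borel B = cond_law K {\<omega> \<in> space K. M0 \<omega> = -1} borel (\<lambda>\<omega>. M' \<omega> / M0 \<omega>))"

definition tail_step :: "real \<Rightarrow> real \<Rightarrow> real \<Rightarrow> real" where
  "tail_step y a b = y * (a * indicator {0<..} y + b * indicator {..<0} y)"

end

(*
  Split the test function on the coordinates {j-1..k} into the part that ignores coordinate j-1 and a
  part g that vanishes for small values of that coordinate.  All coordinates after j and X 0 are driven
  by Y j and future innovations, so the expectation of g and |X 0| > x (smoothed) is the expectation of
  a function of (Y (j-1), Y j) that is asymptotically homogeneous, and divided by P(|Y 0| > x) it
  converges to an integral over the tail measure, the law of z * (M0, M1) with z of Lebesgue density
  alpha z^(-alpha-1).  Adjointness says that (M0, M1) may be replaced by (Mneg, M0) away from the axes.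
  The resulting integral is also the limit of the expectation in which Y (j-1) is replaced by a backward
  tail step from Y j, and for that one the induction hypothesis applies.  The forward step is a
  continuous mapping argument, since the next innovation is independent of the conditioning event.

  Functions are integrated against converging laws by means of "continuous convergence"
  F_x(v_x) -> F_0(v_0) for x -> infinity and v_x -> v_0.
*)
theory Submission
  imports Defs
begin

text \<open>\<open>\<Phi>\<close> and \<open>\<Psi>\<close> are only measurable, so functions of the
  unscaled series are not continuous test functions. Condition 2 is exactly continuous convergence,
  and a mapping theorem for varying integrands replaces the usual one. Three cutoffs shape the
  backward step. \<open>g\<close> vanishes for small \<open>Y (j - 1) / x\<close>, since the tail
  measure is infinite near the origin. Small values of \<open>Y j / x\<close> are removed as well,
  because adjointness says nothing on the axes: the measure of \<open>(M0, M1)\<close> may charge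
  the axis where the second coordinate is 0, that of \<open>(Mneg, M0)\<close> cannot. The loss is
  small, since \<open>Y j / x\<close> near 0 forces \<open>X 0 / x\<close> near 0 in the limit,
  against \<open>|X 0| > x\<close>, and a tail step from 0 stays at 0. Finally, the indicator of
  \<open>|X 0| > x\<close> becomes a ramp, and regular variation of \<open>X 0\<close> bounds the
  error. \<open>C > 0\<close> relates the normalisations by the tails of \<open>X 0\<close> and
  \<open>Y 0\<close>. If \<open>M0 = 1\<close> is null, the law of \<open>A\<close> is arbitrary.
  Going forward, positive values of the last coordinate must then be shown to be null; going
  backward, the law of \<open>A\<close> enters with the factor \<open>p = 0\<close>. The same holds
  for \<open>B\<close> and \<open>1 - p\<close>.\<close>

section \<open>Continuous convergence and an extended mapping theorem\<close>

definition cconv :: "(real \<Rightarrow> 'a::topological_space \<Rightarrow> 'b::topological_space) \<Rightarrow> ('a \<Rightarrow> 'b) \<Rightarrow> bool" where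
  "cconv F F0 \<longleftrightarrow> (\<forall>(r :: nat \<Rightarrow> real) v v0. filterlim r at_top sequentially \<longrightarrow> v \<longlonglongrightarrow> v0 \<longrightarrow>
     (\<lambda>k. F (r k) (v k)) \<longlonglongrightarrow> F0 v0)"

lemma cconvD:
  "cconv F F0 \<Longrightarrow> filterlim r at_top sequentially \<Longrightarrow> v \<longlonglongrightarrow> v0 \<Longrightarrow> (\<lambda>k. F (r k) (v k)) \<longlonglongrightarrow> F0 v0"
  by (auto simp: cconv_def)

lemma cconv_pointwise: "cconv F F0 \<Longrightarrow> (\<lambda>k. F (real k) v) \<longlonglongrightarrow> F0 v"
  by (rule cconvD) (auto intro: filterlim_real_sequentially)

lemma cconv_limit_bounded:
  fixes F :: "real \<Rightarrow> 'a::topological_space \<Rightarrow> real"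
  assumes "cconv F F0" "\<And>r v. \<bar>F r v\<bar> \<le> B"
  shows "\<bar>F0 v\<bar> \<le> B"
  by (rule LIMSEQ_le_const2[OF tendsto_rabs[OF cconv_pointwise[OF assms(1)]]]) (use assms(2) in auto)

text \<open>Limit functions are pointwise limits of measurable ones; their measurability is obtained
  here each time instead of being assumed.\<close>

lemma cconv_limit_measurable:
  fixes F :: "real \<Rightarrow> 'a::topological_space \<Rightarrow> real"
  assumes "cconv F F0" "\<And>r. F r \<in> borel_measurable S"
  shows "F0 \<in> borel_measurable S"
  by (rule borel_measurable_LIMSEQ_real[OF cconv_pointwise[OF assms(1)] assms(2)])

text \<open>\<open>L k\<close> is the inf-convolution of all \<open>F (r n)\<close> with
  \<open>n \<ge> k\<close> and the cone of slope \<open>k\<close>. An infimum of such cones is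
  \<open>k\<close>-Lipschitz, and it lies below each of these functions. Slope and starting index
  grow together, so near-minimisers move both to \<open>v\<close> and to infinity in the index, and
  continuous convergence identifies the limit.\<close>

lemma inf_conv_approx:
  fixes F :: "real \<Rightarrow> 'a::metric_space \<Rightarrow> real"
  assumes cc: "cconv F F0" and B: "\<And>r v. \<bar>F r v\<bar> \<le> B" and r: "filterlim r at_top sequentially"
  obtains L :: "nat \<Rightarrow> 'a \<Rightarrow> real"
  where "\<And>k v. \<bar>L k v\<bar> \<le> B" "\<And>k. (real k)-lipschitz_on UNIV (L k)"
    "\<And>k n v. k \<le> n \<Longrightarrow> L k v \<le> F (r n) v" "\<And>v. (\<lambda>k. L k v) \<longlonglongrightarrow> F0 v"
proof -
  define S where "S k v = (\<lambda>(n,w). F (r n) w + real k * dist v w) ` ({k..} \<times> UNIV)" for k v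
  define L where "L k v = Inf (S k v)" for k v
  have ne: "S k v \<noteq> {}" for k v by (auto simp: S_def)
  have lbd: "-B \<le> y" if "y \<in> S k v" for y k v
  proof -
    from that obtain n w where y: "y = F (r n) w + real k * dist v w" by (auto simp: S_def)
    have "- B \<le> F (r n) w" using B[of "r n" w] by linarith
    moreover have "0 \<le> real k * dist v w" by simp
    ultimately show ?thesis using y by linarith
  qed
  have bdd: "bdd_below (S k v)" for k v using lbd by (meson bdd_below.I)
  have low: "L k v \<le> F (r n) w + real k * dist v w" if "k \<le> n" for k n v w
    unfolding L_def using that by (intro cInf_lower bdd) (auto simp: S_def)
  have 3: "L k v \<le> F (r n) v" if "k \<le> n" for k n v using low[OF that, of v v] by simp
  have 1: "\<bar>L k v\<bar> \<le> B" for k v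
  proof -
    have "-B \<le> L k v" unfolding L_def using ne lbd by (intro cInf_greatest) auto
    moreover have "L k v \<le> F (r k) v" using 3 by simp
    ultimately show ?thesis using B[of "r k" v] by linarith
  qed
  have lip: "L k v \<le> L k v' + real k * dist v v'" for k v v'
  proof -
    have "L k v - real k * dist v v' \<le> L k v'" unfolding L_def[of k v']
    proof (intro cInf_greatest ne)
      fix y assume "y \<in> S k v'"
      then obtain n w where nw: "k \<le> n" "y = F (r n) w + real k * dist v' w" by (auto simp: S_def)
      have "L k v \<le> F (r n) w + real k * dist v w" by (rule low) fact
      also have "real k * dist v w \<le> real k * (dist v v' + dist v' w)"
        by (intro mult_left_mono dist_triangle) auto
      finally show "L k v - real k * dist v v' \<le> y" using nw by (simp add: algebra_simps)
    qed
    then show ?thesis by simp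
  qed
  have 2: "(real k)-lipschitz_on UNIV (L k)" for k
  proof (rule lipschitz_onI)
    show "dist (L k x) (L k y) \<le> real k * dist x y" for x y
      using lip[of k x y] lip[of k y x] by (auto simp: dist_real_def dist_commute)
  qed simp
  have 4: "(\<lambda>k. L k v) \<longlonglongrightarrow> F0 v" for v
  proof -
    have "\<exists>n w. k \<le> n \<and> F (r n) w + real k * dist v w < L k v + 1 / (real k + 1)" for k
    proof -
      have "Inf (S k v) < L k v + 1 / (real k + 1)" by (simp add: L_def)
      from cInf_lessD[OF ne this] show ?thesis by (auto simp: S_def)
    qed
    then obtain n w where nw: "\<And>k. k \<le> n k"
      "\<And>k. F (r (n k)) (w k) + real k * dist v (w k) < L k v + 1 / (real k + 1)" by metis
    have "filterlim n at_top sequentially"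
      by (rule filterlim_at_top_mono[OF filterlim_ident]) (use nw in auto)
    then have rn: "filterlim (\<lambda>k. r (n k)) at_top sequentially" by (rule filterlim_compose[OF r])
    \<comment> \<open>All values of \<open>F\<close> lie within \<open>B\<close> of 0, so a
      near-minimiser can afford a penalty of at most \<open>2*B + 1\<close>; the slope
      \<open>k\<close> turns this into a distance.\<close>
    have d: "dist v (w k) \<le> (2*B+1) / real k" if "k > 0" for k
    proof -
      have "real k * dist v (w k) \<le> 2*B + 1/(real k + 1)"
        using nw(2)[of k] B[of "r (n k)" "w k"] 1[of k v] by linarith
      also have "\<dots> \<le> 2*B+1" by (simp add: field_simps)
      finally show ?thesis using that by (simp add: field_simps)
    qed
    have "(\<lambda>k. dist (w k) v) \<longlonglongrightarrow> 0"
    proof (rule tendsto_sandwich[where f="\<lambda>_. 0" and h="\<lambda>k. (2*B+1) / real k"])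
      show "\<forall>\<^sub>F k in sequentially. dist (w k) v \<le> (2*B+1) / real k"
        using d by (intro eventually_sequentiallyI[of 1]) (auto simp: dist_commute)
      show "(\<lambda>k. (2 * B + 1) / real k) \<longlonglongrightarrow> 0" by (rule lim_const_over_n)
    qed auto
    then have "w \<longlonglongrightarrow> v" by (rule tendsto_dist_iff[THEN iffD2])
    from cconvD[OF cc rn this] have F: "(\<lambda>k. F (r (n k)) (w k)) \<longlonglongrightarrow> F0 v" .
    have one: "(\<lambda>k. 1 / (real k + 1)) \<longlonglongrightarrow> 0"
      using LIMSEQ_inverse_real_of_nat by (simp add: inverse_eq_divide add.commute)
    show ?thesis
    proof (rule tendsto_sandwich[where f="\<lambda>k. F (r (n k)) (w k) - 1/(real k + 1)" and h="\<lambda>k. F (r k) v"])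
      show "(\<lambda>k. F (r (n k)) (w k) - 1/(real k + 1)) \<longlonglongrightarrow> F0 v"
        using tendsto_diff[OF F one] by simp
      show "(\<lambda>k. F (r k) v) \<longlonglongrightarrow> F0 v" by (rule cconvD[OF cc r]) simp
      have "F (r (n k)) (w k) - 1 / (real k + 1) \<le> L k v" for k
      proof -
        have "0 \<le> real k * dist v (w k)" by simp
        then show ?thesis using nw(2)[of k] by linarith
      qed
      then show "\<forall>\<^sub>F k in sequentially. F (r (n k)) (w k) - 1 / (real k + 1) \<le> L k v" by auto
      show "\<forall>\<^sub>F k in sequentially. L k v \<le> F (r k) v" using 3 by auto
    qed
  qed
  show ?thesis using that[of L] 1 2 3 4 by blast
qed

lemma lipschitz_borel: "C-lipschitz_on UNIV (f :: 'a::metric_space \<Rightarrow> real) \<Longrightarrow> f \<in> borel_measurable borel"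
  using lipschitz_on_continuous_on borel_measurable_continuous_onI by blast

text \<open>Half of a portmanteau argument: a Lipschitz minorant \<open>L k\<close> loses less than
  \<open>e\<close> under \<open>\<nu>\<close> by dominated convergence, and weak convergence applies
  to it for this fixed \<open>k\<close>. Lipschitz test functions are demanded because the minorants
  are of this kind.\<close>

lemma ext_mapping_lower:
  fixes F :: "real \<Rightarrow> 'a::metric_space \<Rightarrow> real" and \<mu> :: "nat \<Rightarrow> 'a measure"
  assumes weak: "\<And>(f :: 'a \<Rightarrow> real) C. C-lipschitz_on UNIV f \<Longrightarrow> bounded (range f) \<Longrightarrow>
      (\<lambda>n. \<integral>z. f z \<partial>\<mu> n) \<longlonglongrightarrow> (\<integral>z. f z \<partial>\<nu>)"
    and \<mu>: "\<And>n. prob_space (\<mu> n)" "\<And>n. sets (\<mu> n) = sets borel"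
    and \<nu>: "prob_space \<nu>" "sets \<nu> = sets borel"
    and cc: "cconv F F0" and B: "\<And>r v. \<bar>F r v\<bar> \<le> B" and r: "filterlim r at_top sequentially"
    and F: "\<And>r. F r \<in> borel_measurable borel" and e: "e > 0"
  shows "\<forall>\<^sub>F n in sequentially. (\<integral>z. F0 z \<partial>\<nu>) - e < (\<integral>z. F (r n) z \<partial>\<mu> n)"
proof -
  interpret \<nu>: prob_space \<nu> by fact
  obtain L :: "nat \<Rightarrow> 'a \<Rightarrow> real"
  where L: "\<And>k v. \<bar>L k v\<bar> \<le> B" "\<And>k. (real k)-lipschitz_on UNIV (L k)"
    "\<And>k n v. k \<le> n \<Longrightarrow> L k v \<le> F (r n) v" "\<And>v. (\<lambda>k. L k v) \<longlonglongrightarrow> F0 v"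
    using inf_conv_approx[OF cc B r] by metis
  have Lm: "L k \<in> borel_measurable borel" for k by (rule lipschitz_borel[OF L(2)])
  have [measurable]: "L k \<in> borel_measurable \<nu>" "F0 \<in> borel_measurable \<nu>" for k
    using Lm cconv_limit_measurable[OF cc F] by (auto simp: measurable_cong_sets[OF \<nu>(2) refl])
  have "(\<lambda>k. \<integral>z. L k z \<partial>\<nu>) \<longlonglongrightarrow> (\<integral>z. F0 z \<partial>\<nu>)"
    by (rule integral_dominated_convergence[where w = "\<lambda>_. B"]) (use L in auto)
  then have "\<forall>\<^sub>F k in sequentially. (\<integral>z. F0 z \<partial>\<nu>) - e < (\<integral>z. L k z \<partial>\<nu>)"
    using e by (intro order_tendstoD) auto
  then obtain k where k: "(\<integral>z. F0 z \<partial>\<nu>) - e < (\<integral>z. L k z \<partial>\<nu>)"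
    by (auto simp: eventually_sequentially)
  have "(\<lambda>n. \<integral>z. L k z \<partial>\<mu> n) \<longlonglongrightarrow> (\<integral>z. L k z \<partial>\<nu>)"
    by (rule weak[OF L(2)]) (use L(1) in \<open>auto simp: bounded_iff\<close>)
  from order_tendstoD(1)[OF this k]
  have "\<forall>\<^sub>F n in sequentially. (\<integral>z. F0 z \<partial>\<nu>) - e < (\<integral>z. L k z \<partial>\<mu> n)" .
  moreover have "\<forall>\<^sub>F n in sequentially. (\<integral>z. L k z \<partial>\<mu> n) \<le> (\<integral>z. F (r n) z \<partial>\<mu> n)"
  proof (rule eventually_sequentiallyI[of k])
    fix n assume "k \<le> n"
    interpret p: prob_space "\<mu> n" by fact
    show "(\<integral>z. L k z \<partial>\<mu> n) \<le> (\<integral>z. F (r n) z \<partial>\<mu> n)"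
    proof (rule integral_mono)
      show "integrable (\<mu> n) (L k)" using L(1) Lm
        by (intro p.integrable_const_bound[of _ B]) (auto simp: measurable_cong_sets[OF \<mu>(2) refl])
      show "integrable (\<mu> n) (F (r n))" using B F
        by (intro p.integrable_const_bound[of _ B]) (auto simp: measurable_cong_sets[OF \<mu>(2) refl])
    qed (use L(3)[OF \<open>k \<le> n\<close>] in auto)
  qed
  ultimately show ?thesis by eventually_elim linarith
qed

text \<open>Integrand and law both vary with \<open>n\<close>. The lower bound, applied also to the
  negated functions, gives the matching upper bound.\<close>

lemma ext_mapping:
  fixes F :: "real \<Rightarrow> 'a::metric_space \<Rightarrow> real" and \<mu> :: "nat \<Rightarrow> 'a measure"
  assumes weak: "\<And>(f :: 'a \<Rightarrow> real) C. C-lipschitz_on UNIV f \<Longrightarrow> bounded (range f) \<Longrightarrow>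
      (\<lambda>n. \<integral>z. f z \<partial>\<mu> n) \<longlonglongrightarrow> (\<integral>z. f z \<partial>\<nu>)"
    and \<mu>: "\<And>n. prob_space (\<mu> n)" "\<And>n. sets (\<mu> n) = sets borel"
    and \<nu>: "prob_space \<nu>" "sets \<nu> = sets borel"
    and cc: "cconv F F0" and B: "\<And>r v. \<bar>F r v\<bar> \<le> B" and r: "filterlim r at_top sequentially"
    and F: "\<And>r. F r \<in> borel_measurable borel"
  shows "(\<lambda>n. \<integral>z. F (r n) z \<partial>\<mu> n) \<longlonglongrightarrow> (\<integral>z. F0 z \<partial>\<nu>)"
proof -
  have cc': "cconv (\<lambda>r v. - F r v) (\<lambda>v. - F0 v)"
    using cc unfolding cconv_def by (auto intro: tendsto_minus)
  have u: "\<forall>\<^sub>F n in sequentially. (\<integral>z. F (r n) z \<partial>\<mu> n) < (\<integral>z. F0 z \<partial>\<nu>) + e" if "e > 0" for e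
    proof -
    have "\<forall>\<^sub>F n in sequentially. (\<integral>z. - F0 z \<partial>\<nu>) - e < (\<integral>z. - F (r n) z \<partial>\<mu> n)"
      by (rule ext_mapping_lower[OF weak \<mu> \<nu> cc' _ r _ that]) (use B F in auto)
    then show ?thesis by eventually_elim simp
  qed
  have l: "\<forall>\<^sub>F n in sequentially. (\<integral>z. F0 z \<partial>\<nu>) - e < (\<integral>z. F (r n) z \<partial>\<mu> n)" if "e > 0" for e
    by (rule ext_mapping_lower[OF weak \<mu> \<nu> cc B r F that])
  show ?thesis
  proof (rule order_tendstoI)
    show "\<forall>\<^sub>F n in sequentially. a < (\<integral>z. F (r n) z \<partial>\<mu> n)" if "a < (\<integral>z. F0 z \<partial>\<nu>)" for a
      using l[of "(\<integral>z. F0 z \<partial>\<nu>) - a"] that by simp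
    show "\<forall>\<^sub>F n in sequentially. (\<integral>z. F (r n) z \<partial>\<mu> n) < a" if "(\<integral>z. F0 z \<partial>\<nu>) < a" for a
      using u[of "a - (\<integral>z. F0 z \<partial>\<nu>)"] that by simp
  qed
qed

lemma cconv_const: "continuous_on UNIV f \<Longrightarrow> cconv (\<lambda>_. f) f"
  unfolding cconv_def by (auto intro: continuous_on_tendsto_compose[where s=UNIV])

lemma cconv_compose:
  assumes "cconv G G0" "cconv F F0"
  shows "cconv (\<lambda>x v. G x (F x v)) (\<lambda>v. G0 (F0 v))"
  using assms unfolding cconv_def by blast

lemma cconv_Pair:
  assumes "cconv F F0" "cconv G G0"
  shows "cconv (\<lambda>x v. (F x v, G x v)) (\<lambda>v. (F0 v, G0 v))"
  using assms unfolding cconv_def by (auto intro!: tendsto_Pair)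

lemma cconv_mult:
  fixes F G :: "real \<Rightarrow> 'a::topological_space \<Rightarrow> real"
  assumes "cconv F F0" "cconv G G0"
  shows "cconv (\<lambda>x v. F x v * G x v) (\<lambda>v. F0 v * G0 v)"
  using assms unfolding cconv_def by (auto intro!: tendsto_mult)

text \<open>This is how innovations and random pairs are averaged out: convergence for each fixed
  value passes to the mean by dominated convergence.\<close>

lemma cconv_integral:
  fixes F :: "'w \<Rightarrow> real \<Rightarrow> 'a::topological_space \<Rightarrow> real"
  assumes "prob_space M" and cc: "\<And>\<omega>. \<omega> \<in> space M \<Longrightarrow> cconv (F \<omega>) (F0 \<omega>)" and B: "\<And>\<omega> x v. \<bar>F \<omega> x v\<bar> \<le> B"
    and meas: "\<And>x v. (\<lambda>\<omega>. F \<omega> x v) \<in> borel_measurable M"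
  shows "cconv (\<lambda>x v. \<integral>\<omega>. F \<omega> x v \<partial>M) (\<lambda>v. \<integral>\<omega>. F0 \<omega> v \<partial>M)"
  unfolding cconv_def
proof (intro allI impI)
  interpret prob_space M by fact
  fix r :: "nat \<Rightarrow> real" and v :: "nat \<Rightarrow> 'a" and v0 assume r: "filterlim r at_top sequentially" "v \<longlonglongrightarrow> v0"
  have m0: "(\<lambda>\<omega>. F0 \<omega> v0) \<in> borel_measurable M"
    by (rule borel_measurable_LIMSEQ_real[OF cconv_pointwise[OF cc] meas])
  show "(\<lambda>k. \<integral>\<omega>. F \<omega> (r k) (v k) \<partial>M) \<longlonglongrightarrow> (\<integral>\<omega>. F0 \<omega> v0 \<partial>M)"
    by (rule integral_dominated_convergence[where w = "\<lambda>_. B"])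
      (use m0 meas B cconvD[OF cc r] in auto)
qed

lemma tendsto_fun_iff:
  fixes f :: "'c \<Rightarrow> 'i \<Rightarrow> 'b::topological_space"
  shows "(f \<longlongrightarrow> l) F \<longleftrightarrow> (\<forall>i. ((\<lambda>c. f c i) \<longlongrightarrow> l i) F)"
  using limitin_componentwise[of "\<lambda>_. euclidean" UNIV f l F]
  by (simp add: euclidean_product_topology)

lemma cconv_fun:
  fixes F :: "real \<Rightarrow> 'a::topological_space \<Rightarrow> 'i \<Rightarrow> 'b::topological_space"
  assumes "\<And>i. cconv (\<lambda>x v. F x v i) (\<lambda>v. F0 v i)"
  shows "cconv F F0"
  using assms unfolding cconv_def by (auto simp: tendsto_fun_iff)

section \<open>Independence\<close>

lemma indep_rv_iff:
  assumes "prob_space M"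
  shows "indep_rv M S U T V \<longleftrightarrow> U \<in> measurable M S \<and> V \<in> measurable M T \<and>
    (\<forall>A\<in>sets S. \<forall>B\<in>sets T. measure M {\<omega>\<in>space M. U \<omega> \<in> A \<and> V \<omega> \<in> B} =
        measure M {\<omega>\<in>space M. U \<omega> \<in> A} * measure M {\<omega>\<in>space M. V \<omega> \<in> B})"
proof -
  interpret prob_space M by fact
  have eq: "(U -` A \<inter> space M) \<inter> (V -` B \<inter> space M) = {\<omega>\<in>space M. U \<omega> \<in> A \<and> V \<omega> \<in> B}"
    "U -` A \<inter> space M = {\<omega>\<in>space M. U \<omega> \<in> A}" "V -` B \<inter> space M = {\<omega>\<in>space M. V \<omega> \<in> B}" for A B by auto
  show ?thesis
  proof (cases "U \<in> measurable M S \<and> V \<in> measurable M T")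
    case True
    then have [measurable]: "U \<in> measurable M S" "V \<in> measurable M T" by auto
    have "indep_set {U -` A \<inter> space M | A. A \<in> sets S} {V -` A \<inter> space M | A. A \<in> sets T} \<longleftrightarrow>
       (\<forall>A\<in>sets S. \<forall>B\<in>sets T. prob ((U -` A \<inter> space M) \<inter> (V -` B \<inter> space M)) =
        prob (U -` A \<inter> space M) * prob (V -` B \<inter> space M))"
      unfolding indep_sets2_eq by (auto; blast)
    then show ?thesis unfolding indep_rv_def using True unfolding eq(1) by (simp add: eq(2,3))
  qed (auto simp: indep_rv_def)
qed

lemma indep_rv_distr:
  assumes "prob_space M" "indep_rv M S U T V"
  shows "distr M (S \<Otimes>\<^sub>M T) (\<lambda>\<omega>. (U \<omega>, V \<omega>)) = distr M S U \<Otimes>\<^sub>M distr M T V"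
proof -
  interpret prob_space M by fact
  have [measurable]: "U \<in> measurable M S" "V \<in> measurable M T" using assms(2) by (auto simp: indep_rv_def)
  show ?thesis
  proof (rule pair_measure_eqI[symmetric])
    show "sigma_finite_measure (distr M S U)" "sigma_finite_measure (distr M T V)"
      by (auto intro!: prob_space_imp_sigma_finite prob_space_distr)
    fix A B assume "A \<in> sets (distr M S U)" "B \<in> sets (distr M T V)"
    then have [measurable]: "A \<in> sets S" "B \<in> sets T" by auto
    have *: "(\<lambda>\<omega>. (U \<omega>, V \<omega>)) -` (A \<times> B) \<inter> space M = {\<omega>\<in>space M. U \<omega> \<in> A \<and> V \<omega> \<in> B}"
      "U -` A \<inter> space M = {\<omega>\<in>space M. U \<omega> \<in> A}" "V -` B \<inter> space M = {\<omega>\<in>space M. V \<omega> \<in> B}" by auto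
    show "emeasure (distr M S U) A * emeasure (distr M T V) B = emeasure (distr M (S \<Otimes>\<^sub>M T) (\<lambda>\<omega>. (U \<omega>, V \<omega>))) (A \<times> B)"
      using assms(2) unfolding indep_rv_iff[OF assms(1)]
      by (simp add: emeasure_distr * emeasure_eq_measure ennreal_mult[symmetric])
  qed simp
qed

text \<open>Fubini in the form used throughout: \<open>U\<close> is frozen while \<open>V\<close> is
  averaged over a second copy \<open>\<omega>'\<close> of the sample point.\<close>

lemma indep_rv_integral:
  fixes f :: "'b \<times> 'c \<Rightarrow> real"
  assumes "prob_space M" "indep_rv M S U T V" and f: "f \<in> borel_measurable (S \<Otimes>\<^sub>M T)"
    and B: "\<And>z. \<bar>f z\<bar> \<le> B"
  shows "(\<integral>\<omega>. f (U \<omega>, V \<omega>) \<partial>M) = (\<integral>\<omega>. (\<integral>\<omega>'. f (U \<omega>, V \<omega>') \<partial>M) \<partial>M)"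
proof -
  interpret prob_space M by fact
  note f[measurable]
  have [measurable]: "U \<in> measurable M S" "V \<in> measurable M T" using assms(2) by (auto simp: indep_rv_def)
  interpret A: prob_space "distr M S U" by (rule prob_space_distr) simp
  interpret B: prob_space "distr M T V" by (rule prob_space_distr) simp
  interpret P: pair_prob_space "distr M S U" "distr M T V" ..
  have "(\<integral>\<omega>. f (U \<omega>, V \<omega>) \<partial>M) = (\<integral>z. f z \<partial>distr M (S \<Otimes>\<^sub>M T) (\<lambda>\<omega>. (U \<omega>, V \<omega>)))"
    by (subst integral_distr) auto
  also have "\<dots> = (\<integral>z. f z \<partial>(distr M S U \<Otimes>\<^sub>M distr M T V))" by (simp add: indep_rv_distr[OF assms(1,2)])
  also have "\<dots> = (\<integral>u. (\<integral>v. f (u, v) \<partial>distr M T V) \<partial>distr M S U)"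
    by (rule P.integral_fst'[symmetric]) (auto intro!: P.integrable_const_bound[of _ B] simp: B)
  also have "\<dots> = (\<integral>u. (\<integral>\<omega>'. f (u, V \<omega>') \<partial>M) \<partial>distr M S U)"
    by (intro Bochner_Integration.integral_cong refl integral_distr) (auto simp: measurable_Pair2)
  also have "\<dots> = (\<integral>\<omega>. (\<integral>\<omega>'. f (U \<omega>, V \<omega>') \<partial>M) \<partial>M)"
    by (subst integral_distr) auto
  finally show ?thesis .
qed

lemma indep_rv_compose:
  assumes "prob_space M" "indep_rv M S U T V" "a \<in> measurable S S'" "b \<in> measurable T T'"
  shows "indep_rv M S' (\<lambda>\<omega>. a (U \<omega>)) T' (\<lambda>\<omega>. b (V \<omega>))"
proof -
  have [measurable]: "U \<in> measurable M S" "V \<in> measurable M T" using assms(2) by (auto simp: indep_rv_def)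
  note assms(3,4)[measurable]
  have "measure M {\<omega>\<in>space M. a (U \<omega>) \<in> A \<and> b (V \<omega>) \<in> B} =
        measure M {\<omega>\<in>space M. a (U \<omega>) \<in> A} * measure M {\<omega>\<in>space M. b (V \<omega>) \<in> B}"
    if "A \<in> sets S'" "B \<in> sets T'" for A B
  proof -
    have A: "a -` A \<inter> space S \<in> sets S" "b -` B \<inter> space T \<in> sets T" using that by measurable
    have eq: "{\<omega>\<in>space M. a (U \<omega>) \<in> A} = {\<omega>\<in>space M. U \<omega> \<in> a -` A \<inter> space S}"
      "{\<omega>\<in>space M. b (V \<omega>) \<in> B} = {\<omega>\<in>space M. V \<omega> \<in> b -` B \<inter> space T}"
      "{\<omega>\<in>space M. a (U \<omega>) \<in> A \<and> b (V \<omega>) \<in> B} = {\<omega>\<in>space M. U \<omega> \<in> a -` A \<inter> space S \<and> V \<omega> \<in> b -` B \<inter> space T}"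
      using measurable_space[of U M S] measurable_space[of V M T] by auto
    have "measure M {\<omega>\<in>space M. U \<omega> \<in> a -` A \<inter> space S \<and> V \<omega> \<in> b -` B \<inter> space T} =
        measure M {\<omega>\<in>space M. U \<omega> \<in> a -` A \<inter> space S} * measure M {\<omega>\<in>space M. V \<omega> \<in> b -` B \<inter> space T}"
      using assms(2) A unfolding indep_rv_iff[OF assms(1)] by blast
    then show ?thesis unfolding eq .
  qed
  then show ?thesis unfolding indep_rv_iff[OF assms(1)] by simp
qed

text \<open>The recursions hold only almost surely, so what is proved for the explicit functions of
  the innovations has to be carried over to \<open>Y\<close>, \<open>X 0\<close> and the limit
  process.\<close>

lemma indep_rv_AE:
  assumes "prob_space M" "indep_rv M S U T V" "U' \<in> measurable M S" "V' \<in> measurable M T"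
    "AE \<omega> in M. U' \<omega> = U \<omega>" "AE \<omega> in M. V' \<omega> = V \<omega>"
  shows "indep_rv M S U' T V'"
proof -
  have [measurable]: "U \<in> measurable M S" "V \<in> measurable M T" using assms(2) by (auto simp: indep_rv_def)
  note assms(3,4)[measurable]
  interpret prob_space M by fact
  have "measure M {\<omega>\<in>space M. U' \<omega> \<in> A \<and> V' \<omega> \<in> B} =
        measure M {\<omega>\<in>space M. U' \<omega> \<in> A} * measure M {\<omega>\<in>space M. V' \<omega> \<in> B}"
    if [measurable]: "A \<in> sets S" "B \<in> sets T" for A B
  proof -
    have "measure M {\<omega>\<in>space M. U' \<omega> \<in> A \<and> V' \<omega> \<in> B} = measure M {\<omega>\<in>space M. U \<omega> \<in> A \<and> V \<omega> \<in> B}"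
      "measure M {\<omega>\<in>space M. U' \<omega> \<in> A} = measure M {\<omega>\<in>space M. U \<omega> \<in> A}"
      "measure M {\<omega>\<in>space M. V' \<omega> \<in> B} = measure M {\<omega>\<in>space M. V \<omega> \<in> B}"
      using assms(5,6) by (auto intro!: finite_measure_eq_AE)
    then show ?thesis using assms(2) that unfolding indep_rv_iff[OF assms(1)] by simp
  qed
  then show ?thesis unfolding indep_rv_iff[OF assms(1)] by simp
qed

text \<open>Two rounds of Fubini on indicators, which avoids a generator argument on the product.
  The regrouping makes a fresh innovation, or a fresh pair of multipliers, independent of all that
  was built from the earlier ones.\<close>

lemma indep_rv_assoc:
  assumes "prob_space M" "indep_rv M S U (T1 \<Otimes>\<^sub>M T2) (\<lambda>\<omega>. (V1 \<omega>, V2 \<omega>))" "indep_rv M T1 V1 T2 V2"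
  shows "indep_rv M (S \<Otimes>\<^sub>M T1) (\<lambda>\<omega>. (U \<omega>, V1 \<omega>)) T2 V2"
proof -
  interpret prob_space M by fact
  have [measurable]: "U \<in> measurable M S" "V1 \<in> measurable M T1" "V2 \<in> measurable M T2"
    using assms(2,3) by (auto simp: indep_rv_def)
  have "measure M {\<omega>\<in>space M. (U \<omega>, V1 \<omega>) \<in> A \<and> V2 \<omega> \<in> B} =
        measure M {\<omega>\<in>space M. (U \<omega>, V1 \<omega>) \<in> A} * measure M {\<omega>\<in>space M. V2 \<omega> \<in> B}"
    if [measurable]: "A \<in> sets (S \<Otimes>\<^sub>M T1)" "B \<in> sets T2" for A B
  proof -
    have i1: "indep_rv M S U T1 V1"
      using indep_rv_compose[OF assms(1,2) measurable_ident measurable_fst] by simp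
    have "measure M {\<omega>\<in>space M. (U \<omega>, V1 \<omega>) \<in> A \<and> V2 \<omega> \<in> B} = (\<integral>\<omega>. indicator A (U \<omega>, V1 \<omega>) * indicator B (V2 \<omega>) \<partial>M)"
    proof -
      have "(\<integral>\<omega>. indicator A (U \<omega>, V1 \<omega>) * indicator B (V2 \<omega>) \<partial>M) =
         (\<integral>\<omega>. indicator {\<omega>\<in>space M. (U \<omega>, V1 \<omega>) \<in> A \<and> V2 \<omega> \<in> B} \<omega> \<partial>M :: real)"
        by (intro Bochner_Integration.integral_cong) (auto simp: indicator_def)
      then show ?thesis by simp
    qed
    also have "\<dots> = (\<integral>\<omega>. (\<lambda>(u,(v1,v2)). indicator A (u,v1) * indicator B v2) (U \<omega>, (V1 \<omega>, V2 \<omega>)) \<partial>M)" by simp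
    also have "\<dots> = (\<integral>\<omega>. (\<integral>\<omega>'. indicator A (U \<omega>, V1 \<omega>') * indicator B (V2 \<omega>') \<partial>M) \<partial>M)"
    proof -
      have "(\<lambda>(u,(v1,v2)). indicator A (u,v1) * indicator B v2 :: real) \<in> borel_measurable (S \<Otimes>\<^sub>M (T1 \<Otimes>\<^sub>M T2))"
        by measurable
      moreover have "\<bar>(\<lambda>(u,(v1,v2)). indicator A (u,v1) * indicator B v2 :: real) z\<bar> \<le> 1" for z
        by (simp add: indicator_def split: prod.split)
      ultimately show ?thesis using indep_rv_integral[OF assms(1,2)] by fastforce
    qed
    also have "\<dots> = (\<integral>\<omega>. (\<integral>\<omega>'. indicator A (U \<omega>, V1 \<omega>') \<partial>M) * measure M {\<omega>\<in>space M. V2 \<omega> \<in> B} \<partial>M)"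
    proof (rule Bochner_Integration.integral_cong[OF refl])
      fix \<omega> assume "\<omega> \<in> space M"
      then have U: "U \<omega> \<in> space S" by (meson \<open>U \<in> measurable M S\<close> measurable_space)
      then have "Pair (U \<omega>) \<in> measurable T1 (S \<Otimes>\<^sub>M T1)" by simp
      from measurable_compose[OF this borel_measurable_indicator[OF that(1)]]
      have [measurable]: "(\<lambda>v1. indicator A (U \<omega>, v1) :: real) \<in> borel_measurable T1" .
      have "(\<integral>\<omega>'. indicator A (U \<omega>, V1 \<omega>') * indicator B (V2 \<omega>') \<partial>M :: real)
         = (\<integral>\<omega>'. (\<lambda>(v1,v2). indicator A (U \<omega>, v1) * indicator B v2) (V1 \<omega>', V2 \<omega>') \<partial>M)" by simp
      also have "\<dots> = (\<integral>\<omega>1. (\<integral>\<omega>2. indicator A (U \<omega>, V1 \<omega>1) * indicator B (V2 \<omega>2) \<partial>M) \<partial>M)"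
      proof -
        have "(\<lambda>(v1,v2). indicator A (U \<omega>, v1) * indicator B v2 :: real) \<in> borel_measurable (T1 \<Otimes>\<^sub>M T2)"
          by measurable
        moreover have "\<bar>(\<lambda>(v1,v2). indicator A (U \<omega>, v1) * indicator B v2 :: real) z\<bar> \<le> 1" for z
          by (simp add: indicator_def split: prod.split)
        ultimately show ?thesis using indep_rv_integral[OF assms(1,3)] by fastforce
      qed
      also have "(\<lambda>\<omega>1. \<integral>\<omega>2. indicator A (U \<omega>, V1 \<omega>1) * indicator B (V2 \<omega>2) \<partial>M) =
         (\<lambda>\<omega>1. indicator A (U \<omega>, V1 \<omega>1) * (measure M {\<omega>\<in>space M. V2 \<omega> \<in> B} :: real))"
      proof
        fix \<omega>1
        have "(\<integral>\<omega>2. indicator B (V2 \<omega>2) \<partial>M) = (\<integral>\<omega>2. indicator {\<omega>\<in>space M. V2 \<omega> \<in> B} \<omega>2 \<partial>M :: real)"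
          by (intro Bochner_Integration.integral_cong) (auto simp: indicator_def)
        then show "(\<integral>\<omega>2. indicator A (U \<omega>, V1 \<omega>1) * indicator B (V2 \<omega>2) \<partial>M) = indicator A (U \<omega>, V1 \<omega>1) * (measure M {\<omega>\<in>space M. V2 \<omega> \<in> B} :: real)"
          by simp
      qed
      finally show "(\<integral>\<omega>'. indicator A (U \<omega>, V1 \<omega>') * indicator B (V2 \<omega>') \<partial>M) = 
          (\<integral>\<omega>'. indicator A (U \<omega>, V1 \<omega>') \<partial>M) * (measure M {\<omega>\<in>space M. V2 \<omega> \<in> B} :: real)" by simp
    qed
    also have "\<dots> = (\<integral>\<omega>. (\<integral>\<omega>'. indicator A (U \<omega>, V1 \<omega>') \<partial>M) \<partial>M) * measure M {\<omega>\<in>space M. V2 \<omega> \<in> B}"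
      by simp
    also have "(\<integral>\<omega>. (\<integral>\<omega>'. indicator A (U \<omega>, V1 \<omega>') \<partial>M) \<partial>M) = (\<integral>\<omega>. indicator A (U \<omega>, V1 \<omega>) \<partial>M :: real)"
      by (rule indep_rv_integral[OF assms(1) i1, where B=1, symmetric]) (auto simp: indicator_def)
    also have "\<dots> = (\<integral>\<omega>. indicator {\<omega>\<in>space M. (U \<omega>, V1 \<omega>) \<in> A} \<omega> \<partial>M)"
      by (intro Bochner_Integration.integral_cong) (auto simp: indicator_def)
    finally show ?thesis by simp
  qed
  then show ?thesis unfolding indep_rv_iff[OF assms(1)] by simp
qed

lemma indep_var_imp_indep_rv:
  assumes "prob_space M" "prob_space.indep_var M S U T V"
  shows "indep_rv M S U T V"
proof -
  interpret prob_space M by fact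
  have "U \<in> measurable M S" "V \<in> measurable M T" using assms(2) unfolding indep_var_eq by auto
  moreover have "indep_set {U -` A \<inter> space M | A. A \<in> sets S} {V -` A \<inter> space M | A. A \<in> sets T}"
    using assms(2) unfolding indep_var_eq indep_sets2_eq by (meson sigma_sets.Basic subset_iff)
  ultimately show ?thesis unfolding indep_rv_def by simp
qed

section \<open>Regularly varying tails\<close>

text \<open>Null events are covered: there the uniform measure is the zero measure, and the right
  side is a division by 0 with value 0.\<close>

lemma integral_uniform_measure_real:
  fixes f :: "'a \<Rightarrow> real"
  assumes [measurable]: "A \<in> sets M" "f \<in> borel_measurable M" and A: "emeasure M A \<noteq> \<infinity>"
  shows "(\<integral>x. f x \<partial>uniform_measure M A) = (\<integral>x. f x * indicator A x \<partial>M) / measure M A"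
proof (cases "measure M A = 0")
  case True
  then have "emeasure M A = 0" using A by (simp add: measure_eq_0_null_sets emeasure_eq_ennreal_measure)
  have eq: "uniform_measure M A = density M (\<lambda>x. indicator A x / emeasure M A)"
    by (simp add: uniform_measure_def)
  have "AE x in M. x \<notin> A" using \<open>emeasure M A = 0\<close> AE_not_in[of A M] by (auto simp: null_sets_def)
  then have "uniform_measure M A = density M (\<lambda>x. 0)"
    unfolding eq using \<open>AE x in M. x \<notin> A\<close> by (intro density_cong) (auto elim!: eventually_mono)
  then show ?thesis using True by (simp add: integral_density[where g="\<lambda>x. (0::real)", simplified])
next
  case False
  then have pos: "measure M A > 0" by (simp add: zero_less_measure_iff)
  have "uniform_measure M A = density M (\<lambda>x. ennreal (indicator A x / measure M A))"
    unfolding uniform_measure_def using A pos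
    by (intro density_cong) (auto simp: emeasure_eq_ennreal_measure ennreal_indicator[symmetric] divide_ennreal)
  then have "(\<integral>x. f x \<partial>uniform_measure M A) = (\<integral>x. (indicator A x / measure M A) *\<^sub>R f x \<partial>M)"
    by (simp add: integral_density)
  also have "\<dots> = (\<integral>x. (f x * indicator A x) / measure M A \<partial>M)"
    by (intro Bochner_Integration.integral_cong) auto
  finally show ?thesis by simp
qed

text \<open>The image of Lebesgue measure on the positive half-line assigns mass \<open>u powr - \<alpha>\<close> to \<open>(u, \<infinity>)\<close>.\<close>

definition tail_radius :: "real \<Rightarrow> real \<Rightarrow> real" where
  "tail_radius \<alpha> t = (if t > 0 then t powr (-1/\<alpha>) else 0)"

lemma tail_radius_measurable[measurable]: "tail_radius \<alpha> \<in> borel_measurable borel"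
  unfolding tail_radius_def by measurable

lemma tail_radius_nonneg: "tail_radius \<alpha> t \<ge> 0" by (simp add: tail_radius_def)

lemma tail_radius_gt_iff:
  assumes "\<alpha> > 0" "u > 0"
  shows "u < tail_radius \<alpha> t \<longleftrightarrow> 0 < t \<and> t < u powr (-\<alpha>)"
proof (cases "t > 0")
  case True
  have "u = (u powr (-\<alpha>)) powr (-1/\<alpha>)" using assms by (simp add: powr_powr)
  then have "u < tail_radius \<alpha> t \<longleftrightarrow> (u powr (-\<alpha>)) powr (-1/\<alpha>) < t powr (-1/\<alpha>)" using True by (simp add: tail_radius_def)
  also have "\<dots> \<longleftrightarrow> t < u powr (-\<alpha>)"
    using True assms powr_less_mono2_neg[of "-1/\<alpha>" t "u powr (-\<alpha>)"] powr_less_mono2_neg[of "-1/\<alpha>" "u powr (-\<alpha>)" t]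
    by (cases t "u powr (-\<alpha>)" rule: linorder_cases) auto
  finally show ?thesis using True by simp
qed (use assms in \<open>auto simp: tail_radius_def\<close>)

text \<open>Given \<open>V > \<eta> * x\<close>, the law of \<open>V / x\<close> tends to a Pareto
  law, as the distribution functions show. \<open>ext_mapping\<close> treats the varying integrand,
  and the probability of the event divided by \<open>q\<close>, with limit
  \<open>c * \<eta> powr (-\<alpha>)\<close>, restores the normalisation.\<close>

lemma one_sided_vague:
  fixes V :: "'a \<Rightarrow> real" and q :: "real \<Rightarrow> real" and H :: "real \<Rightarrow> real \<Rightarrow> real"
  assumes M: "prob_space M" and V[measurable]: "V \<in> borel_measurable M"
    and a: "\<alpha> > 0" and eta: "\<eta> > 0" and c: "c \<ge> 0"
    and tails: "\<And>u. u > 0 \<Longrightarrow> ((\<lambda>x. \<P>(\<omega> in M. V \<omega> > u * x) / q x) \<longlongrightarrow> c * u powr (-\<alpha>)) at_top"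
    and q: "\<And>x. q x > 0"
    and cc: "cconv H H0" and B: "\<And>x w. \<bar>H x w\<bar> \<le> B" and H[measurable]: "\<And>x. H x \<in> borel_measurable borel"
    and r: "filterlim r at_top sequentially"
  shows "(\<lambda>n. (\<integral>\<omega>. H (r n) (V \<omega> / r n) * indicator {\<omega>. V \<omega> > \<eta> * r n} \<omega> \<partial>M) / q (r n)) \<longlonglongrightarrow>
      c * (\<integral>t. H0 (tail_radius \<alpha> t) * indicator {0<..<\<eta> powr (-\<alpha>)} t \<partial>lborel)"
proof -
  interpret prob_space M by fact
  have [measurable]: "H0 \<in> borel_measurable borel" by (rule cconv_limit_measurable[OF cc H])
  have B0: "B \<ge> 0" using B[of 0 0] by linarith
  define E where "E n = {\<omega>\<in>space M. V \<omega> > \<eta> * r n}" for n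
  have [measurable]: "E n \<in> sets M" for n unfolding E_def by measurable
  have tl: "(\<lambda>n. \<P>(\<omega> in M. V \<omega> > u * r n) / q (r n)) \<longlonglongrightarrow> c * u powr (-\<alpha>)" if "u > 0" for u
    using filterlim_compose[OF tails[OF that] r] .
  have Eq: "(\<lambda>n. prob (E n) / q (r n)) \<longlonglongrightarrow> c * \<eta> powr (-\<alpha>)"
    using tl[OF eta] by (simp add: E_def)
  have ind: "(\<integral>\<omega>. H (r n) (V \<omega> / r n) * indicator {\<omega>. V \<omega> > \<eta> * r n} \<omega> \<partial>M)
     = (\<integral>\<omega>. H (r n) (V \<omega> / r n) * indicator (E n) \<omega> \<partial>M)" for n
    by (intro Bochner_Integration.integral_cong) (auto simp: E_def indicator_def)
  show ?thesis
  \<comment> \<open>For \<open>c = 0\<close> the conditional laws are out of control, since the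
    event may be null or negligible; but then the whole expression is at most \<open>B\<close> times
    a ratio that tends to 0.\<close>
  proof (cases "c = 0")
    case True
    have b1: "\<bar>(\<integral>\<omega>. H (r n) (V \<omega> / r n) * indicator (E n) \<omega> \<partial>M) / q (r n)\<bar> \<le> B * (prob (E n) / q (r n))" for n
    proof -
      have "\<bar>\<integral>\<omega>. H (r n) (V \<omega> / r n) * indicator (E n) \<omega> \<partial>M\<bar> \<le> (\<integral>\<omega>. \<bar>H (r n) (V \<omega> / r n) * indicator (E n) \<omega>\<bar> \<partial>M)"
        by (rule integral_abs_bound)
      also have "\<dots> \<le> (\<integral>\<omega>. B * indicator (E n) \<omega> \<partial>M)"
      proof (rule integral_mono')
        show "integrable M (\<lambda>\<omega>. B * indicator (E n) \<omega>)"
          by (intro integrable_mult_right integrable_real_indicator) (auto simp: emeasure_eq_measure)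
      qed (use B B0 in \<open>auto simp: indicator_def\<close>)
      also have "\<dots> = B * prob (E n)" by simp
      finally show ?thesis using q[of "r n"] by (simp add: field_simps)
    qed
    have b2: "(\<lambda>n. B * (prob (E n) / q (r n))) \<longlonglongrightarrow> 0"
      using tendsto_mult_left[OF Eq, of B] True by simp
    have "(\<lambda>n. (\<integral>\<omega>. H (r n) (V \<omega> / r n) * indicator (E n) \<omega> \<partial>M) / q (r n)) \<longlonglongrightarrow> 0"
      by (rule Lim_null_comparison[OF always_eventually b2]) (use b1 in \<open>simp only: real_norm_def; blast\<close>)
    then show ?thesis unfolding ind True by simp
  next
    case False
    then have c: "c > 0" using c by simp
    \<comment> \<open>\<open>M\<close> is a placeholder for the finitely many \<open>n\<close> at
      which the event may be null; it keeps every \<open>\<mu> n\<close> a probability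
      measure.\<close>
    define P where "P n = (if prob (E n) > 0 then uniform_measure M (E n) else M)" for n
    define \<mu> where "\<mu> n = distr (P n) borel (\<lambda>\<omega>. V \<omega> / r n)" for n
    define I where "I = {0<..<\<eta> powr (-\<alpha>)}"
    have [measurable]: "I \<in> sets borel" by (simp add: I_def)
    have Ipos: "\<eta> powr (-\<alpha>) > 0" using eta by simp
    then have mI: "emeasure lborel I = ennreal (\<eta> powr (-\<alpha>))" "measure lborel I = \<eta> powr (-\<alpha>)" by (auto simp: I_def)
    \<comment> \<open>The Pareto law on \<open>{\<eta><..}\<close>: for \<open>t\<close> uniform on
      \<open>I\<close>, the radius exceeds \<open>w \<ge> \<eta>\<close> with probability
      \<open>w powr (-\<alpha>) / \<eta> powr (-\<alpha>)\<close>.\<close>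
    define \<nu> where "\<nu> = distr (uniform_measure lborel I) borel (tail_radius \<alpha>)"
    have Pp: "prob_space (P n)" for n
      unfolding P_def using prob_space_axioms by (auto intro!: prob_space_uniform_measure simp: emeasure_eq_measure)
    have sP[measurable_cong]: "sets (P n) = sets M" for n by (simp add: P_def)
    have nup: "prob_space (uniform_measure lborel I)"
      using mI Ipos by (intro prob_space_uniform_measure) auto
    have rd: "real_distribution (\<mu> n)" "real_distribution \<nu>" for n
      unfolding \<mu>_def \<nu>_def by (intro prob_space.real_distribution_distr Pp nup; measurable)+
    have rev: "\<forall>\<^sub>F n in sequentially. r n > 0" using r by (simp add: filterlim_at_top_dense)
    have Eev: "\<forall>\<^sub>F n in sequentially. prob (E n) > 0"
    proof -
      have "\<forall>\<^sub>F n in sequentially. prob (E n) / q (r n) > 0"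
        by (rule order_tendstoD(1)[OF Eq]) (use c Ipos in simp)
      then show ?thesis by eventually_elim (metis divide_eq_0_iff less_irrefl zero_less_measure_iff)
    qed
    have Pint: "(\<integral>\<omega>. f (V \<omega> / r n) \<partial>P n) = (\<integral>\<omega>. f (V \<omega> / r n) * indicator (E n) \<omega> \<partial>M) / prob (E n)"
      if "prob (E n) > 0" "f \<in> borel_measurable borel" for f :: "real \<Rightarrow> real" and n
      using that by (simp add: P_def) (subst integral_uniform_measure_real, auto)
    have muint: "(\<integral>z. f z \<partial>\<mu> n) = (\<integral>\<omega>. f (V \<omega> / r n) * indicator (E n) \<omega> \<partial>M) / prob (E n)"
      if "prob (E n) > 0" "f \<in> borel_measurable borel" for f :: "real \<Rightarrow> real" and n
      unfolding Pint[OF that, symmetric] \<mu>_def using that(2) by (intro integral_distr) auto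
    have nuint: "(\<integral>z. f z \<partial>\<nu>) = (\<integral>t. f (tail_radius \<alpha> t) * indicator I t \<partial>lborel) / \<eta> powr (-\<alpha>)"
      if [measurable]: "f \<in> borel_measurable borel" for f :: "real \<Rightarrow> real"
    proof -
      have "(\<integral>z. f z \<partial>\<nu>) = (\<integral>t. f (tail_radius \<alpha> t) \<partial>uniform_measure lborel I)"
        unfolding \<nu>_def by (rule integral_distr) measurable
      then show ?thesis by (subst (asm) integral_uniform_measure_real) (auto simp: mI)
    qed
    have cdf_nu: "cdf \<nu> w = 1 - (if w \<ge> \<eta> then w powr (-\<alpha>) / \<eta> powr (-\<alpha>) else 1)" for w
    proof -
      interpret nu: real_distribution \<nu> by fact
      have "cdf \<nu> w = 1 - measure \<nu> {w<..}"
        using nu.prob_compl[of "{..w}"] by (simp add: cdf_def2 Compl_eq_Diff_UNIV[symmetric])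
      also have "measure \<nu> {w<..} = (\<integral>z. indicator {w<..} z \<partial>\<nu>)" by simp
      also have "\<dots> = (\<integral>t. indicator {w<..} (tail_radius \<alpha> t) * indicator I t \<partial>lborel) / \<eta> powr (-\<alpha>)"
        by (rule nuint) simp
      also have "(\<integral>t. indicator {w<..} (tail_radius \<alpha> t) * indicator I t \<partial>lborel) =
          (\<integral>t. indicator {0<..<(if w \<ge> \<eta> then w powr (-\<alpha>) else \<eta> powr (-\<alpha>))} t \<partial>lborel :: real)"
      proof (rule Bochner_Integration.integral_cong[OF refl])
        fix t :: real
        have mono: "w powr (-\<alpha>) \<le> \<eta> powr (-\<alpha>)" if "w \<ge> \<eta>"
          using that eta a by (intro powr_mono2') auto
        show "indicator {w<..} (tail_radius \<alpha> t) * indicator I t =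
            (indicator {0<..<(if w \<ge> \<eta> then w powr (-\<alpha>) else \<eta> powr (-\<alpha>))} t :: real)"
        proof (cases "w \<ge> \<eta>")
          case True
          then show ?thesis using mono tail_radius_gt_iff[OF a, of w t] eta by (auto simp: indicator_def I_def)
        next
          case False
          then show ?thesis using tail_radius_gt_iff[OF a eta, of t] by (auto simp: indicator_def I_def)
        qed
      qed
      also have "\<dots> / \<eta> powr (-\<alpha>) = (if w \<ge> \<eta> then w powr (-\<alpha>) / \<eta> powr (-\<alpha>) else 1)"
        using eta by simp
      finally show ?thesis .
    qed
    have cdf_mu: "cdf (\<mu> n) w = 1 - (if w \<ge> \<eta> then prob {\<omega>\<in>space M. V \<omega> > w * r n} / prob (E n) else 1)"
      if n: "r n > 0" "prob (E n) > 0" for w n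
    proof -
      interpret mu: real_distribution "\<mu> n" by fact
      have "cdf (\<mu> n) w = 1 - measure (\<mu> n) {w<..}"
        using mu.prob_compl[of "{..w}"] by (simp add: cdf_def2 Compl_eq_Diff_UNIV[symmetric])
      also have "measure (\<mu> n) {w<..} = (\<integral>z. indicator {w<..} z \<partial>\<mu> n)" by simp
      also have "\<dots> = (\<integral>\<omega>. indicator {w<..} (V \<omega> / r n) * indicator (E n) \<omega> \<partial>M) / prob (E n)"
        by (rule muint) (use n in auto)
      also have "(\<integral>\<omega>. indicator {w<..} (V \<omega> / r n) * indicator (E n) \<omega> \<partial>M) = 
          (\<integral>\<omega>. indicator (if w \<ge> \<eta> then {\<omega>\<in>space M. V \<omega> > w * r n} else E n) \<omega> \<partial>M :: real)"
      proof (rule Bochner_Integration.integral_cong[OF refl])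
        fix \<omega> assume w: "\<omega> \<in> space M"
        have le: "V \<omega> > \<eta> * r n" if "w \<ge> \<eta>" "V \<omega> > w * r n"
          using mult_right_mono[OF that(1), of "r n"] that(2) n(1) by linarith
        have ge: "V \<omega> > w * r n" if "\<not> w \<ge> \<eta>" "V \<omega> > \<eta> * r n"
          using mult_right_mono[of w \<eta> "r n"] that n(1) by linarith
        have "w < V \<omega> / r n \<longleftrightarrow> w * r n < V \<omega>" using n(1) by (simp add: field_simps)
        then show "indicator {w<..} (V \<omega> / r n) * indicator (E n) \<omega> =
           (indicator (if w \<ge> \<eta> then {\<omega>\<in>space M. V \<omega> > w * r n} else E n) \<omega> :: real)"
          using w le ge by (auto simp: indicator_def E_def)
      qed
      also have "\<dots> / prob (E n) = (if w \<ge> \<eta> then prob {\<omega>\<in>space M. V \<omega> > w * r n} / prob (E n) else 1)"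
        using n by simp
      finally show ?thesis .
    qed
    have "weak_conv_m \<mu> \<nu>"
      unfolding weak_conv_m_def weak_conv_def
    proof (intro allI impI)
      fix w
      have ev: "\<forall>\<^sub>F n in sequentially. 1 - (if w \<ge> \<eta> then (prob {\<omega>\<in>space M. V \<omega> > w * r n} / q (r n)) / (prob (E n) / q (r n)) else 1) = cdf (\<mu> n) w"
        using rev Eev by eventually_elim (use q in \<open>auto simp: cdf_mu less_imp_neq[THEN not_sym]\<close>)
      have "(\<lambda>n. 1 - (if w \<ge> \<eta> then (prob {\<omega>\<in>space M. V \<omega> > w * r n} / q (r n)) / (prob (E n) / q (r n)) else 1)) \<longlonglongrightarrow>
          1 - (if w \<ge> \<eta> then (c * w powr (-\<alpha>)) / (c * \<eta> powr (-\<alpha>)) else 1)"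
      proof (cases "w \<ge> \<eta>")
        case True
        then have "w > 0" using eta by simp
        have "(\<lambda>n. 1 - (prob {\<omega>\<in>space M. V \<omega> > w * r n} / q (r n)) / (prob (E n) / q (r n))) \<longlonglongrightarrow>
            1 - (c * w powr (-\<alpha>)) / (c * \<eta> powr (-\<alpha>))"
          by (intro tendsto_diff tendsto_const tendsto_divide tl \<open>w > 0\<close> Eq) (use c eta in simp)
        then show ?thesis using True by (simp only: if_True)
      qed simp
      from Lim_transform_eventually[OF this ev]
      show "(\<lambda>n. cdf (\<mu> n) w) \<longlonglongrightarrow> cdf \<nu> w" using c by (cases "w \<ge> \<eta>") (simp_all add: cdf_nu)
    qed
    then have weak: "(\<lambda>n. \<integral>z. f z \<partial>\<mu> n) \<longlonglongrightarrow> (\<integral>z. f z \<partial>\<nu>)" if lf: "C-lipschitz_on UNIV f" "bounded (range f)" for f :: "real \<Rightarrow> real" and C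
    proof -
      obtain D where "\<And>x. norm (f x) \<le> D" using lf(2) by (auto simp: bounded_iff)
      moreover have "isCont f x" for x using lipschitz_on_continuous_on[OF lf(1)] by (simp add: continuous_on_eq_continuous_at)
      ultimately show ?thesis
        by (intro weak_conv_imp_integral_bdd_continuous_conv[OF rd] \<open>weak_conv_m \<mu> \<nu>\<close>)
    qed
    have "(\<lambda>n. \<integral>z. H (r n) z \<partial>\<mu> n) \<longlonglongrightarrow> (\<integral>z. H0 z \<partial>\<nu>)"
      by (rule ext_mapping[OF weak _ _ _ _ cc B r H])
        (use rd in \<open>auto simp: real_distribution_def real_distribution_axioms_def\<close>)
    from tendsto_mult[OF this Eq]
    have "(\<lambda>n. (\<integral>z. H (r n) z \<partial>\<mu> n) * (prob (E n) / q (r n))) \<longlonglongrightarrow>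
        c * (\<integral>t. H0 (tail_radius \<alpha> t) * indicator I t \<partial>lborel)"
      using Ipos eta by (simp add: nuint mult.commute)
    moreover have "\<forall>\<^sub>F n in sequentially. (\<integral>z. H (r n) z \<partial>\<mu> n) * (prob (E n) / q (r n)) =
         (\<integral>\<omega>. H (r n) (V \<omega> / r n) * indicator (E n) \<omega> \<partial>M) / q (r n)"
      using Eev by eventually_elim (simp add: muint)
    ultimately show ?thesis unfolding ind I_def by (rule Lim_transform_eventually)
  qed
qed

text \<open>A zero tail at \<open>x\<close> would make all later tails zero. Then the quotient for
  \<open>u = 1\<close> is 0 by the convention on division by 0, while its limit is 1.\<close>

lemma regularly_varying_tails_pos:
  assumes "prob_space M" and [measurable]: "Z \<in> borel_measurable M" and rv: "regularly_varying_tails M Z \<alpha> p"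
  shows "\<P>(\<omega> in M. \<bar>Z \<omega>\<bar> > x) > 0"
proof (rule ccontr)
  interpret prob_space M by fact
  assume "\<not> \<P>(\<omega> in M. \<bar>Z \<omega>\<bar> > x) > 0"
  then have 0: "\<P>(\<omega> in M. \<bar>Z \<omega>\<bar> > x) = 0" by (simp add: zero_less_measure_iff)
  have "\<P>(\<omega> in M. \<bar>Z \<omega>\<bar> > y) = 0" if "y \<ge> x" for y
  proof -
    have "\<P>(\<omega> in M. \<bar>Z \<omega>\<bar> > y) \<le> \<P>(\<omega> in M. \<bar>Z \<omega>\<bar> > x)" using that by (intro finite_measure_mono) auto
    then show ?thesis using 0 by (simp add: measure_le_0_iff)
  qed
  then have ev: "\<forall>\<^sub>F y in at_top. \<P>(\<omega> in M. \<bar>Z \<omega>\<bar> > 1 * y) / \<P>(\<omega> in M. \<bar>Z \<omega>\<bar> > y) = 0"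
    by (intro eventually_at_top_linorderI[of x]) auto
  have "((\<lambda>y. \<P>(\<omega> in M. \<bar>Z \<omega>\<bar> > 1 * y) / \<P>(\<omega> in M. \<bar>Z \<omega>\<bar> > y)) \<longlongrightarrow> 1 powr (-\<alpha>)) at_top"
    using rv unfolding regularly_varying_tails_def by (meson zero_less_one)
  from Lim_transform_eventually[OF this ev] have "((\<lambda>y::real. 0::real) \<longlongrightarrow> 1) at_top" by simp
  then show False by (simp add: tendsto_const_iff)
qed

lemma regularly_varying_tails_upper:
  assumes "prob_space M" and Z: "Z \<in> borel_measurable M" and rv: "regularly_varying_tails M Z \<alpha> p" and u: "u > 0"
  shows "((\<lambda>x. \<P>(\<omega> in M. Z \<omega> > u * x) / \<P>(\<omega> in M. \<bar>Z \<omega>\<bar> > x)) \<longlongrightarrow> p * u powr (-\<alpha>)) at_top"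
proof -
  have ux: "filterlim (\<lambda>x::real. u * x) at_top at_top"
    using u by (intro filterlim_tendsto_pos_mult_at_top[OF tendsto_const]) (auto simp: filterlim_ident)
  have 1: "((\<lambda>x. \<P>(\<omega> in M. Z \<omega> > u * x) / \<P>(\<omega> in M. \<bar>Z \<omega>\<bar> > u * x)) \<longlongrightarrow> p) at_top"
    using rv unfolding regularly_varying_tails_def by (intro filterlim_compose[OF _ ux]) auto
  have 2: "((\<lambda>x. \<P>(\<omega> in M. \<bar>Z \<omega>\<bar> > u * x) / \<P>(\<omega> in M. \<bar>Z \<omega>\<bar> > x)) \<longlongrightarrow> u powr (-\<alpha>)) at_top"
    using rv u unfolding regularly_varying_tails_def by auto
  have pos: "\<P>(\<omega> in M. \<bar>Z \<omega>\<bar> > y) \<noteq> 0" for y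
    using regularly_varying_tails_pos[OF assms(1) Z rv, of y] by linarith
  show ?thesis using tendsto_mult[OF 1 2] pos by simp
qed

lemma regularly_varying_tails_lower:
  assumes "prob_space M" and Z[measurable]: "Z \<in> borel_measurable M" and rv: "regularly_varying_tails M Z \<alpha> p" and u: "u > 0"
  shows "((\<lambda>x. \<P>(\<omega> in M. - Z \<omega> > u * x) / \<P>(\<omega> in M. \<bar>Z \<omega>\<bar> > x)) \<longlongrightarrow> (1 - p) * u powr (-\<alpha>)) at_top"
proof -
  interpret prob_space M by fact
  have 2: "((\<lambda>x. \<P>(\<omega> in M. \<bar>Z \<omega>\<bar> > u * x) / \<P>(\<omega> in M. \<bar>Z \<omega>\<bar> > x)) \<longlongrightarrow> u powr (-\<alpha>)) at_top"
    using rv u unfolding regularly_varying_tails_def by auto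
  have eq: "\<P>(\<omega> in M. - Z \<omega> > u * x) = \<P>(\<omega> in M. \<bar>Z \<omega>\<bar> > u * x) - \<P>(\<omega> in M. Z \<omega> > u * x)" if "x \<ge> 0" for x
  proof -
    have "0 \<le> u * x" using that u by simp
    then have e: "{\<omega>\<in>space M. - Z \<omega> > u * x} = {\<omega>\<in>space M. \<bar>Z \<omega>\<bar> > u * x} - {\<omega>\<in>space M. Z \<omega> > u * x}" by auto
    have "{\<omega>\<in>space M. \<bar>Z \<omega>\<bar> > u * x} \<in> sets M" "{\<omega>\<in>space M. Z \<omega> > u * x} \<in> sets M" by measurable
    moreover have "{\<omega>\<in>space M. Z \<omega> > u * x} \<subseteq> {\<omega>\<in>space M. \<bar>Z \<omega>\<bar> > u * x}" by auto
    ultimately show ?thesis unfolding e by (rule finite_measure_Diff)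
  qed
  have ev: "\<forall>\<^sub>F x in at_top. \<P>(\<omega> in M. \<bar>Z \<omega>\<bar> > u * x) / \<P>(\<omega> in M. \<bar>Z \<omega>\<bar> > x) - \<P>(\<omega> in M. Z \<omega> > u * x) / \<P>(\<omega> in M. \<bar>Z \<omega>\<bar> > x)
     = \<P>(\<omega> in M. - Z \<omega> > u * x) / \<P>(\<omega> in M. \<bar>Z \<omega>\<bar> > x)"
    by (intro eventually_at_top_linorderI[of 0]) (simp add: eq diff_divide_distrib)
  show ?thesis
    using Lim_transform_eventually[OF tendsto_diff[OF 2 regularly_varying_tails_upper[OF assms]] ev]
    by (simp add: algebra_simps)
qed

lemma AE_sign:
  assumes "prob_space K" "\<P>(\<omega> in K. M0 \<omega> = 1) = p" "\<P>(\<omega> in K. M0 \<omega> = -1) = 1 - p"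
    and [measurable]: "M0 \<in> borel_measurable K"
  shows "AE \<omega> in K. M0 \<omega> = 1 \<or> M0 \<omega> = (-1::real)"
proof -
  interpret prob_space K by fact
  have "prob ({\<omega>\<in>space K. M0 \<omega> = 1} \<union> {\<omega>\<in>space K. M0 \<omega> = -1}) = 1"
    using assms(2,3) by (subst finite_measure_Union) auto
  from AE_prob_1[OF this] show ?thesis by auto
qed

lemma integral_sign_split:
  fixes f M0 :: "'a \<Rightarrow> real"
  assumes "prob_space K" "\<P>(\<omega> in K. M0 \<omega> = 1) = p" "\<P>(\<omega> in K. M0 \<omega> = -1) = 1 - p"
    and [measurable]: "M0 \<in> borel_measurable K" "f \<in> borel_measurable K" and B: "\<And>\<omega>. \<bar>f \<omega>\<bar> \<le> B"
  shows "(\<integral>\<omega>. f \<omega> \<partial>K) = (\<integral>\<omega>. f \<omega> * indicator {\<omega>\<in>space K. M0 \<omega> = 1} \<omega> \<partial>K)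
      + (\<integral>\<omega>. f \<omega> * indicator {\<omega>\<in>space K. M0 \<omega> = -1} \<omega> \<partial>K)"
proof -
  interpret prob_space K by fact
  have B0: "0 \<le> B" using B[of undefined] by linarith
  have i: "integrable K (\<lambda>\<omega>. f \<omega> * indicator {\<omega>\<in>space K. M0 \<omega> = c} \<omega>)" for c :: real
    by (rule integrable_const_bound[of _ B]) (use B B0 in \<open>auto simp: indicator_def\<close>)
  have "(\<integral>\<omega>. f \<omega> \<partial>K) = (\<integral>\<omega>. f \<omega> * indicator {\<omega>\<in>space K. M0 \<omega> = 1} \<omega> + f \<omega> * indicator {\<omega>\<in>space K. M0 \<omega> = -1} \<omega> \<partial>K)"
    using AE_sign[OF assms(1-4)] AE_space by (intro integral_cong_AE) (auto simp: indicator_def)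
  then show ?thesis by (simp add: i)
qed

text \<open>The half-lines are treated apart, \<open>Z\<close> with weight \<open>p\<close> and
  \<open>- Z\<close> with weight \<open>1 - p\<close>, and put together again as a mixture over the
  two values of \<open>M0\<close>. \<open>H\<close> must vanish near 0 because the tail measure has
  infinite mass there.\<close>

lemma tail_vague:
  fixes Z :: "'a \<Rightarrow> real" and H :: "real \<Rightarrow> real \<Rightarrow> real" and M0 :: "'c \<Rightarrow> real"
  assumes M: "prob_space M" and Z[measurable]: "Z \<in> borel_measurable M" and rv: "regularly_varying_tails M Z \<alpha> p"
    and a: "\<alpha> > 0" and eta: "\<eta> > 0" and p: "p \<in> {0..1}"
    and cc: "cconv H H0" and B: "\<And>x w. \<bar>H x w\<bar> \<le> B" and H[measurable]: "\<And>x. H x \<in> borel_measurable borel"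
    and zero: "\<And>x w. \<bar>w\<bar> \<le> \<eta> \<Longrightarrow> H x w = 0"
    and r: "filterlim r at_top sequentially"
    and K: "prob_space K" "\<P>(\<omega> in K. M0 \<omega> = 1) = p" "\<P>(\<omega> in K. M0 \<omega> = -1) = 1 - p"
    and M0[measurable]: "M0 \<in> borel_measurable K"
  shows "(\<lambda>n. (\<integral>\<omega>. H (r n) (Z \<omega> / r n) \<partial>M) / \<P>(\<omega> in M. \<bar>Z \<omega>\<bar> > r n)) \<longlonglongrightarrow>
      (\<integral>t. (\<integral>\<omega>. H0 (tail_radius \<alpha> t * M0 \<omega>) \<partial>K) \<partial>lborel)"
proof -
  interpret prob_space M by fact
  interpret K: prob_space K by fact
  have [measurable]: "H0 \<in> borel_measurable borel" by (rule cconv_limit_measurable[OF cc H])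
  have B0: "B \<ge> 0" using B[of 0 0] by linarith
  have H0B: "\<bar>H0 w\<bar> \<le> B" for w by (rule cconv_limit_bounded[OF cc B])
  have H0z: "H0 w = 0" if "\<bar>w\<bar> \<le> \<eta>" for w
    using cconv_pointwise[OF cc, of w] zero[OF that] by (simp add: LIMSEQ_const_iff)
  define q where "q x = \<P>(\<omega> in M. \<bar>Z \<omega>\<bar> > x)" for x
  define I where "I = {0<..<\<eta> powr (-\<alpha>)}"
  have qpos: "q x > 0" for x unfolding q_def by (rule regularly_varying_tails_pos[OF M Z rv])
  have cc': "cconv (\<lambda>x w. H x (- w)) (\<lambda>w. H0 (- w))"
    unfolding cconv_def using cconvD[OF cc] tendsto_minus by blast
  have 1: "(\<lambda>n. (\<integral>\<omega>. H (r n) (Z \<omega> / r n) * indicator {\<omega>. Z \<omega> > \<eta> * r n} \<omega> \<partial>M) / q (r n)) \<longlonglongrightarrow>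
      p * (\<integral>t. H0 (tail_radius \<alpha> t) * indicator I t \<partial>lborel)" unfolding I_def
    by (rule one_sided_vague[OF M Z a eta _ _ qpos cc B H r])
      (use p regularly_varying_tails_upper[OF M Z rv] in \<open>auto simp: q_def\<close>)
  have 2: "(\<lambda>n. (\<integral>\<omega>. H (r n) (- ((- Z \<omega>) / r n)) * indicator {\<omega>. - Z \<omega> > \<eta> * r n} \<omega> \<partial>M) / q (r n)) \<longlonglongrightarrow>
      (1 - p) * (\<integral>t. H0 (- tail_radius \<alpha> t) * indicator I t \<partial>lborel)" unfolding I_def
    by (rule one_sided_vague[OF M _ a eta _ _ qpos cc' B _ r])
      (use p regularly_varying_tails_lower[OF M Z rv] in \<open>auto simp: q_def\<close>)
  have ev: "\<forall>\<^sub>F n in sequentially. (\<integral>\<omega>. H (r n) (Z \<omega> / r n) * indicator {\<omega>. Z \<omega> > \<eta> * r n} \<omega> \<partial>M) / q (r n)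
      + (\<integral>\<omega>. H (r n) (- ((- Z \<omega>) / r n)) * indicator {\<omega>. - Z \<omega> > \<eta> * r n} \<omega> \<partial>M) / q (r n)
      = (\<integral>\<omega>. H (r n) (Z \<omega> / r n) \<partial>M) / q (r n)"
  proof -
    have "\<forall>\<^sub>F n in sequentially. r n > 0" using r by (simp add: filterlim_at_top_dense)
    then show ?thesis
    proof eventually_elim
      case (elim n)
      have i: "integrable M (\<lambda>\<omega>. H (r n) (Z \<omega> / r n) * indicator {\<omega>. Z \<omega> > \<eta> * r n} \<omega>)"
        "integrable M (\<lambda>\<omega>. H (r n) (- ((- Z \<omega>) / r n)) * indicator {\<omega>. - Z \<omega> > \<eta> * r n} \<omega>)"
        by (rule integrable_const_bound[of _ B]; use B B0 in \<open>auto simp: indicator_def\<close>)+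
      have "H (r n) (Z \<omega> / r n) * indicator {\<omega>. Z \<omega> > \<eta> * r n} \<omega> + H (r n) (- ((- Z \<omega>) / r n)) * indicator {\<omega>. - Z \<omega> > \<eta> * r n} \<omega>
         = H (r n) (Z \<omega> / r n)" for \<omega>
      proof -
        have pos: "0 \<le> \<eta> * r n" using elim eta by simp
        show ?thesis
        proof (cases "\<bar>Z \<omega> / r n\<bar> \<le> \<eta>")
          case True
          then have "\<bar>Z \<omega>\<bar> \<le> \<eta> * r n" using elim by (simp add: field_simps)
          then show ?thesis using zero[OF True] by (auto simp: indicator_def)
        next
          case False
          then have "\<bar>Z \<omega>\<bar> > \<eta> * r n" using elim by (simp add: field_simps)
          then show ?thesis using pos by (auto simp: indicator_def)
        qed
      qed
      then show ?case using i by (simp add: Bochner_Integration.integral_add[symmetric] add_divide_distrib[symmetric])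
    qed
  qed
  \<comment> \<open>The indicator of \<open>I\<close> is inserted at no cost: off \<open>I\<close>
    the radius is at most \<open>\<eta>\<close>, where \<open>H0\<close> vanishes.\<close>
  have inner: "(\<integral>\<omega>. H0 (tail_radius \<alpha> t * M0 \<omega>) \<partial>K) = p * (H0 (tail_radius \<alpha> t) * indicator I t) + (1 - p) * (H0 (- tail_radius \<alpha> t) * indicator I t)" for t
  proof -
    have "(\<integral>\<omega>. H0 (tail_radius \<alpha> t * M0 \<omega>) \<partial>K) = (\<integral>\<omega>. H0 (tail_radius \<alpha> t * M0 \<omega>) * indicator {\<omega>\<in>space K. M0 \<omega> = 1} \<omega> \<partial>K)
        + (\<integral>\<omega>. H0 (tail_radius \<alpha> t * M0 \<omega>) * indicator {\<omega>\<in>space K. M0 \<omega> = -1} \<omega> \<partial>K)"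
      by (rule integral_sign_split[OF K]) (use H0B in auto)
    also have "(\<integral>\<omega>. H0 (tail_radius \<alpha> t * M0 \<omega>) * indicator {\<omega>\<in>space K. M0 \<omega> = 1} \<omega> \<partial>K) = (\<integral>\<omega>. H0 (tail_radius \<alpha> t) * indicator {\<omega>\<in>space K. M0 \<omega> = 1} \<omega> \<partial>K)"
      by (intro Bochner_Integration.integral_cong) (auto simp: indicator_def)
    also have "\<dots> = p * H0 (tail_radius \<alpha> t)" using K(2) by simp
    also have "(\<integral>\<omega>. H0 (tail_radius \<alpha> t * M0 \<omega>) * indicator {\<omega>\<in>space K. M0 \<omega> = -1} \<omega> \<partial>K) = (\<integral>\<omega>. H0 (- tail_radius \<alpha> t) * indicator {\<omega>\<in>space K. M0 \<omega> = -1} \<omega> \<partial>K)"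
      by (intro Bochner_Integration.integral_cong) (auto simp: indicator_def)
    also have "\<dots> = (1 - p) * H0 (- tail_radius \<alpha> t)" using K(3) by simp
    finally have *: "(\<integral>\<omega>. H0 (tail_radius \<alpha> t * M0 \<omega>) \<partial>K) = p * H0 (tail_radius \<alpha> t) + (1 - p) * H0 (- tail_radius \<alpha> t)" .
    show ?thesis
    proof (cases "t \<in> I")
      case False
      then have "\<bar>tail_radius \<alpha> t\<bar> \<le> \<eta>" using tail_radius_gt_iff[OF a eta, of t] tail_radius_nonneg[of \<alpha> t] by (auto simp: I_def)
      then show ?thesis using * H0z False by simp
    qed (simp add: *)
  qed
  have i: "integrable lborel (\<lambda>t. f t * indicator I t)" if "f \<in> borel_measurable borel" "\<And>t. \<bar>f t\<bar> \<le> B" for f :: "real \<Rightarrow> real"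
  proof (rule Bochner_Integration.integrable_bound)
    show "integrable lborel (\<lambda>t. B * indicator I t :: real)"
      by (intro integrable_mult_right integrable_real_indicator) (auto simp: I_def)
  qed (use that B0 in \<open>auto simp: I_def indicator_def\<close>)
  have "(\<integral>t. (\<integral>\<omega>. H0 (tail_radius \<alpha> t * M0 \<omega>) \<partial>K) \<partial>lborel) =
    p * (\<integral>t. H0 (tail_radius \<alpha> t) * indicator I t \<partial>lborel) + (1 - p) * (\<integral>t. H0 (- tail_radius \<alpha> t) * indicator I t \<partial>lborel)"
    unfolding inner using H0B by (subst Bochner_Integration.integral_add) (auto intro!: i)
  then show ?thesis using Lim_transform_eventually[OF tendsto_add[OF 1 2] ev] by (simp add: q_def)
qed

section \<open>Adjointness as equality of two tail measures away from the axes\<close>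

text \<open>For fixed \<open>\<omega>\<close>, the parameters \<open>t\<close> that lead into the
  quadrant form the interval from 0 to the minimum on the right. Tonelli thus turns the mass of a
  quadrant into just the expectation that the adjointness condition speaks of.\<close>

lemma emeasure_tail_rectangle:
  fixes U W :: "'c \<Rightarrow> real"
  assumes K: "prob_space K" and a: "\<alpha> > 0" and [measurable]: "U \<in> borel_measurable K" "W \<in> borel_measurable K"
    and c: "c > 0" "d > 0"
    and int: "integrable K (\<lambda>\<omega>. min (pos_powr (U \<omega> / c) \<alpha>) (pos_powr (W \<omega> / d) \<alpha>))"
  shows "emeasure (distr (lborel \<Otimes>\<^sub>M K) borel (\<lambda>(t,\<omega>). (tail_radius \<alpha> t * U \<omega>, tail_radius \<alpha> t * W \<omega>))) ({c<..} \<times> {d<..})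
    = ennreal (\<integral>\<omega>. min (pos_powr (U \<omega> / c) \<alpha>) (pos_powr (W \<omega> / d) \<alpha>) \<partial>K)"
proof -
  interpret K: prob_space K by fact
  interpret P: pair_sigma_finite lborel K ..
  have [measurable]: "(\<lambda>(t,\<omega>). (tail_radius \<alpha> t * U \<omega>, tail_radius \<alpha> t * W \<omega>)) \<in> borel_measurable (lborel \<Otimes>\<^sub>M K)"
    unfolding borel_prod[symmetric] by measurable
  have [measurable]: "{c<..} \<times> {d<..} \<in> sets (borel :: (real \<times> real) measure)"
    unfolding borel_prod[symmetric] by measurable
  have iff: "c < tail_radius \<alpha> t * u \<longleftrightarrow> 0 < t \<and> t < pos_powr (u / c) \<alpha>" if c: "c > 0" for c u t :: real
  proof (cases "u > 0")
    case True
    have "c < tail_radius \<alpha> t * u \<longleftrightarrow> c / u < tail_radius \<alpha> t" using True by (simp add: field_simps)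
    also have "\<dots> \<longleftrightarrow> 0 < t \<and> t < (c / u) powr (-\<alpha>)" using True that by (intro tail_radius_gt_iff a) auto
    also have "(c / u) powr (-\<alpha>) = (u / c) powr \<alpha>" using True that by (simp add: powr_minus powr_divide inverse_eq_divide)
    finally show ?thesis using True that by (simp add: pos_powr_def)
  next
    case False
    then have "tail_radius \<alpha> t * u \<le> 0" using tail_radius_nonneg[of \<alpha> t] by (simp add: mult_nonneg_nonpos)
    moreover have "u / c \<le> 0" using False that by (simp add: divide_nonpos_pos)
    ultimately show ?thesis using that by (auto simp: pos_powr_def max_def)
  qed
  have nn: "0 \<le> pos_powr x \<alpha>" for x by (simp add: pos_powr_def)
  have "emeasure (distr (lborel \<Otimes>\<^sub>M K) borel (\<lambda>(t,\<omega>). (tail_radius \<alpha> t * U \<omega>, tail_radius \<alpha> t * W \<omega>))) ({c<..} \<times> {d<..})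
     = (\<integral>\<^sup>+z. indicator ({c<..} \<times> {d<..}) z \<partial>distr (lborel \<Otimes>\<^sub>M K) borel (\<lambda>(t,\<omega>). (tail_radius \<alpha> t * U \<omega>, tail_radius \<alpha> t * W \<omega>)))"
    by simp
  also have "\<dots> = (\<integral>\<^sup>+x. indicator ({c<..} \<times> {d<..}) (case x of (t,\<omega>) \<Rightarrow> (tail_radius \<alpha> t * U \<omega>, tail_radius \<alpha> t * W \<omega>)) \<partial>(lborel \<Otimes>\<^sub>M K))"
    by (rule nn_integral_distr) measurable
  also have "\<dots> = (\<integral>\<^sup>+\<omega>. (\<integral>\<^sup>+t. indicator ({c<..} \<times> {d<..}) (tail_radius \<alpha> t * U \<omega>, tail_radius \<alpha> t * W \<omega>) \<partial>lborel) \<partial>K)"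
    by (subst P.nn_integral_snd[symmetric]) auto
  also have "\<dots> = (\<integral>\<^sup>+\<omega>. ennreal (min (pos_powr (U \<omega> / c) \<alpha>) (pos_powr (W \<omega> / d) \<alpha>)) \<partial>K)"
  proof (rule nn_integral_cong)
    fix \<omega>
    have "(\<integral>\<^sup>+t. indicator ({c<..} \<times> {d<..}) (tail_radius \<alpha> t * U \<omega>, tail_radius \<alpha> t * W \<omega>) \<partial>lborel) =
       (\<integral>\<^sup>+t. indicator {0<..<min (pos_powr (U \<omega> / c) \<alpha>) (pos_powr (W \<omega> / d) \<alpha>)} t \<partial>lborel)"
      by (intro nn_integral_cong) (auto simp: indicator_def iff[OF c(1)] iff[OF c(2)])
    also have "\<dots> = ennreal (min (pos_powr (U \<omega> / c) \<alpha>) (pos_powr (W \<omega> / d) \<alpha>))"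
      using nn by simp
    finally show "(\<integral>\<^sup>+t. indicator ({c<..} \<times> {d<..}) (tail_radius \<alpha> t * U \<omega>, tail_radius \<alpha> t * W \<omega>) \<partial>lborel) =
      ennreal (min (pos_powr (U \<omega> / c) \<alpha>) (pos_powr (W \<omega> / d) \<alpha>))" .
  qed
  also have "\<dots> = ennreal (\<integral>\<omega>. min (pos_powr (U \<omega> / c) \<alpha>) (pos_powr (W \<omega> / d) \<alpha>) \<partial>K)"
    using int nn by (intro nn_integral_eq_integral) auto
  finally show ?thesis .
qed

text \<open>Open upper quadrants are the sets above a point in the order \<open>eucl_less\<close>.
  They are closed under intersection and generate the Borel sets of the plane.\<close>

lemma measure_eq_upper_quadrants:
  fixes \<mu> \<nu> :: "(real \<times> real) measure"
  assumes "finite_measure \<mu>" "sets \<mu> = sets borel" "sets \<nu> = sets borel"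
    and eq: "\<And>c d. emeasure \<mu> ({c<..} \<times> {d<..}) = emeasure \<nu> ({c<..} \<times> {d<..})"
  shows "\<mu> = \<nu>"
proof -
  interpret finite_measure \<mu> by fact
  define E where "E = range (\<lambda>a::real \<times> real. {x. eucl_less a x})"
  have el: "{x. eucl_less a x} = {fst a<..} \<times> {snd a<..}" for a :: "real \<times> real"
    by (cases a) (auto simp: eucl_less_def Basis_prod_def)
  have sE: "sets borel = sigma_sets UNIV E"
    by (subst borel_eq_greaterThan) (simp add: E_def)
  show ?thesis
  proof (rule measure_eqI_generator_eq[where E=E and \<Omega>=UNIV and A="\<lambda>n::nat. {- real n<..} \<times> {- real n<..}"])
    show "Int_stable E"
    proof (rule Int_stableI)
      fix a b assume "a \<in> E" "b \<in> E"
      then obtain c d where "a = {fst c<..} \<times> {snd c<..}" "b = {fst d<..} \<times> {snd d<..}" by (auto simp: E_def el)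
      then have "a \<inter> b = {x. eucl_less (max (fst c) (fst d), max (snd c) (snd d)) x}" by (auto simp: el)
      then show "a \<inter> b \<in> E" by (auto simp: E_def)
    qed
    show "range (\<lambda>n::nat. {- real n<..} \<times> {- real n<..}) \<subseteq> E"
    proof safe
      fix n :: nat
      have "{- real n<..} \<times> {- real n<..} = {x. eucl_less (- real n, - real n) x}" by (simp add: el)
      then show "{- real n<..} \<times> {- real n<..} \<in> E" unfolding E_def by blast
    qed
    show "(\<Union>n::nat. {- real n<..} \<times> {- real n<..}) = (UNIV :: (real \<times> real) set)"
    proof safe
      fix a b :: real
      obtain n where "max (-a) (-b) < real n" using reals_Archimedean2 by blast
      then show "(a, b) \<in> (\<Union>n::nat. {- real n<..} \<times> {- real n<..})" by (auto intro!: exI[of _ n])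
    qed auto
    show "emeasure \<mu> ({- real i<..} \<times> {- real i<..}) \<noteq> \<infinity>" for i :: nat
      using emeasure_finite by simp
  qed (use eq assms(2,3) in \<open>auto simp: sE E_def el\<close>)
qed

text \<open>The images \<open>Q\<close> of the product measure can be infinite, so uniqueness of
  measures is applied to their restrictions \<open>\<rho>\<close> to one quadrant with positive
  corner; these are finite and agree on all upper quadrants.\<close>

lemma quadrant_integral_eq:
  fixes U1 W1 U2 W2 :: "'c \<Rightarrow> real" and G :: "real \<times> real \<Rightarrow> real"
  assumes K: "prob_space K" and a: "\<alpha> > 0"
    and [measurable]: "U1 \<in> borel_measurable K" "W1 \<in> borel_measurable K" "U2 \<in> borel_measurable K" "W2 \<in> borel_measurable K"
    and ab: "a > 0" "b > 0"
    and int1: "\<And>c d. c > 0 \<Longrightarrow> d > 0 \<Longrightarrow> integrable K (\<lambda>\<omega>. min (pos_powr (U1 \<omega> / c) \<alpha>) (pos_powr (W1 \<omega> / d) \<alpha>))"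
    and int2: "\<And>c d. c > 0 \<Longrightarrow> d > 0 \<Longrightarrow> integrable K (\<lambda>\<omega>. min (pos_powr (U2 \<omega> / c) \<alpha>) (pos_powr (W2 \<omega> / d) \<alpha>))"
    and eq: "\<And>c d. c > 0 \<Longrightarrow> d > 0 \<Longrightarrow> (\<integral>\<omega>. min (pos_powr (U1 \<omega> / c) \<alpha>) (pos_powr (W1 \<omega> / d) \<alpha>) \<partial>K)
        = (\<integral>\<omega>. min (pos_powr (U2 \<omega> / c) \<alpha>) (pos_powr (W2 \<omega> / d) \<alpha>) \<partial>K)"
    and G[measurable]: "G \<in> borel_measurable borel" and B: "\<And>z. \<bar>G z\<bar> \<le> B"
  defines "F \<equiv> \<lambda>U W (t,\<omega>::'c). G (tail_radius \<alpha> t * U \<omega>, tail_radius \<alpha> t * W \<omega>) * indicator ({a<..} \<times> {b<..}) (tail_radius \<alpha> t * U \<omega>, tail_radius \<alpha> t * W \<omega>)"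
  shows "integrable (lborel \<Otimes>\<^sub>M K) (F U1 W1)" "integrable (lborel \<Otimes>\<^sub>M K) (F U2 W2)"
    "(\<integral>z. F U1 W1 z \<partial>(lborel \<Otimes>\<^sub>M K)) = (\<integral>z. F U2 W2 z \<partial>(lborel \<Otimes>\<^sub>M K))"
proof -
  define R where "R = {a<..} \<times> {b<..}"
  define T where "T U W = (\<lambda>(t,\<omega>::'c). (tail_radius \<alpha> t * U \<omega>, tail_radius \<alpha> t * W \<omega>))" for U W
  define Q where "Q U W = distr (lborel \<Otimes>\<^sub>M K) borel (T U W)" for U W
  define \<rho> where "\<rho> U W = density (Q U W) (indicator R)" for U W
  have [measurable]: "{c<..} \<times> {d<..} \<in> sets (borel :: (real \<times> real) measure)" for c d
    unfolding borel_prod[symmetric] by measurable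
  then have [measurable]: "R \<in> sets borel" by (simp add: R_def)
  have B0: "B \<ge> 0" using B[of undefined] by linarith
  have Tm[measurable]: "T U W \<in> borel_measurable (lborel \<Otimes>\<^sub>M K)"
    if [measurable]: "U \<in> borel_measurable K" "W \<in> borel_measurable K" for U W
    unfolding T_def borel_prod[symmetric] by measurable
  have sets: "sets (\<rho> U W) = sets borel" "sets (Q U W) = sets borel" for U W by (auto simp: \<rho>_def Q_def)
  \<comment> \<open>Restricting to \<open>R\<close> only raises the corner to
    \<open>(max a c, max b d)\<close>, so the hypotheses, which concern positive corners, suffice
    for arbitrary \<open>c\<close> and \<open>d\<close>.\<close>
  have em: "emeasure (\<rho> U W) ({c<..} \<times> {d<..}) = emeasure (Q U W) ({max a c<..} \<times> {max b d<..})" for U W c d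
  proof -
    have "emeasure (\<rho> U W) ({c<..} \<times> {d<..}) = (\<integral>\<^sup>+z. indicator R z * indicator ({c<..} \<times> {d<..}) z \<partial>Q U W)"
      unfolding \<rho>_def by (rule emeasure_density) (auto simp: measurable_cong_sets[OF sets(2) refl] sets)
    also have "\<dots> = (\<integral>\<^sup>+z. indicator ({max a c<..} \<times> {max b d<..}) z \<partial>Q U W)"
      by (intro nn_integral_cong) (auto simp: indicator_def R_def)
    finally show ?thesis by (simp add: sets)
  qed
  have Qm: "emeasure (Q U1 W1) ({max a c<..} \<times> {max b d<..}) = emeasure (Q U2 W2) ({max a c<..} \<times> {max b d<..})" for c d
    unfolding Q_def T_def using ab
    by (subst (1 2) emeasure_tail_rectangle[OF K a]) (auto intro!: int1 int2 arg_cong[where f=ennreal] eq)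
  have QR: "emeasure (Q U1 W1) R < \<infinity>" "emeasure (Q U2 W2) R < \<infinity>"
    unfolding Q_def T_def R_def using ab
    by (subst emeasure_tail_rectangle[OF K a]; auto intro!: int1 int2)+
  have \<rho>eq: "\<rho> U1 W1 = \<rho> U2 W2"
  proof (rule measure_eq_upper_quadrants)
    have "emeasure (\<rho> U1 W1) UNIV = (\<integral>\<^sup>+z. indicator R z * indicator UNIV z \<partial>Q U1 W1)"
      unfolding \<rho>_def by (rule emeasure_density) (auto simp: measurable_cong_sets[OF sets(2) refl] sets)
    also have "\<dots> = emeasure (Q U1 W1) R" by (simp add: sets)
    finally show "finite_measure (\<rho> U1 W1)"
      using QR(1) by (intro finite_measureI) (simp add: \<rho>_def Q_def less_top)
    show "emeasure (\<rho> U1 W1) ({c<..} \<times> {d<..}) = emeasure (\<rho> U2 W2) ({c<..} \<times> {d<..})" for c d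
      by (simp add: em Qm)
  qed (auto simp: sets)
  have F: "F U W = (\<lambda>x. (\<lambda>z. G z * indicator R z) (T U W x))" for U W
    by (auto simp: F_def T_def R_def fun_eq_iff)
  have integ: "integrable (lborel \<Otimes>\<^sub>M K) (F U W)"
    if [measurable]: "U \<in> borel_measurable K" "W \<in> borel_measurable K" and fin: "emeasure (Q U W) R < \<infinity>" for U W
  proof -
    have "integrable (Q U W) (\<lambda>z. G z * indicator R z)"
    proof (rule Bochner_Integration.integrable_bound)
      show "integrable (Q U W) (\<lambda>z. B * indicator R z :: real)"
        using fin by (intro integrable_mult_right integrable_real_indicator) (auto simp: sets)
    qed (use B B0 in \<open>auto simp: measurable_cong_sets[OF sets(2) refl] indicator_def\<close>)
    then show ?thesis unfolding F Q_def by (subst (asm) integrable_distr_eq) auto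
  qed
  have Fint: "(\<integral>z. F U W z \<partial>(lborel \<Otimes>\<^sub>M K)) = (\<integral>z. G z \<partial>\<rho> U W)"
    if [measurable]: "U \<in> borel_measurable K" "W \<in> borel_measurable K" for U W
  proof -
    have "(\<integral>z. F U W z \<partial>(lborel \<Otimes>\<^sub>M K)) = (\<integral>z. G z * indicator R z \<partial>Q U W)"
      unfolding F Q_def by (rule integral_distr[symmetric]) auto
    also have "\<dots> = (\<integral>z. indicator R z *\<^sub>R G z \<partial>Q U W)" by (simp add: mult.commute)
    also have "\<dots> = (\<integral>z. G z \<partial>density (Q U W) (\<lambda>z. ennreal (indicator R z)))"
      by (rule integral_density[symmetric]) (auto simp: measurable_cong_sets[OF sets(2) refl])
    finally show ?thesis by (simp add: \<rho>_def ennreal_indicator)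
  qed
  show "integrable (lborel \<Otimes>\<^sub>M K) (F U1 W1)" "integrable (lborel \<Otimes>\<^sub>M K) (F U2 W2)"
    using QR by (auto intro!: integ)
  show "(\<integral>z. F U1 W1 z \<partial>(lborel \<Otimes>\<^sub>M K)) = (\<integral>z. F U2 W2 z \<partial>(lborel \<Otimes>\<^sub>M K))"
    by (simp add: Fint \<rho>eq)
qed

text \<open>The adjointness condition allows negative \<open>x\<close> and \<open>y\<close>; taking
  \<open>\<sigma> / c\<close> and \<open>\<tau> / d\<close> with signs \<open>\<sigma>\<close>,
  \<open>\<tau>\<close> yields the masses in all four open quadrants. The axes remain undetermined,
  which is why \<open>G\<close> has to vanish near both of them.\<close>

lemma adjoint_integral_eq:
  fixes G :: "real \<times> real \<Rightarrow> real" and M0 M1 Mneg :: "'c \<Rightarrow> real"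
  assumes K: "prob_space K" and a: "\<alpha> > 0"
    and [measurable]: "M0 \<in> borel_measurable K" "M1 \<in> borel_measurable K" "Mneg \<in> borel_measurable K"
    and adj: "adjoint_law K \<alpha> M0 M1 Mneg" and sgn: "AE \<omega> in K. M0 \<omega> = 1 \<or> M0 \<omega> = -1"
    and ab: "a > 0" "b > 0"
    and G[measurable]: "G \<in> borel_measurable borel" and B: "\<And>z. \<bar>G z\<bar> \<le> B"
    and zero: "\<And>u w. \<bar>u\<bar> \<le> a \<or> \<bar>w\<bar> \<le> b \<Longrightarrow> G (u, w) = 0"
  shows "(\<integral>t. (\<integral>\<omega>. G (tail_radius \<alpha> t * M0 \<omega>, tail_radius \<alpha> t * M1 \<omega>) \<partial>K) \<partial>lborel)
       = (\<integral>t. (\<integral>\<omega>. G (tail_radius \<alpha> t * Mneg \<omega>, tail_radius \<alpha> t * M0 \<omega>) \<partial>K) \<partial>lborel)"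
proof -
  interpret K: prob_space K by fact
  interpret P: pair_sigma_finite lborel K ..
  \<comment> \<open>The inner signs reflect one of the four quadrants onto the positive one; the
    outer signs undo the reflection in the argument of \<open>G\<close>.\<close>
  define F where "F \<sigma> \<tau> U W = (\<lambda>(t,\<omega>::'c). G (\<sigma> * (tail_radius \<alpha> t * (\<sigma> * U \<omega>)), \<tau> * (tail_radius \<alpha> t * (\<tau> * W \<omega>)))
     * indicator ({a<..} \<times> {b<..}) (tail_radius \<alpha> t * (\<sigma> * U \<omega>), tail_radius \<alpha> t * (\<tau> * W \<omega>)))" for \<sigma> \<tau> U W
  have nn: "0 \<le> pos_powr x \<alpha>" for x by (simp add: pos_powr_def)
  have bd: "AE \<omega> in K. pos_powr (s * M0 \<omega> / c) \<alpha> \<le> (1/c) powr \<alpha>" if "c > 0" "\<bar>s\<bar> = 1" for c s :: real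
    using sgn
  proof eventually_elim
    case (elim \<omega>)
    have "s * M0 \<omega> \<le> 1" using elim that(2) by (auto simp: abs_if split: if_splits)
    then show ?case using that a unfolding pos_powr_def by (intro powr_mono2) (auto simp: divide_right_mono)
  qed
  \<comment> \<open>The minimum is bounded by its \<open>M0\<close> term, and \<open>M0\<close> has
    modulus 1 almost surely, whatever the tails of \<open>V\<close> are.\<close>
  have int1: "integrable K (\<lambda>\<omega>. min (pos_powr (s * M0 \<omega> / c) \<alpha>) (pos_powr (t * V \<omega> / d) \<alpha>))"
    if "c > 0" "\<bar>s\<bar> = 1" and [measurable]: "V \<in> borel_measurable K" for c d s t and V :: "'c \<Rightarrow> real"
  proof (rule K.integrable_const_bound)
    show "AE \<omega> in K. norm (min (pos_powr (s * M0 \<omega> / c) \<alpha>) (pos_powr (t * V \<omega> / d) \<alpha>)) \<le> (1/c) powr \<alpha>"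
      using bd[OF that(1,2)]
    proof eventually_elim
      case (elim \<omega>)
      have "0 \<le> min (pos_powr (s * M0 \<omega> / c) \<alpha>) (pos_powr (t * V \<omega> / d) \<alpha>)" using nn by simp
      then show ?case using elim by (simp add: min.coboundedI1)
    qed
  qed (simp add: pos_powr_def)
  have key: "integrable (lborel \<Otimes>\<^sub>M K) (F \<sigma> \<tau> M0 M1) \<and> integrable (lborel \<Otimes>\<^sub>M K) (F \<sigma> \<tau> Mneg M0) \<and>
    (\<integral>z. F \<sigma> \<tau> M0 M1 z \<partial>(lborel \<Otimes>\<^sub>M K)) = (\<integral>z. F \<sigma> \<tau> Mneg M0 z \<partial>(lborel \<Otimes>\<^sub>M K))"
    if s: "\<bar>\<sigma>\<bar> = 1" "\<bar>\<tau>\<bar> = 1" for \<sigma> \<tau> :: real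
  proof -
    have i2: "integrable K (\<lambda>\<omega>. min (pos_powr (\<sigma> * Mneg \<omega> / c) \<alpha>) (pos_powr (\<tau> * M0 \<omega> / d) \<alpha>))" if "d > 0" for c d
      using int1[OF that s(2), of Mneg \<sigma> c] by (simp add: min.commute)
    have e: "(\<integral>\<omega>. min (pos_powr (\<sigma> * M0 \<omega> / c) \<alpha>) (pos_powr (\<tau> * M1 \<omega> / d) \<alpha>) \<partial>K)
        = (\<integral>\<omega>. min (pos_powr (\<sigma> * Mneg \<omega> / c) \<alpha>) (pos_powr (\<tau> * M0 \<omega> / d) \<alpha>) \<partial>K)" for c d
      using adj[unfolded adjoint_law_def, rule_format, of "\<sigma>/c" "\<tau>/d"] by simp
    have gm: "(\<lambda>z. G (\<sigma> * fst z, \<tau> * snd z)) \<in> borel_measurable borel"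
      unfolding borel_prod[symmetric] using G unfolding borel_prod[symmetric] by measurable
    show ?thesis
      using quadrant_integral_eq[OF K a, of "\<lambda>\<omega>. \<sigma> * M0 \<omega>" "\<lambda>\<omega>. \<tau> * M1 \<omega>" "\<lambda>\<omega>. \<sigma> * Mneg \<omega>" "\<lambda>\<omega>. \<tau> * M0 \<omega>" a b "\<lambda>z. G (\<sigma> * fst z, \<tau> * snd z)" B,
        OF _ _ _ _ ab _ _ _ gm B] int1[OF _ s(1)] i2 e
      unfolding F_def by simp
  qed
  \<comment> \<open>Away from the two strips exactly one sign pattern has a nonzero indicator, and
    its summand is \<open>G\<close> at the original point; in the strips \<open>G\<close> and all
    summands are 0.\<close>
  have split: "G (z * u, z * w) = 
     (\<Sum>\<sigma>\<in>{1,-1}. \<Sum>\<tau>\<in>{1,-1}. G (\<sigma> * (z * (\<sigma> * u)), \<tau> * (z * (\<tau> * w))) * indicator ({a<..} \<times> {b<..}) (z * (\<sigma> * u), z * (\<tau> * w)))" for z u w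
  proof (cases "\<bar>z * u\<bar> \<le> a \<or> \<bar>z * w\<bar> \<le> b")
    case True
    have sum2: "(\<Sum>\<sigma>\<in>{1,-1::real}. f \<sigma>) = f 1 + f (-1)" for f :: "real \<Rightarrow> real" by simp
    show ?thesis unfolding sum2 using zero[OF True] True by (auto simp: indicator_def abs_le_iff)
  next
    case False
    have "z * u > a \<or> z * u < - a" "z * w > b \<or> z * w < - b" using False by auto
    then show ?thesis using ab by (auto simp: indicator_def)
  qed
  have eq: "(\<lambda>(t,\<omega>). G (tail_radius \<alpha> t * U \<omega>, tail_radius \<alpha> t * W \<omega>)) = (\<lambda>z. \<Sum>\<sigma>\<in>{1,-1}. \<Sum>\<tau>\<in>{1,-1}. F \<sigma> \<tau> U W z)" for U W
  proof
    fix z :: "real \<times> 'c"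
    show "(case z of (t,\<omega>) \<Rightarrow> G (tail_radius \<alpha> t * U \<omega>, tail_radius \<alpha> t * W \<omega>)) = (\<Sum>\<sigma>\<in>{1,-1}. \<Sum>\<tau>\<in>{1,-1}. F \<sigma> \<tau> U W z)"
      unfolding F_def by (cases z) (simp only: prod.case split[of "tail_radius \<alpha> _"])
  qed
  have i: "integrable (lborel \<Otimes>\<^sub>M K) (\<lambda>(t,\<omega>). G (tail_radius \<alpha> t * M0 \<omega>, tail_radius \<alpha> t * M1 \<omega>))"
    "integrable (lborel \<Otimes>\<^sub>M K) (\<lambda>(t,\<omega>). G (tail_radius \<alpha> t * Mneg \<omega>, tail_radius \<alpha> t * M0 \<omega>))"
    unfolding eq using key by (auto intro!: Bochner_Integration.integrable_sum Bochner_Integration.integrable_add)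
  have "(\<integral>z. (\<lambda>(t,\<omega>). G (tail_radius \<alpha> t * M0 \<omega>, tail_radius \<alpha> t * M1 \<omega>)) z \<partial>(lborel \<Otimes>\<^sub>M K)) =
    (\<integral>z. (\<lambda>(t,\<omega>). G (tail_radius \<alpha> t * Mneg \<omega>, tail_radius \<alpha> t * M0 \<omega>)) z \<partial>(lborel \<Otimes>\<^sub>M K))"
    unfolding eq using key by simp
  then show ?thesis
    using P.integral_fst'[OF i(1)] P.integral_fst'[OF i(2)] by simp
qed

section \<open>Conditional limits along sequences\<close>

lemma indep_rv_sym:
  assumes "prob_space M" "indep_rv M S U T V"
  shows "indep_rv M T V S U"
  using assms(2) unfolding indep_rv_iff[OF assms(1)] by (simp add: conj_commute mult.commute)

text \<open>The condition only speaks of functions of a real variable.  Given a sequence, a value at \<open>y = r k\<close>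
  is read off from an index \<open>k\<close> that violates the limit, if there is one.\<close>

lemma asymptotically_homogeneous_seq:
  assumes ah: "asymptotically_homogeneous T G g" and r: "filterlim r at_top sequentially"
    and w: "w \<longlonglongrightarrow> w0" and v: "limitin T v v0 sequentially"
  shows "(\<lambda>k::nat. G (r k * w k) (v k) / r k) \<longlonglongrightarrow> w0 * g v0 (sign_ge w0)"
proof (rule LIMSEQ_I)
  fix e :: real assume e: "e > 0"
  let ?L = "w0 * g v0 (sign_ge w0)"
  define bad where "bad k \<longleftrightarrow> norm (G (r k * w k) (v k) / r k - ?L) \<ge> e" for k
  define ex where "ex y \<longleftrightarrow> (\<exists>k. r k = y \<and> bad k)" for y
  define \<kappa> where "\<kappa> y = (SOME k. r k = y \<and> bad k)" for y
  have \<kappa>: "r (\<kappa> y) = y" "bad (\<kappa> y)" if "ex y" for y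
    using someI_ex[of "\<lambda>k. r k = y \<and> bad k"] that by (auto simp: ex_def \<kappa>_def)
  have ev: "\<forall>\<^sub>F y in at_top. ex y \<longrightarrow> P (\<kappa> y)" if ev: "\<forall>\<^sub>F k in sequentially. P k" for P
  proof -
    obtain n where n: "\<And>k. k \<ge> n \<Longrightarrow> P k" using ev by (auto simp: eventually_sequentially)
    show ?thesis
    proof (rule eventually_at_top_dense[THEN iffD2], intro exI allI impI)
      fix y assume y: "y > Max (insert 0 (r ` {..<n}))" "ex y"
      have "\<not> \<kappa> y < n"
      proof
        assume "\<kappa> y < n"
        then have "r (\<kappa> y) \<le> Max (insert 0 (r ` {..<n}))" by (intro Max_ge) auto
        then show False using y \<kappa>(1) by simp
      qed
      then show "P (\<kappa> y)" using n by simp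
    qed
  qed
  \<comment> \<open>Where no bad index exists, the limits themselves are inserted, so that both
    functions converge along the whole real filter.\<close>
  define w' where "w' y = (if ex y then w (\<kappa> y) else w0)" for y
  define v' where "v' y = (if ex y then v (\<kappa> y) else v0)" for y
  have "(w' \<longlongrightarrow> w0) at_top"
  proof (rule topological_tendstoI)
    fix S assume S: "open S" "w0 \<in> S"
    have "\<forall>\<^sub>F y in at_top. ex y \<longrightarrow> w (\<kappa> y) \<in> S" by (intro ev topological_tendstoD[OF w] S)
    then show "\<forall>\<^sub>F y in at_top. w' y \<in> S" by eventually_elim (use S in \<open>auto simp: w'_def\<close>)
  qed
  moreover have "limitin T v' v0 at_top"
    unfolding limitin_def
  proof (intro conjI allI impI)
    show "v0 \<in> topspace T" using v by (simp add: limitin_def)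
    fix S assume S: "openin T S \<and> v0 \<in> S"
    then have "\<forall>\<^sub>F k in sequentially. v k \<in> S" using v by (auto simp: limitin_def)
    from ev[OF this] show "\<forall>\<^sub>F y in at_top. v' y \<in> S" by eventually_elim (use S in \<open>auto simp: v'_def\<close>)
  qed
  ultimately have "((\<lambda>y. G (y * w' y) (v' y) / y) \<longlongrightarrow> ?L) at_top"
    using ah unfolding asymptotically_homogeneous_def by blast
  from tendstoD[OF this e] have "\<forall>\<^sub>F y in at_top. norm (G (y * w' y) (v' y) / y - ?L) < e"
    by (simp add: dist_real_def)
  then have "\<forall>\<^sub>F k in sequentially. norm (G (r k * w' (r k)) (v' (r k)) / r k - ?L) < e"
    by (rule eventually_compose_filterlim[OF _ r])
  \<comment> \<open>A bad \<open>k\<close> need not be the index selected for \<open>r k\<close>,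
    but the selected one is bad at the same point \<open>r k\<close> and contradicts the bound
    equally.\<close>
  moreover have "\<not> bad k" if "norm (G (r k * w' (r k)) (v' (r k)) / r k - ?L) < e" for k
  proof
    assume "bad k"
    then have "ex (r k)" by (auto simp: ex_def)
    from \<kappa>[OF this] show False using that \<open>ex (r k)\<close> by (simp add: w'_def v'_def bad_def)
  qed
  ultimately have "\<forall>\<^sub>F k in sequentially. \<not> bad k" by (auto elim: eventually_mono)
  then show "\<exists>n. \<forall>k\<ge>n. norm (G (r k * w k) (v k) / r k - ?L) < e"
    by (auto simp: bad_def eventually_sequentially not_le)
qed

section \<open>Vectors as functions on all integers, and weak limits along sequences\<close>

text \<open>Padding with zeros instead of \<open>undefined\<close> keeps all vectors in the one
  metric space \<open>int \<Rightarrow> real\<close>, to which \<open>ext_mapping\<close> applies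
  for every \<open>I\<close>.\<close>

definition proj :: "int set \<Rightarrow> (int \<Rightarrow> real) \<Rightarrow> int \<Rightarrow> real" where
  "proj I v = (\<lambda>i. if i \<in> I then v i else 0)"

lemma proj_insert: "proj (insert t I) v = (proj I v)(t := v t)" by (auto simp: proj_def)

lemma continuous_proj: "continuous_on UNIV (proj I)"
  unfolding proj_def
proof (rule continuous_on_coordinatewise_then_product)
  show "continuous_on UNIV (\<lambda>x. if i \<in> I then x i else (0::real))" for i
    by (cases "i \<in> I") (auto intro: continuous_on_product_coordinates)
qed

lemma measurable_proj: "(\<And>i. i \<in> I \<Longrightarrow> (\<lambda>\<omega>. Z \<omega> i) \<in> borel_measurable M) \<Longrightarrow> (\<lambda>\<omega>. proj I (Z \<omega>)) \<in> borel_measurable M"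
  unfolding proj_def
proof (rule measurable_coordinatewise_then_product)
  show "(\<lambda>\<omega>. if i \<in> I then Z \<omega> i else 0) \<in> borel_measurable M"
    if "\<And>i. i \<in> I \<Longrightarrow> (\<lambda>\<omega>. Z \<omega> i) \<in> borel_measurable M" for i
    by (cases "i \<in> I") (use that in auto)
qed

lemma measurable_fun_upd_borel:
  assumes "(\<lambda>\<omega>. f \<omega>) \<in> borel_measurable M" "(\<lambda>\<omega>. a \<omega>) \<in> borel_measurable M"
  shows "(\<lambda>\<omega>. (f \<omega>)(t := a \<omega> :: real) :: int \<Rightarrow> real) \<in> borel_measurable M"
proof (rule measurable_coordinatewise_then_product)
  show "(\<lambda>\<omega>. ((f \<omega>)(t := a \<omega>)) i) \<in> borel_measurable M" for i
    using assms(2) measurable_product_then_coordinatewise[OF assms(1), of i] by (cases "i = t") auto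
qed

lemma dist_fun_summable: "summable (\<lambda>n. (1/2)^n * min (dist ((x::int\<Rightarrow>real) (from_nat n)) (y (from_nat n))) 1)"
  by (rule summable_comparison_test'[where g="\<lambda>n. (1/2)^n" and N=0]) (auto simp: mult_le_cancel_left1)

text \<open>The metric sums coordinate distances, truncated at 1, with weights
  \<open>(1/2)^n\<close>. Each term is bounded by the change of the single altered coordinate, and
  the weights add up to 2.\<close>

lemma dist_fun_upd: "dist ((v::int\<Rightarrow>real)(t := a)) v \<le> 2 * \<bar>a - v t\<bar>"
proof -
  have "dist (v(t := a)) v \<le> (\<Sum>n. (1/2)^n * \<bar>a - v t\<bar>)"
    unfolding dist_fun_def
  proof (rule suminf_le)
    show "(1/2)^n * min (dist ((v(t := a)) (from_nat n)) (v (from_nat n))) 1 \<le> (1/2)^n * \<bar>a - v t\<bar>" for n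
      by (intro mult_left_mono) (auto simp: dist_real_def)
    show "summable (\<lambda>n. (1/2)^n * \<bar>a - v t\<bar>)" by (intro summable_mult2) simp
  qed (rule dist_fun_summable)
  also have "\<dots> = (\<Sum>n. (1/2)^n) * \<bar>a - v t\<bar>" by (rule suminf_mult2[symmetric]) simp
  also have "(\<Sum>n. (1/2::real)^n) = 2" by (simp add: suminf_geometric)
  finally show ?thesis .
qed

definition cond_mean :: "'a measure \<Rightarrow> ('a \<Rightarrow> real) \<Rightarrow> real \<Rightarrow> ('a \<Rightarrow> real) \<Rightarrow> real" where
  "cond_mean M X0 x f = (\<integral>\<omega>. f \<omega> * indicator {\<omega>. \<bar>X0 \<omega>\<bar> > x} \<omega> \<partial>M) / \<P>(\<omega> in M. \<bar>X0 \<omega>\<bar> > x)"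

lemma integral_uniform_measure_cond_mean:
  assumes "prob_space M" and [measurable]: "f \<in> borel_measurable M" "X0 \<in> borel_measurable M"
  shows "(\<integral>\<omega>. f \<omega> \<partial>uniform_measure M {\<omega> \<in> space M. \<bar>X0 \<omega>\<bar> > x}) = cond_mean M X0 x f"
proof -
  interpret prob_space M by fact
  have "(\<integral>\<omega>. f \<omega> \<partial>uniform_measure M {\<omega> \<in> space M. \<bar>X0 \<omega>\<bar> > x})
    = (\<integral>\<omega>. f \<omega> * indicator {\<omega> \<in> space M. \<bar>X0 \<omega>\<bar> > x} \<omega> \<partial>M) / \<P>(\<omega> in M. \<bar>X0 \<omega>\<bar> > x)"
    by (rule integral_uniform_measure_real) (auto simp: emeasure_eq_measure)
  also have "(\<integral>\<omega>. f \<omega> * indicator {\<omega> \<in> space M. \<bar>X0 \<omega>\<bar> > x} \<omega> \<partial>M) = (\<integral>\<omega>. f \<omega> * indicator {\<omega>. \<bar>X0 \<omega>\<bar> > x} \<omega> \<partial>M)"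
    by (intro Bochner_Integration.integral_cong) (auto simp: indicator_def)
  finally show ?thesis unfolding cond_mean_def .
qed

text \<open>The working form of the conditional weak limit. Sequences \<open>r\<close> fit
  continuous convergence, and few test functions make the induction steps easy to verify; the full
  class is recovered at the end.\<close>

definition seq_limit ::
    "'a measure \<Rightarrow> (int \<Rightarrow> 'a \<Rightarrow> real) \<Rightarrow> (int \<Rightarrow> 'a \<Rightarrow> real) \<Rightarrow> int set \<Rightarrow> 'b measure \<Rightarrow> (int \<Rightarrow> 'b \<Rightarrow> real) \<Rightarrow> bool" where
  "seq_limit M X Y I N Z \<longleftrightarrow> (\<forall>(f :: (int \<Rightarrow> real) \<Rightarrow> real) C r. C-lipschitz_on UNIV f \<longrightarrow> bounded (range f) \<longrightarrow>
      filterlim r at_top sequentially \<longrightarrow>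
      (\<lambda>n. cond_mean M (X 0) (r n) (\<lambda>\<omega>. f (proj I (\<lambda>i. Y i \<omega> / r n)))) \<longlonglongrightarrow> (\<integral>\<omega>. f (proj I (\<lambda>i. Z i \<omega>)) \<partial>N))"

text \<open>The conditional laws of the padded vector serve as \<open>\<mu> n\<close> in
  \<open>ext_mapping\<close>; they are probability measures because every exceedance event has
  positive probability.\<close>

lemma seq_limit_ext:
  fixes F :: "real \<Rightarrow> (int \<Rightarrow> real) \<Rightarrow> real"
  assumes M: "prob_space M" and N: "prob_space N"
    and XY[measurable]: "X 0 \<in> borel_measurable M" "\<And>t. Y t \<in> borel_measurable M" and Z[measurable]: "\<And>t. Z t \<in> borel_measurable N"
    and pos: "\<And>x. \<P>(\<omega> in M. \<bar>X 0 \<omega>\<bar> > x) > 0"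
    and sl: "seq_limit M X Y I N Z"
    and cc: "cconv F F0" and B: "\<And>x v. \<bar>F x v\<bar> \<le> B" and F[measurable]: "\<And>x. F x \<in> borel_measurable borel"
    and r: "filterlim r at_top sequentially"
  shows "(\<lambda>n. cond_mean M (X 0) (r n) (\<lambda>\<omega>. F (r n) (proj I (\<lambda>i. Y i \<omega> / r n)))) \<longlonglongrightarrow> (\<integral>\<omega>. F0 (proj I (\<lambda>i. Z i \<omega>)) \<partial>N)"
proof -
  interpret prob_space M by fact
  define E where "E n = {\<omega> \<in> space M. \<bar>X 0 \<omega>\<bar> > r n}" for n
  define \<mu> where "\<mu> n = distr (uniform_measure M (E n)) borel (\<lambda>\<omega>. proj I (\<lambda>i. Y i \<omega> / r n))" for n
  define \<nu> where "\<nu> = distr N borel (\<lambda>\<omega>. proj I (\<lambda>i. Z i \<omega>))"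
  have F0[measurable]: "F0 \<in> borel_measurable borel" by (rule cconv_limit_measurable[OF cc F])
  have m[measurable]: "(\<lambda>\<omega>. proj I (\<lambda>i. Y i \<omega> / r n)) \<in> borel_measurable M" for n by (rule measurable_proj) simp
  have mN[measurable]: "(\<lambda>\<omega>. proj I (\<lambda>i. Z i \<omega>)) \<in> borel_measurable N" by (rule measurable_proj) simp
  have mu: "(\<integral>z. f z \<partial>\<mu> n) = cond_mean M (X 0) (r n) (\<lambda>\<omega>. f (proj I (\<lambda>i. Y i \<omega> / r n)))"
    if [measurable]: "f \<in> borel_measurable borel" for f :: "(int \<Rightarrow> real) \<Rightarrow> real" and n
  proof -
    have "(\<integral>z. f z \<partial>\<mu> n) = (\<integral>\<omega>. f (proj I (\<lambda>i. Y i \<omega> / r n)) \<partial>uniform_measure M (E n))"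
      unfolding \<mu>_def by (rule integral_distr) (auto simp: measurable_cong_sets[OF sets_uniform_measure refl])
    then show ?thesis unfolding E_def by (simp add: integral_uniform_measure_cond_mean[OF M])
  qed
  have nu: "(\<integral>z. f z \<partial>\<nu>) = (\<integral>\<omega>. f (proj I (\<lambda>i. Z i \<omega>)) \<partial>N)"
    if [measurable]: "f \<in> borel_measurable borel" for f :: "(int \<Rightarrow> real) \<Rightarrow> real"
    unfolding \<nu>_def by (rule integral_distr) auto
  have "prob_space (uniform_measure M (E n))" for n
    using pos[of "r n"] by (intro prob_space_uniform_measure) (auto simp: E_def emeasure_eq_measure)
  then have mup: "prob_space (\<mu> n)" for n
    unfolding \<mu>_def by (rule prob_space.prob_space_distr) (auto simp: measurable_cong_sets[OF sets_uniform_measure refl])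
  have nup: "prob_space \<nu>" unfolding \<nu>_def by (rule prob_space.prob_space_distr[OF N]) auto
  have "(\<lambda>n. \<integral>z. F (r n) z \<partial>\<mu> n) \<longlonglongrightarrow> (\<integral>z. F0 z \<partial>\<nu>)"
  proof (rule ext_mapping[OF _ mup _ nup _ cc B r F])
    fix f :: "(int \<Rightarrow> real) \<Rightarrow> real" and C assume f: "C-lipschitz_on UNIV f" "bounded (range f)"
    have "f \<in> borel_measurable borel" by (rule lipschitz_borel[OF f(1)])
    then show "(\<lambda>n. \<integral>z. f z \<partial>\<mu> n) \<longlonglongrightarrow> (\<integral>z. f z \<partial>\<nu>)"
      using sl[unfolded seq_limit_def, rule_format, OF f r] by (simp add: mu nu)
  qed (auto simp: \<mu>_def \<nu>_def)
  then show ?thesis by (simp add: mu nu)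
qed

lemma integral_vec_of_cond_mean:
  fixes f :: "(int \<Rightarrow> real) \<Rightarrow> real"
  assumes M: "prob_space M" and XY[measurable]: "X 0 \<in> borel_measurable M" "\<And>t. Y t \<in> borel_measurable M"
    and f: "f \<in> borel_measurable (PiM I (\<lambda>_. borel))"
  shows "(\<integral>z. f z \<partial>cond_law M {\<omega> \<in> space M. \<bar>X 0 \<omega>\<bar> > x} (PiM I (\<lambda>_. borel)) (vec_of I (\<lambda>i \<omega>. Y i \<omega> / x)))
    = cond_mean M (X 0) x (\<lambda>\<omega>. f (\<lambda>i\<in>I. Y i \<omega> / x))"
proof -
  have m: "(\<lambda>\<omega>. \<lambda>i\<in>I. Y i \<omega> / x) \<in> measurable M (PiM I (\<lambda>_. borel))" by (intro measurable_restrict) simp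
  then have "(\<integral>z. f z \<partial>cond_law M {\<omega> \<in> space M. \<bar>X 0 \<omega>\<bar> > x} (PiM I (\<lambda>_. borel)) (vec_of I (\<lambda>i \<omega>. Y i \<omega> / x)))
     = (\<integral>\<omega>. f (\<lambda>i\<in>I. Y i \<omega> / x) \<partial>uniform_measure M {\<omega> \<in> space M. \<bar>X 0 \<omega>\<bar> > x})"
    unfolding cond_law_def vec_of_def using f
    by (intro integral_distr) (auto simp: measurable_cong_sets[OF sets_uniform_measure refl])
  then show ?thesis using measurable_compose[OF m f] by (simp add: integral_uniform_measure_cond_mean[OF M])
qed

text \<open>Padding by zeros and restriction to \<open>I\<close> translate the test functions into
  each other continuously. The passage from Lipschitz to all bounded continuous functions is
  \<open>seq_limit_ext\<close> for a family that does not depend on \<open>x\<close>.\<close>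

lemma exceedance_limit_iff_seq_limit:
  assumes M: "prob_space M" and N: "prob_space N"
    and XY[measurable]: "X 0 \<in> borel_measurable M" "\<And>t. Y t \<in> borel_measurable M" and Z[measurable]: "\<And>t. Z t \<in> borel_measurable N"
    and pos: "\<And>x. \<P>(\<omega> in M. \<bar>X 0 \<omega>\<bar> > x) > 0"
  shows "exceedance_limit M X Y I N Z \<longleftrightarrow> seq_limit M X Y I N Z"
proof
  have lawN: "(\<integral>z. f z \<partial>law_vec N I Z) = (\<integral>\<omega>. f (\<lambda>i\<in>I. Z i \<omega>) \<partial>N)"
    if "f \<in> borel_measurable (PiM I (\<lambda>_. borel))" for f :: "(int \<Rightarrow> real) \<Rightarrow> real"
    unfolding law_vec_def vec_of_def by (rule integral_distr[OF _ that]) (intro measurable_restrict, simp)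
  {
    assume ex: "exceedance_limit M X Y I N Z"
    show "seq_limit M X Y I N Z" unfolding seq_limit_def
    proof (intro allI impI)
      fix f :: "(int \<Rightarrow> real) \<Rightarrow> real" and C and r :: "nat \<Rightarrow> real"
      assume f: "C-lipschitz_on UNIV f" "bounded (range f)" and r: "filterlim r at_top sequentially"
      define g where "g z = f (proj I z)" for z
      have "continuous_map (product_topology (\<lambda>_. euclideanreal) I) euclidean (proj I)"
        unfolding euclidean_product_topology[symmetric] proj_def
      proof (rule continuous_map_coordinatewise_then_product)
        show "continuous_map (product_topology (\<lambda>_. euclideanreal) I) euclideanreal (\<lambda>x. if i \<in> I then x i else 0)" for i
          by (cases "i \<in> I") (auto intro: continuous_map_product_projection)
      qed auto
      moreover have "continuous_map euclidean euclideanreal f"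
        using lipschitz_on_continuous_on[OF f(1)] by simp
      ultimately have cg: "continuous_map (product_topology (\<lambda>_. euclideanreal) I) euclideanreal g"
        unfolding g_def using continuous_map_compose[of _ euclidean "proj I" euclideanreal f] by (simp add: o_def)
      have mg: "g \<in> borel_measurable (PiM I (\<lambda>_. borel))" by (rule continuous_map_imp_measurable_PiM[OF cg])
      have bg: "bounded (g ` topspace (product_topology (\<lambda>_. euclideanreal) I))"
        using f(2) by (rule bounded_subset) (auto simp: g_def)
      have [simp]: "g (\<lambda>i\<in>I. a i) = f (proj I a)" for a
        by (simp add: g_def) (rule arg_cong[where f=f]; auto simp: proj_def)
      have "((\<lambda>x. cond_mean M (X 0) x (\<lambda>\<omega>. f (proj I (\<lambda>i. Y i \<omega> / x)))) \<longlongrightarrow> (\<integral>\<omega>. f (proj I (\<lambda>i. Z i \<omega>)) \<partial>N)) at_top"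
        using ex[unfolded exceedance_limit_def weakly_tendsto_def, rule_format, OF cg bg]
        by (simp add: integral_vec_of_cond_mean[where M=M and X=X and Y=Y, OF M XY mg] lawN[OF mg])
      from filterlim_compose[OF this r]
      show "(\<lambda>n. cond_mean M (X 0) (r n) (\<lambda>\<omega>. f (proj I (\<lambda>i. Y i \<omega> / r n)))) \<longlonglongrightarrow> (\<integral>\<omega>. f (proj I (\<lambda>i. Z i \<omega>)) \<partial>N)" .
    qed
  next
    assume sl: "seq_limit M X Y I N Z"
    show "exceedance_limit M X Y I N Z" unfolding exceedance_limit_def weakly_tendsto_def
    proof (intro allI impI tendsto_at_topI_sequentially)
      fix f :: "(int \<Rightarrow> real) \<Rightarrow> real" and r :: "nat \<Rightarrow> real"
      assume f: "continuous_map (product_topology (\<lambda>_. euclideanreal) I) euclideanreal f"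
        "bounded (f ` topspace (product_topology (\<lambda>_. euclideanreal) I))" and r: "filterlim r at_top sequentially"
      have mf: "f \<in> borel_measurable (PiM I (\<lambda>_. borel))" by (rule continuous_map_imp_measurable_PiM[OF f(1)])
      define g where "g v = f (restrict v I)" for v
      have "continuous_map (product_topology (\<lambda>_. euclideanreal) UNIV)
          (product_topology (\<lambda>_. euclideanreal) I) (\<lambda>z. restrict z I)"
        by (auto simp: continuous_map_componentwise intro: continuous_map_product_projection)
      from continuous_map_compose[OF this f(1)]
      have cg: "continuous_on UNIV g" by (simp add: euclidean_product_topology o_def g_def)
      obtain B where "\<And>z. z \<in> topspace (product_topology (\<lambda>_. euclideanreal) I) \<Longrightarrow> \<bar>f z\<bar> \<le> B"
        using f(2) by (auto simp: bounded_iff)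
      then have B: "\<bar>g v\<bar> \<le> B" for v by (simp add: g_def)
      have [simp]: "g (proj I a) = f (\<lambda>i\<in>I. a i)" for a
        unfolding g_def by (rule arg_cong[where f=f]) (auto simp: proj_def)
      have "(\<lambda>n. cond_mean M (X 0) (r n) (\<lambda>\<omega>. g (proj I (\<lambda>i. Y i \<omega> / r n)))) \<longlonglongrightarrow> (\<integral>\<omega>. g (proj I (\<lambda>i. Z i \<omega>)) \<partial>N)"
        by (rule seq_limit_ext[OF M N XY Z pos sl cconv_const[OF cg] B borel_measurable_continuous_onI[OF cg] r])
      then show "(\<lambda>n. \<integral>z. f z \<partial>cond_law M {\<omega> \<in> space M. \<bar>X 0 \<omega>\<bar> > r n} (PiM I (\<lambda>_. borel)) (vec_of I (\<lambda>i \<omega>. Y i \<omega> / r n)))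
          \<longlonglongrightarrow> (\<integral>z. f z \<partial>law_vec N I Z)"
        by (simp add: integral_vec_of_cond_mean[where M=M and X=X and Y=Y, OF M XY mf] lawN[OF mf])
    qed
  }
qed

section \<open>The chain driven by future innovations\<close>

locale innovation_series =
  fixes M :: "'a measure" and \<epsilon> :: "int \<Rightarrow> 'a \<Rightarrow> 's :: {metric_space, second_countable_topology}"
    and X Y :: "int \<Rightarrow> 'a \<Rightarrow> real"
    and \<Phi> :: "real \<Rightarrow> 's \<Rightarrow> real" and \<Psi> :: "real \<Rightarrow> (nat \<Rightarrow> 's) \<Rightarrow> real"
    and \<phi> :: "'s \<Rightarrow> real \<Rightarrow> real" and \<psi> :: "(nat \<Rightarrow> 's) \<Rightarrow> real \<Rightarrow> real" and s :: nat
  assumes M: "prob_space M" and iid: "iid M \<epsilon>"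
    and \<Phi>: "case_prod \<Phi> \<in> borel_measurable (borel \<Otimes>\<^sub>M borel)"
    and \<Psi>: "case_prod \<Psi> \<in> borel_measurable (borel \<Otimes>\<^sub>M PiM {1..s} (\<lambda>_. borel))"
    and Ym[measurable]: "\<And>t. Y t \<in> borel_measurable M" and Xm[measurable]: "X 0 \<in> borel_measurable M"
    and Yrec: "\<And>t. AE \<omega> in M. Y t \<omega> = \<Phi> (Y (t - 1) \<omega>) (\<epsilon> t \<omega>)"
    and Xrec: "AE \<omega> in M. X 0 \<omega> = \<Psi> (Y 0 \<omega>) (\<lambda>i\<in>{1..s}. \<epsilon> (int i) \<omega>)"
    and innovations: "\<And>r. indep_rv M (PiM {r<..} (\<lambda>_. borel)) (vec_of {r<..} \<epsilon>)
                                     (PiM {..r} (\<lambda>_. borel)) (vec_of {..r} Y)"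
    and \<Phi>_hom: "asymptotically_homogeneous euclidean \<Phi> \<phi>"
    and \<Psi>_hom: "asymptotically_homogeneous (product_topology (\<lambda>_. euclidean) {1..s}) \<Psi> \<psi>"
begin

sublocale prob_space M by (rule M)

lemma eps_measurable[measurable]: "\<epsilon> t \<in> borel_measurable M"
  using iid unfolding iid_def indep_vars_def by auto

lemma \<Phi>_comp:
  assumes "f \<in> borel_measurable S" "g \<in> borel_measurable S"
  shows "(\<lambda>z. \<Phi> (f z) (g z)) \<in> borel_measurable S"
  using measurable_compose[OF measurable_Pair[OF assms] \<Phi>] by simp

lemma \<Psi>_comp:
  assumes "f \<in> borel_measurable S" "\<And>i. i \<in> {1..s} \<Longrightarrow> g i \<in> borel_measurable S"
  shows "(\<lambda>z. \<Psi> (f z) (\<lambda>i\<in>{1..s}. g i z)) \<in> borel_measurable S"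
  using measurable_compose[OF measurable_Pair[OF assms(1) measurable_restrict[of "{1..s}" g S "\<lambda>_. borel", OF assms(2)]] \<Psi>] by simp

lemma \<Phi>_cconv: "cconv (\<lambda>x w. \<Phi> (x * w) c / x) (\<lambda>w. w * \<phi> c (sign_ge w))"
  unfolding cconv_def
  by (intro allI impI asymptotically_homogeneous_seq[OF \<Phi>_hom]) auto

text \<open>Extensionality places \<open>c\<close> in the topological space of the product, without
  which the constant sequence would have no limit there.\<close>

lemma \<Psi>_cconv: "c \<in> extensional {1..s} \<Longrightarrow> cconv (\<lambda>x w. \<Psi> (x * w) c / x) (\<lambda>w. w * \<psi> c (sign_ge w))"
  unfolding cconv_def
  by (intro allI impI asymptotically_homogeneous_seq[OF \<Psi>_hom]) (auto simp: PiE_def)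

text \<open>Measurability of \<open>\<phi>\<close> follows from that of \<open>\<Phi>\<close>: at
  \<open>w = 1\<close> and \<open>w = -1\<close> the scaled functions converge pointwise to the two
  slices, the second one with a minus sign.\<close>

lemma \<phi>_measurable: "(\<lambda>c. \<phi> c 1) \<in> borel_measurable borel" "(\<lambda>c. \<phi> c (-1)) \<in> borel_measurable borel"
proof -
  have 1: "(\<lambda>k. \<Phi> (real k * w) c / real k) \<longlonglongrightarrow> w * \<phi> c (sign_ge w)" for w c
    using cconv_pointwise[OF \<Phi>_cconv, of w c] .
  have 2: "(\<lambda>c. w * \<phi> c (sign_ge w)) \<in> borel_measurable borel" for w
    by (rule borel_measurable_LIMSEQ_real[OF 1]) (intro borel_measurable_divide \<Phi>_comp; simp)
  show "(\<lambda>c. \<phi> c 1) \<in> borel_measurable borel" using 2[of 1] by (simp add: sign_ge_def)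
  have "(\<lambda>c. - (- 1 * \<phi> c (sign_ge (-1)))) \<in> borel_measurable borel" by (rule borel_measurable_uminus[OF 2])
  then show "(\<lambda>c. \<phi> c (-1)) \<in> borel_measurable borel" by (simp add: sign_ge_def)
qed

text \<open>If \<open>w = Y j / x\<close> and \<open>e\<close> are the innovations, then \<open>chain j e x w i = Y (j + i) / x\<close>; the innovations
  before time \<open>j + 1\<close> are not used.\<close>

primrec chain :: "int \<Rightarrow> (int \<Rightarrow> 's) \<Rightarrow> real \<Rightarrow> real \<Rightarrow> nat \<Rightarrow> real" where
  "chain j e x w 0 = w"
| "chain j e x w (Suc i) = \<Phi> (x * chain j e x w i) (e (j + 1 + int i)) / x"

primrec chain_lim :: "int \<Rightarrow> (int \<Rightarrow> 's) \<Rightarrow> real \<Rightarrow> nat \<Rightarrow> real" where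
  "chain_lim j e w 0 = w"
| "chain_lim j e w (Suc i) = chain_lim j e w i * \<phi> (e (j + 1 + int i)) (sign_ge (chain_lim j e w i))"

text \<open>The zeros before \<open>j\<close> are a filler: later, coordinate \<open>j - 1\<close>
  is overwritten, and earlier coordinates are not seen by the test functions.\<close>

definition path :: "int \<Rightarrow> (int \<Rightarrow> 's) \<Rightarrow> real \<Rightarrow> real \<Rightarrow> int \<Rightarrow> real" where
  "path j e x w = (\<lambda>i. if i < j then 0 else chain j e x w (nat (i - j)))"

definition path_lim :: "int \<Rightarrow> (int \<Rightarrow> 's) \<Rightarrow> real \<Rightarrow> int \<Rightarrow> real" where
  "path_lim j e w = (\<lambda>i. if i < j then 0 else chain_lim j e w (nat (i - j)))"

text \<open>For \<open>j \<le> 0\<close> this is \<open>X 0 / x\<close> as a function of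
  \<open>w = Y j / x\<close> and of the innovations after time \<open>j\<close>.\<close>

definition trigger :: "int \<Rightarrow> (int \<Rightarrow> 's) \<Rightarrow> real \<Rightarrow> real \<Rightarrow> real" where
  "trigger j e x w = \<Psi> (x * path j e x w 0) (\<lambda>i\<in>{1..s}. e (int i)) / x"

definition trigger_lim :: "int \<Rightarrow> (int \<Rightarrow> 's) \<Rightarrow> real \<Rightarrow> real" where
  "trigger_lim j e w = path_lim j e w 0 * \<psi> (\<lambda>i\<in>{1..s}. e (int i)) (sign_ge (path_lim j e w 0))"

lemma chain_cconv: "cconv (\<lambda>x w. chain j e x w i) (\<lambda>w. chain_lim j e w i)"
proof (induction i)
  case 0
  show ?case by (simp add: cconv_def)
next
  case (Suc i)
  show ?case using cconv_compose[OF \<Phi>_cconv Suc] by simp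
qed

lemma path_cconv: "cconv (path j e) (path_lim j e)"
proof (rule cconv_fun)
  show "cconv (\<lambda>x v. path j e x v i) (\<lambda>v. path_lim j e v i)" for i
    using chain_cconv[of j e "nat (i - j)"] by (cases "i < j") (auto simp: path_def path_lim_def cconv_def)
qed

lemma trigger_cconv: "cconv (trigger j e) (trigger_lim j e)"
proof -
  have "cconv (\<lambda>x w. path j e x w 0) (\<lambda>w. path_lim j e w 0)"
    using path_cconv[of j e] unfolding cconv_def tendsto_fun_iff by blast
  from cconv_compose[OF \<Psi>_cconv this, of "\<lambda>i\<in>{1..s}. e (int i)"]
  show ?thesis by (simp add: trigger_def[abs_def] trigger_lim_def[abs_def])
qed

lemma path_lim_0: "path_lim j e 0 i = 0"
proof -
  have "chain_lim j e 0 n = 0" for n by (induction n) auto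
  then show ?thesis by (simp add: path_lim_def)
qed

text \<open>The chain started at 0 stays at 0 in the limit, so a negligible \<open>Y j\<close>
  cannot produce an exceedance of \<open>X 0\<close>. This justifies cutting out the region where
  \<open>Y j / x\<close> is small.\<close>

lemma trigger_lim_0: "trigger_lim j e 0 = 0" by (simp add: trigger_lim_def path_lim_0)

lemma chain_cong: "(\<And>t. j < t \<Longrightarrow> t \<le> j + int i \<Longrightarrow> e t = e' t) \<Longrightarrow> chain j e x w i = chain j e' x w i"
  by (induction i) auto

lemma chain_measurable:
  assumes "{j<..j + int i} \<subseteq> J"
  shows "(\<lambda>z. chain j (snd z) x (fst z) i) \<in> borel_measurable (borel \<Otimes>\<^sub>M PiM J (\<lambda>_. borel))"
  using assms
proof (induction i)
  case 0
  show ?case by simp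
next
  case (Suc i)
  have "j + 1 + int i \<in> J" using Suc.prems by auto
  then have "(\<lambda>z. snd z (j + 1 + int i)) \<in> borel_measurable (borel \<Otimes>\<^sub>M PiM J (\<lambda>_. borel))"
    by (intro measurable_compose[OF measurable_snd measurable_component_singleton])
  moreover have "(\<lambda>z. chain j (snd z) x (fst z) i) \<in> borel_measurable (borel \<Otimes>\<^sub>M PiM J (\<lambda>_. borel))"
    by (rule Suc.IH) (use Suc.prems in auto)
  ultimately show ?case by (auto intro!: borel_measurable_divide \<Phi>_comp borel_measurable_times)
qed

lemma path_measurable:
  assumes "{j<..i} \<subseteq> J"
  shows "(\<lambda>z. path j (snd z) x (fst z) i) \<in> borel_measurable (borel \<Otimes>\<^sub>M PiM J (\<lambda>_. borel))"
  using chain_measurable[of j "nat (i - j)" J x] assms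
  by (cases "i < j") (auto simp: path_def)

lemma trigger_measurable:
  assumes "j \<le> 0" "{j<..int s} \<subseteq> J"
  shows "(\<lambda>z. trigger j (snd z) x (fst z)) \<in> borel_measurable (borel \<Otimes>\<^sub>M PiM J (\<lambda>_. borel))"
  unfolding trigger_def
proof (intro borel_measurable_divide \<Psi>_comp borel_measurable_times path_measurable borel_measurable_const)
  show "{j<..0} \<subseteq> J" using assms by auto
  show "(\<lambda>z. snd z (int i)) \<in> borel_measurable (borel \<Otimes>\<^sub>M PiM J (\<lambda>_. borel))" if "i \<in> {1..s}" for i
    using that assms by (intro measurable_compose[OF measurable_snd measurable_component_singleton]) auto
qed

lemma path_eq: "AE \<omega> in M. \<forall>i\<ge>j. path j (\<lambda>t. \<epsilon> t \<omega>) x (Y j \<omega> / x) i = Y i \<omega> / x" if "x \<noteq> 0"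
proof -
  have "AE \<omega> in M. \<forall>t. Y t \<omega> = \<Phi> (Y (t - 1) \<omega>) (\<epsilon> t \<omega>)"
    using Yrec by (simp add: AE_all_countable)
  then show ?thesis
  proof eventually_elim
    case (elim \<omega>)
    have "chain j (\<lambda>t. \<epsilon> t \<omega>) x (Y j \<omega> / x) n = Y (j + int n) \<omega> / x" for n
    proof (induction n)
      case (Suc n)
      have "Y (j + 1 + int n) \<omega> = \<Phi> (Y (j + int n) \<omega>) (\<epsilon> (j + 1 + int n) \<omega>)"
        using elim[rule_format, of "j + 1 + int n"] by (simp add: algebra_simps)
      then show ?case using Suc that by (simp add: algebra_simps)
    qed simp
    then show ?case by (simp add: path_def)
  qed
qed

lemma trigger_eq: "AE \<omega> in M. trigger j (\<lambda>t. \<epsilon> t \<omega>) x (Y j \<omega> / x) = X 0 \<omega> / x" if "x \<noteq> 0" "j \<le> 0"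
  using path_eq[OF that(1), of j] Xrec
proof eventually_elim
  case (elim \<omega>)
  have "path j (\<lambda>t. \<epsilon> t \<omega>) x (Y j \<omega> / x) 0 = Y 0 \<omega> / x" using elim(1) that(2) by blast
  then show ?case using elim(2) that by (simp add: trigger_def)
qed

lemma path_restrict: "{j<..i} \<subseteq> J \<Longrightarrow> path j (restrict e J) x w i = path j e x w i"
  unfolding path_def by (auto intro!: chain_cong)

lemma trigger_restrict: "j \<le> 0 \<Longrightarrow> {j<..int s} \<subseteq> J \<Longrightarrow> trigger j (restrict e J) x w = trigger j e x w"
proof -
  assume a: "j \<le> 0" "{j<..int s} \<subseteq> J"
  have "path j (restrict e J) x w 0 = path j e x w 0" using a by (intro path_restrict) auto
  moreover have "(\<lambda>i\<in>{1..s}. restrict e J (int i)) = (\<lambda>i\<in>{1..s}. e (int i))"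
    using a by (intro restrict_ext) (auto simp: subset_iff)
  ultimately show ?thesis unfolding trigger_def by simp
qed

lemma future_indep:
  assumes "r \<le> j"
  shows "indep_rv M (borel \<Otimes>\<^sub>M borel) (\<lambda>\<omega>. (Y r \<omega>, Y j \<omega>)) (PiM {j<..} (\<lambda>_. borel)) (vec_of {j<..} \<epsilon>)"
proof -
  have "(\<lambda>y. (y r, y j)) \<in> measurable (PiM {..j} (\<lambda>_. borel)) (borel \<Otimes>\<^sub>M borel)"
    using assms by (intro measurable_Pair measurable_component_singleton) auto
  from indep_rv_compose[OF M indep_rv_sym[OF M innovations] this measurable_ident]
  show ?thesis using assms by (simp add: vec_of_def[abs_def])
qed

text \<open>Independence of \<open>Y\<close> up to time \<open>k\<close> from later innovations
  would not be enough, as \<open>X 0\<close> also contains the innovations \<open>1..s\<close>.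
  Hence everything is written through \<open>Y 0\<close> and the innovations up to \<open>k\<close>,
  which are jointly independent of the next one by \<open>indep_rv_assoc\<close>;
  \<open>s \<le> k\<close> ensures that these determine \<open>X 0\<close>.\<close>

lemma forward_indep:
  assumes "int s \<le> k"
  shows "indep_rv M (borel \<Otimes>\<^sub>M borel) (\<lambda>\<omega>. (proj {0..k} (\<lambda>i. Y i \<omega>), X 0 \<omega>)) borel (\<epsilon> (k + 1))"
proof -
  let ?J = "{0<..k}"
  have "(\<lambda>y. y 0) \<in> measurable (PiM {..0::int} (\<lambda>_. borel)) (borel :: real measure)"
    by (rule measurable_component_singleton) simp
  moreover have "(\<lambda>e. (restrict e ?J, e (k + 1))) \<in> measurable (PiM {0<..} (\<lambda>_. borel)) (PiM ?J (\<lambda>_. borel) \<Otimes>\<^sub>M borel)"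
    using assms by (intro measurable_Pair measurable_component_singleton measurable_restrict_subset) auto
  ultimately have "indep_rv M borel (\<lambda>\<omega>. vec_of {..0} Y \<omega> 0) (PiM ?J (\<lambda>_. borel) \<Otimes>\<^sub>M borel)
      (\<lambda>\<omega>. (restrict (vec_of {0<..} \<epsilon> \<omega>) ?J, vec_of {0<..} \<epsilon> \<omega> (k + 1)))"
    by (rule indep_rv_compose[OF M indep_rv_sym[OF M innovations]])
  moreover have "restrict (vec_of {0<..} \<epsilon> \<omega>) ?J = vec_of ?J \<epsilon> \<omega>" for \<omega>
    by (auto simp: vec_of_def fun_eq_iff)
  ultimately have 1: "indep_rv M borel (Y 0) (PiM ?J (\<lambda>_. borel) \<Otimes>\<^sub>M borel) (\<lambda>\<omega>. (vec_of ?J \<epsilon> \<omega>, \<epsilon> (k + 1) \<omega>))"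
    using assms by (simp add: vec_of_def)
  have "indep_vars (\<lambda>_. borel) \<epsilon> UNIV" using iid by (simp add: iid_def)
  from indep_var_restrict[OF this, of ?J "{k+1}"]
  have "indep_rv M (PiM ?J (\<lambda>_. borel)) (\<lambda>\<omega>. \<lambda>i\<in>?J. \<epsilon> i \<omega>) (PiM {k+1} (\<lambda>_. borel)) (\<lambda>\<omega>. \<lambda>i\<in>{k+1}. \<epsilon> i \<omega>)"
    by (intro indep_var_imp_indep_rv[OF M]) auto
  from indep_rv_compose[OF M this measurable_ident measurable_component_singleton[of "k+1"]]
  have 2: "indep_rv M (PiM ?J (\<lambda>_. borel)) (vec_of ?J \<epsilon>) borel (\<epsilon> (k+1))" by (simp add: vec_of_def[abs_def])
  have m: "(\<lambda>z. (proj {0..k} (path 0 (snd z) 1 (fst z)), trigger 0 (snd z) 1 (fst z)))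
      \<in> measurable (borel \<Otimes>\<^sub>M PiM ?J (\<lambda>_. borel)) (borel \<Otimes>\<^sub>M borel)"
    using assms by (intro measurable_Pair measurable_proj path_measurable trigger_measurable) auto
  have 3: "indep_rv M (borel \<Otimes>\<^sub>M borel) (\<lambda>\<omega>. (proj {0..k} (path 0 (vec_of ?J \<epsilon> \<omega>) 1 (Y 0 \<omega>)), trigger 0 (vec_of ?J \<epsilon> \<omega>) 1 (Y 0 \<omega>)))
      borel (\<epsilon> (k + 1))"
    using indep_rv_compose[OF M indep_rv_assoc[OF M 1 2] m measurable_ident] by simp
  have "AE \<omega> in M. (proj {0..k} (\<lambda>i. Y i \<omega>), X 0 \<omega>) =
      (proj {0..k} (path 0 (vec_of ?J \<epsilon> \<omega>) 1 (Y 0 \<omega>)), trigger 0 (vec_of ?J \<epsilon> \<omega>) 1 (Y 0 \<omega>))"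
    using path_eq[OF one_neq_zero, of 0] trigger_eq[OF one_neq_zero order_refl]
  proof eventually_elim
    case (elim \<omega>)
    have "path 0 (vec_of ?J \<epsilon> \<omega>) 1 (Y 0 \<omega>) i = Y i \<omega>" if "i \<in> {0..k}" for i
      using elim(1) path_restrict[of 0 i ?J "\<lambda>t. \<epsilon> t \<omega>" 1 "Y 0 \<omega>"] that by (auto simp: vec_of_def subset_iff)
    moreover have "trigger 0 (vec_of ?J \<epsilon> \<omega>) 1 (Y 0 \<omega>) = X 0 \<omega>"
      using elim(2) trigger_restrict[of 0 ?J "\<lambda>t. \<epsilon> t \<omega>" 1 "Y 0 \<omega>"] assms by (auto simp: vec_of_def subset_iff)
    ultimately show ?case by (auto simp: proj_def)
  qed
  then show ?thesis by (intro indep_rv_AE[OF M 3]) (auto intro!: measurable_Pair measurable_proj)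
qed

end

text \<open>Ramp functions that vanish for small \<open>\<sigma> * v i\<close> have conditional
  means dominated by the relative tail, which tends to 0. This serves the degenerate cases
  \<open>p = 0\<close> and \<open>p = 1\<close>, in which the law of \<open>A\<close> or of
  \<open>B\<close> is arbitrary.\<close>

lemma limit_coordinate_nonpos:
  fixes \<sigma> :: real
  assumes M: "prob_space M" and N: "prob_space N"
    and XY[measurable]: "X 0 \<in> borel_measurable M" "\<And>t. Y t \<in> borel_measurable M" and Z[measurable]: "\<And>t. Z t \<in> borel_measurable N"
    and pos: "\<And>x. \<P>(\<omega> in M. \<bar>X 0 \<omega>\<bar> > x) > 0"
    and sl: "seq_limit M X Y I N Z" and i: "i \<in> I"
    and tail: "\<And>u. u > 0 \<Longrightarrow> ((\<lambda>x. \<P>(\<omega> in M. \<sigma> * Y i \<omega> > u * x) / \<P>(\<omega> in M. \<bar>X 0 \<omega>\<bar> > x)) \<longlongrightarrow> 0) at_top"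
  shows "AE \<omega> in N. \<sigma> * Z i \<omega> \<le> 0"
proof -
  interpret prob_space M by fact
  interpret N: prob_space N by fact
  have "AE \<omega> in N. \<sigma> * Z i \<omega> \<le> 1 / real (Suc n)" for n
  proof -
    \<comment> \<open>A continuous ramp in \<open>\<sigma> * v i\<close>, rising from 0 at
      \<open>1 / Suc n\<close> to 1 at \<open>2 / Suc n\<close>.\<close>
    define f where "f v = min 1 (max 0 (\<sigma> * v i * real (Suc n) - 1))" for v :: "int \<Rightarrow> real"
    have cf: "continuous_on UNIV f"
      unfolding f_def by (intro continuous_intros continuous_on_product_coordinates)
    have [measurable]: "f \<in> borel_measurable borel" by (rule borel_measurable_continuous_onI[OF cf])
    have f01: "0 \<le> f v" "f v \<le> 1" for v by (auto simp: f_def)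
    have r: "filterlim real at_top sequentially" by (rule filterlim_real_sequentially)
    have lim: "(\<lambda>n. cond_mean M (X 0) (real n) (\<lambda>\<omega>. f (proj I (\<lambda>i. Y i \<omega> / real n)))) \<longlonglongrightarrow> (\<integral>\<omega>. f (proj I (\<lambda>i. Z i \<omega>)) \<partial>N)"
      by (rule seq_limit_ext[OF M N XY Z pos sl cconv_const[OF cf] _ _ r, where B=1]) (use f01 in auto)
    have t0: "(\<lambda>k. \<P>(\<omega> in M. \<sigma> * Y i \<omega> > (1 / real (Suc n)) * real k) / \<P>(\<omega> in M. \<bar>X 0 \<omega>\<bar> > real k)) \<longlonglongrightarrow> 0"
      using filterlim_compose[OF tail[of "1 / real (Suc n)"] r] by simp
    have "(\<integral>\<omega>. f (proj I (\<lambda>i. Z i \<omega>)) \<partial>N) \<le> 0"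
    proof (rule LIMSEQ_le[OF lim t0], intro exI[of _ 1] allI impI)
      fix k :: nat assume k: "1 \<le> k"
      have "(\<integral>\<omega>. f (proj I (\<lambda>i. Y i \<omega> / real k)) * indicator {\<omega>. \<bar>X 0 \<omega>\<bar> > real k} \<omega> \<partial>M)
         \<le> (\<integral>\<omega>. indicator {\<omega>\<in>space M. \<sigma> * Y i \<omega> > (1 / real (Suc n)) * real k} \<omega> \<partial>M)"
      proof (rule integral_mono')
        show "integrable M (\<lambda>\<omega>. indicator {\<omega>\<in>space M. \<sigma> * Y i \<omega> > (1 / real (Suc n)) * real k} \<omega> :: real)"
          by (rule integrable_real_indicator) (auto simp: emeasure_eq_measure)
        fix \<omega> assume w: "\<omega> \<in> space M"
        show "f (proj I (\<lambda>i. Y i \<omega> / real k)) * indicator {\<omega>. \<bar>X 0 \<omega>\<bar> > real k} \<omega> \<le>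
           indicator {\<omega>\<in>space M. \<sigma> * Y i \<omega> > (1 / real (Suc n)) * real k} \<omega>"
        proof (cases "\<sigma> * Y i \<omega> > (1 / real (Suc n)) * real k")
          case True
          then show ?thesis using w f01 by (auto simp: indicator_def)
        next
          case False
          then have "\<sigma> * (Y i \<omega> / real k) * real (Suc n) - 1 \<le> 0" using k by (simp add: field_simps)
          then have "f (proj I (\<lambda>i. Y i \<omega> / real k)) = 0" using i by (simp add: f_def proj_def)
          then show ?thesis by simp
        qed
      qed (simp add: f01)
      then show "cond_mean M (X 0) (real k) (\<lambda>\<omega>. f (proj I (\<lambda>i. Y i \<omega> / real k))) \<le>
         \<P>(\<omega> in M. \<sigma> * Y i \<omega> > (1 / real (Suc n)) * real k) / \<P>(\<omega> in M. \<bar>X 0 \<omega>\<bar> > real k)"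
        unfolding cond_mean_def using pos[of "real k"] by (intro divide_right_mono) auto
    qed
    moreover have [measurable]: "(\<lambda>\<omega>. proj I (\<lambda>i. Z i \<omega>)) \<in> borel_measurable N" by (rule measurable_proj) simp
    have int: "integrable N (\<lambda>\<omega>. f (proj I (\<lambda>i. Z i \<omega>)))"
      by (rule N.integrable_const_bound[of _ 1]) (use f01 in auto)
    ultimately have "(\<integral>\<omega>. f (proj I (\<lambda>i. Z i \<omega>)) \<partial>N) = 0"
      using f01 by (simp add: antisym)
    then have "AE \<omega> in N. f (proj I (\<lambda>i. Z i \<omega>)) = 0"
      using int f01 by (subst (asm) integral_nonneg_eq_0_iff_AE) auto
    then show ?thesis
    proof eventually_elim
      case (elim \<omega>)
      then have "\<sigma> * Z i \<omega> * real (Suc n) - 1 \<le> 0" using i by (auto simp: f_def proj_def min_def max_def split: if_splits)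
      then show ?case by (simp add: field_simps)
    qed
  qed
  then have "AE \<omega> in N. \<forall>n. \<sigma> * Z i \<omega> \<le> 1 / real (Suc n)" by (simp add: AE_all_countable)
  then show ?thesis
  proof eventually_elim
    case (elim \<omega>)
    have "(\<lambda>n. 1 / real (Suc n)) \<longlonglongrightarrow> 0"
      using LIMSEQ_inverse_real_of_nat by (simp add: inverse_eq_divide)
    then show ?case by (rule LIMSEQ_le_const) (use elim in auto)
  qed
qed

section \<open>Independence in the limit process\<close>

abbreviation (input) pairs :: "(int \<Rightarrow> 'b \<Rightarrow> real) \<Rightarrow> (int \<Rightarrow> 'b \<Rightarrow> real) \<Rightarrow> int \<Rightarrow> 'b \<Rightarrow> real \<times> real" where
  "pairs A B \<equiv> (\<lambda>t \<omega>. (A t \<omega>, B t \<omega>))"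

text \<open>The invariant of the recursions of the limit process: the coordinates built so far are
  independent of all pairs not yet consumed. It is used for \<open>I\<close> containing 0, so that
  no pair with index 0 occurs.\<close>

definition indep_outside ::
    "'b measure \<Rightarrow> (int \<Rightarrow> 'b \<Rightarrow> real) \<Rightarrow> (int \<Rightarrow> 'b \<Rightarrow> real) \<Rightarrow> (int \<Rightarrow> 'b \<Rightarrow> real) \<Rightarrow> int set \<Rightarrow> bool" where
  "indep_outside N Z A B I \<longleftrightarrow> indep_rv N borel (\<lambda>\<omega>. proj I (\<lambda>i. Z i \<omega>))
     (PiM (- I) (\<lambda>_. borel \<Otimes>\<^sub>M borel)) (vec_of (- I) (pairs A B))"

lemma indep_outside_coordinate:
  assumes "prob_space N" "indep_outside N Z A B I" "t \<notin> I"
  shows "indep_rv N borel (\<lambda>\<omega>. proj I (\<lambda>i. Z i \<omega>)) (borel \<Otimes>\<^sub>M borel) (\<lambda>\<omega>. (A t \<omega>, B t \<omega>))"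
  using indep_rv_compose[OF assms(1) assms(2)[unfolded indep_outside_def] measurable_ident
      measurable_component_singleton[of t "- I"]] assms(3) by (simp add: vec_of_def)

lemma tail_step_measurable:
  assumes [measurable]: "f \<in> borel_measurable S" "a \<in> borel_measurable S" "b \<in> borel_measurable S"
  shows "(\<lambda>z. tail_step (f z) (a z) (b z)) \<in> borel_measurable S"
  unfolding tail_step_def by measurable

lemma measurable_coordinate: "(\<lambda>v. v i) \<in> borel_measurable (borel :: (int \<Rightarrow> real) measure)"
  by (rule measurable_product_then_coordinatewise) simp

lemma indep_outside_insert:
  assumes N: "prob_space N" and Z[measurable]: "\<And>t. Z t \<in> borel_measurable N"
    and AB: "prob_space.indep_vars N (\<lambda>_. borel \<Otimes>\<^sub>M borel) (pairs A B) (- {0})"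
    and Q: "indep_outside N Z A B I" and I: "0 \<in> I" "t \<notin> I" "t' \<in> I"
    and rec: "AE \<omega> in N. Z t \<omega> = tail_step (Z t' \<omega>) (A t \<omega>) (B t \<omega>)"
  shows "indep_outside N Z A B (insert t I)"
proof -
  interpret N: prob_space N by fact
  let ?J = "- insert t I" and ?B = "borel \<Otimes>\<^sub>M borel :: (real \<times> real) measure"
  have "(\<lambda>e. (e t, restrict e ?J)) \<in> measurable (PiM (- I) (\<lambda>_. ?B)) (?B \<Otimes>\<^sub>M PiM ?J (\<lambda>_. ?B))"
    using I by (intro measurable_Pair measurable_component_singleton measurable_restrict_subset) auto
  from indep_rv_compose[OF N Q[unfolded indep_outside_def] measurable_ident this]
  have "indep_rv N borel (\<lambda>\<omega>. proj I (\<lambda>i. Z i \<omega>)) (?B \<Otimes>\<^sub>M PiM ?J (\<lambda>_. ?B))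
      (\<lambda>\<omega>. (vec_of (- I) (pairs A B) \<omega> t, restrict (vec_of (- I) (pairs A B) \<omega>) ?J))" by simp
  moreover have "restrict (vec_of (- I) (pairs A B) \<omega>) ?J = vec_of ?J (pairs A B) \<omega>" for \<omega>
    by (auto simp: vec_of_def fun_eq_iff)
  moreover have "vec_of (- I) (pairs A B) \<omega> t = (A t \<omega>, B t \<omega>)" for \<omega> using I by (simp add: vec_of_def)
  ultimately have 1: "indep_rv N borel (\<lambda>\<omega>. proj I (\<lambda>i. Z i \<omega>)) (?B \<Otimes>\<^sub>M PiM ?J (\<lambda>_. ?B))
      (\<lambda>\<omega>. ((A t \<omega>, B t \<omega>), vec_of ?J (pairs A B) \<omega>))" by simp
  have "indep_rv N (PiM {t} (\<lambda>_. ?B)) (\<lambda>\<omega>. \<lambda>i\<in>{t}. (A i \<omega>, B i \<omega>)) (PiM ?J (\<lambda>_. ?B)) (\<lambda>\<omega>. \<lambda>i\<in>?J. (A i \<omega>, B i \<omega>))"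
    using I by (intro indep_var_imp_indep_rv[OF N] N.indep_var_restrict[OF AB]) auto
  from indep_rv_compose[OF N this measurable_component_singleton[of t] measurable_ident]
  have 2: "indep_rv N ?B (\<lambda>\<omega>. (A t \<omega>, B t \<omega>)) (PiM ?J (\<lambda>_. ?B)) (vec_of ?J (pairs A B))"
    by (simp add: vec_of_def[abs_def])
  have ABm[measurable]: "A t \<in> borel_measurable N" "B t \<in> borel_measurable N"
  proof -
    have "(\<lambda>\<omega>. (A t \<omega>, B t \<omega>)) \<in> measurable N ?B" using 2 by (simp add: indep_rv_def)
    from measurable_compose[OF this measurable_fst] measurable_compose[OF this measurable_snd]
    show "A t \<in> borel_measurable N" "B t \<in> borel_measurable N" by simp_all
  qed
  have "(\<lambda>z. (fst z)(t := tail_step (fst z t') (fst (snd z)) (snd (snd z)))) \<in> borel_measurable (borel \<Otimes>\<^sub>M ?B)"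
    by (rule measurable_fun_upd_borel[OF measurable_fst tail_step_measurable[OF measurable_compose[OF measurable_fst measurable_coordinate]]])
      measurable
  from indep_rv_compose[OF N indep_rv_assoc[OF N 1 2] this measurable_ident]
  have 3: "indep_rv N borel (\<lambda>\<omega>. (proj I (\<lambda>i. Z i \<omega>))(t := tail_step (Z t' \<omega>) (A t \<omega>) (B t \<omega>)))
     (PiM ?J (\<lambda>_. ?B)) (vec_of ?J (pairs A B))"
    using I by (simp add: proj_def)
  show ?thesis unfolding indep_outside_def
  proof (rule indep_rv_AE[OF N 3])
    show "(\<lambda>\<omega>. proj (insert t I) (\<lambda>i. Z i \<omega>)) \<in> borel_measurable N" by (rule measurable_proj) simp
    show "vec_of ?J (pairs A B) \<in> measurable N (PiM ?J (\<lambda>_. ?B))" using 3 by (simp add: indep_rv_def)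
    show "AE \<omega> in N. proj (insert t I) (\<lambda>i. Z i \<omega>) = (proj I (\<lambda>i. Z i \<omega>))(t := tail_step (Z t' \<omega>) (A t \<omega>) (B t \<omega>))"
      using rec by eventually_elim (simp add: proj_insert)
  qed simp
qed

text \<open>The pairs at \<open>1..s\<close> are consumed by neither recursion; they are discarded
  at the start, where \<open>- {0}\<close> shrinks to the complement of
  \<open>{0..s}\<close>.\<close>

lemma indep_outside_interval:
  assumes N: "prob_space N" and Z[measurable]: "\<And>t. Z t \<in> borel_measurable N"
    and AB: "prob_space.indep_vars N (\<lambda>_. borel \<Otimes>\<^sub>M borel) (pairs A B) (- {0})"
    and ABZ: "indep_rv N
          (PiM (- {0}) (\<lambda>_. borel \<Otimes>\<^sub>M borel)) (vec_of (- {0}) (pairs A B))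
          (PiM {0..int s} (\<lambda>_. borel)) (vec_of {0..int s} Z)"
    and fw: "\<And>t. t > int s \<Longrightarrow> AE \<omega> in N. Z t \<omega> = tail_step (Z (t - 1) \<omega>) (A t \<omega>) (B t \<omega>)"
    and bw: "\<And>t. t > 0 \<Longrightarrow> AE \<omega> in N. Z (- t) \<omega> = tail_step (Z (- t + 1) \<omega>) (A (- t) \<omega>) (B (- t) \<omega>)"
  shows "indep_outside N Z A B {- int m..int s + int n}"
proof -
  have 0: "indep_outside N Z A B {0..int s}"
  proof -
    have "(\<lambda>e. restrict e (- {0..int s})) \<in> measurable (PiM (- {0}) (\<lambda>_. borel \<Otimes>\<^sub>M borel)) (PiM (- {0..int s}) (\<lambda>_. borel \<Otimes>\<^sub>M borel))"
      by (rule measurable_restrict_subset) auto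
    moreover have "(\<lambda>v. proj {0..int s} v) \<in> borel_measurable (PiM {0..int s} (\<lambda>_. borel))"
      by (rule measurable_proj) (rule measurable_component_singleton)
    ultimately have "indep_rv N borel (\<lambda>\<omega>. proj {0..int s} (vec_of {0..int s} Z \<omega>))
        (PiM (- {0..int s}) (\<lambda>_. borel \<Otimes>\<^sub>M borel)) (\<lambda>\<omega>. restrict (vec_of (- {0}) (pairs A B) \<omega>) (- {0..int s}))"
      by (intro indep_rv_compose[OF N indep_rv_sym[OF N ABZ]])
    moreover have "restrict (vec_of (- {0}) (pairs A B) \<omega>) (- {0..int s}) = vec_of (- {0..int s}) (pairs A B) \<omega>" for \<omega>
      by (auto simp: vec_of_def fun_eq_iff)
    moreover have "proj {0..int s} (vec_of {0..int s} Z \<omega>) = proj {0..int s} (\<lambda>i. Z i \<omega>)" for \<omega>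
      by (auto simp: vec_of_def proj_def)
    ultimately show ?thesis unfolding indep_outside_def by simp
  qed
  have 1: "indep_outside N Z A B {0..int s + int n}" for n
  proof (induction n)
    case (Suc n)
    have e: "{0..int s + int (Suc n)} = insert (int s + int n + 1) {0..int s + int n}" by auto
    show ?case unfolding e
      by (rule indep_outside_insert[OF N Z AB Suc, where t'="int s + int n"])
        (use fw[of "int s + int n + 1"] in auto)
  qed (use 0 in simp)
  show ?thesis
  proof (induction m)
    case (Suc m)
    have e: "{- int (Suc m)..int s + int n} = insert (- int m - 1) {- int m..int s + int n}" by auto
    show ?case unfolding e
      by (rule indep_outside_insert[OF N Z AB Suc, where t'="- int m"])
        (use bw[of "int m + 1"] in auto)
  qed (use 1 in simp)
qed

section \<open>The forward step\<close>

text \<open>Integrability is not presupposed: otherwise the integral is 0 by convention, and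
  \<open>D\<close> is nonnegative.\<close>

lemma abs_integral_le:
  fixes f :: "'a \<Rightarrow> real"
  assumes "prob_space M" "\<And>\<omega>. \<bar>f \<omega>\<bar> \<le> D"
  shows "\<bar>\<integral>\<omega>. f \<omega> \<partial>M\<bar> \<le> D"
proof (cases "integrable M f")
  case True
  interpret prob_space M by fact
  have "\<bar>\<integral>\<omega>. f \<omega> \<partial>M\<bar> \<le> (\<integral>\<omega>. \<bar>f \<omega>\<bar> \<partial>M)" by (rule integral_abs_bound)
  also have "\<dots> \<le> (\<integral>\<omega>. D \<partial>M)"
    using True assms(2) by (intro integral_mono integrable_abs) auto
  finally have "\<bar>\<integral>\<omega>. f \<omega> \<partial>M\<bar> \<le> (\<integral>\<omega>. D \<partial>M)" .
  then show ?thesis by (simp add: prob_space)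
next
  case False
  then show ?thesis using assms(2)[of undefined] by (simp add: not_integrable_integral_eq)
qed

lemma cconv_coordinate: "cconv (\<lambda>x v. v i) (\<lambda>v. v i :: 'b::topological_space)"
  unfolding cconv_def tendsto_fun_iff by blast

lemma cconv_fun_upd:
  fixes F :: "real \<Rightarrow> 'a::topological_space \<Rightarrow> int \<Rightarrow> real"
  assumes "cconv F F0" "cconv g g0"
  shows "cconv (\<lambda>x v. (F x v)(t := g x v)) (\<lambda>v. (F0 v)(t := g0 v))"
proof (rule cconv_fun)
  show "cconv (\<lambda>x v. ((F x v)(t := g x v)) i) (\<lambda>v. ((F0 v)(t := g0 v)) i)" for i
    using assms cconv_compose[OF cconv_coordinate[of i] assms(1)] by (cases "i = t") auto
qed

text \<open>By \<open>forward_indep\<close>, the innovation at \<open>k + 1\<close> can be averaged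
  out under the condition on \<open>X 0\<close>. This leaves a test function \<open>F x\<close> of
  the shorter vector that converges continuously. The sign of \<open>Z k\<close> decides whether
  \<open>a\<close> or \<open>b\<close> is used in the limit; \<open>hA\<close> and \<open>hB\<close>
  fix the law of the multiplier or declare that sign impossible.\<close>

lemma (in innovation_series) forward_step:
  assumes N: "prob_space N" and Z[measurable]: "\<And>t. Z t \<in> borel_measurable N"
    and pos: "\<And>x. \<P>(\<omega> in M. \<bar>X 0 \<omega>\<bar> > x) > 0"
    and sl: "seq_limit M X Y {0..k} N Z" and k: "int s \<le> k"
    and ind: "indep_rv N borel (\<lambda>\<omega>. proj {0..k} (\<lambda>i. Z i \<omega>)) (borel \<Otimes>\<^sub>M borel) (\<lambda>\<omega>. (a \<omega>, b \<omega>))"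
    and rec: "AE \<omega> in N. Z (k + 1) \<omega> = tail_step (Z k \<omega>) (a \<omega>) (b \<omega>)"
    and hA: "(AE \<omega> in N. Z k \<omega> \<le> 0) \<or> (\<forall>(g :: real \<Rightarrow> real) B. g \<in> borel_measurable borel \<longrightarrow> (\<forall>y. \<bar>g y\<bar> \<le> B) \<longrightarrow>
        (\<integral>\<omega>. g (a \<omega>) \<partial>N) = (\<integral>\<omega>. g (\<phi> (\<epsilon> (k + 1) \<omega>) 1) \<partial>M))"
    and hB: "(AE \<omega> in N. Z k \<omega> \<ge> 0) \<or> (\<forall>(g :: real \<Rightarrow> real) B. g \<in> borel_measurable borel \<longrightarrow> (\<forall>y. \<bar>g y\<bar> \<le> B) \<longrightarrow>
        (\<integral>\<omega>. g (b \<omega>) \<partial>N) = (\<integral>\<omega>. g (\<phi> (\<epsilon> (k + 1) \<omega>) (-1)) \<partial>M))"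
  shows "seq_limit M X Y {0..k+1} N Z"
  unfolding seq_limit_def
proof (intro allI impI)
  fix f :: "(int \<Rightarrow> real) \<Rightarrow> real" and C and r :: "nat \<Rightarrow> real"
  assume f: "C-lipschitz_on UNIV f" "bounded (range f)" and r: "filterlim r at_top sequentially"
  interpret N: prob_space N by fact
  obtain D where D: "\<And>v. \<bar>f v\<bar> \<le> D" using f(2) by (auto simp: bounded_iff)
  have fm: "f \<in> borel_measurable borel" by (rule lipschitz_borel[OF f(1)])
  have fc: "continuous_on UNIV f" by (rule lipschitz_on_continuous_on[OF f(1)])
  have ins: "{0..k+1} = insert (k+1) {0..k}" using k by auto
  have k0: "k \<in> {0..k}" using k by auto
  have abm[measurable]: "a \<in> borel_measurable N" "b \<in> borel_measurable N"
  proof -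
    have "(\<lambda>\<omega>. (a \<omega>, b \<omega>)) \<in> measurable N (borel \<Otimes>\<^sub>M borel)" using ind by (simp add: indep_rv_def)
    from measurable_compose[OF this measurable_fst] measurable_compose[OF this measurable_snd]
    show "a \<in> borel_measurable N" "b \<in> borel_measurable N" by simp_all
  qed
  define F where "F x v = (\<integral>\<omega>. f (v(k+1 := \<Phi> (x * v k) (\<epsilon> (k+1) \<omega>) / x)) \<partial>M)" for x and v :: "int \<Rightarrow> real"
  define F0 where "F0 v = (\<integral>\<omega>. f (v(k+1 := v k * \<phi> (\<epsilon> (k+1) \<omega>) (sign_ge (v k)))) \<partial>M)" for v :: "int \<Rightarrow> real"
  have cc: "cconv F F0" unfolding F_def F0_def
  proof (rule cconv_integral[OF M])
    show "cconv (\<lambda>x v. f (v(k + 1 := \<Phi> (x * v k) (\<epsilon> (k + 1) \<omega>) / x)))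
         (\<lambda>v. f (v(k + 1 := v k * \<phi> (\<epsilon> (k + 1) \<omega>) (sign_ge (v k)))))" for \<omega>
      by (rule cconv_compose[OF cconv_const[OF fc]], rule cconv_fun_upd)
        (auto simp: cconv_def intro: cconvD[OF cconv_compose[OF \<Phi>_cconv cconv_coordinate]])
    show "(\<lambda>\<omega>. f (v(k + 1 := \<Phi> (x * v k) (\<epsilon> (k + 1) \<omega>) / x))) \<in> borel_measurable M" for x v
      by (intro measurable_compose[OF _ fm] measurable_fun_upd_borel borel_measurable_divide \<Phi>_comp) auto
  qed (rule D)
  have FB: "\<bar>F x v\<bar> \<le> D" for x v unfolding F_def by (rule abs_integral_le[OF M D])
  have Fm: "F x \<in> borel_measurable borel" for x unfolding F_def
  proof (rule borel_measurable_lebesgue_integral)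
    have "(\<lambda>z. f ((fst z)(k + 1 := \<Phi> (x * fst z k) (\<epsilon> (k + 1) (snd z)) / x))) \<in> borel_measurable (borel \<Otimes>\<^sub>M M)"
      by (intro measurable_compose[OF _ fm] measurable_fun_upd_borel borel_measurable_divide \<Phi>_comp borel_measurable_times
          measurable_compose[OF measurable_fst measurable_coordinate] measurable_compose[OF measurable_snd eps_measurable]) auto
    then show "(\<lambda>(v, \<omega>). f (v(k + 1 := \<Phi> (x * v k) (\<epsilon> (k + 1) \<omega>) / x))) \<in> borel_measurable (borel \<Otimes>\<^sub>M M)"
      by (simp add: case_prod_beta')
  qed
  have step: "cond_mean M (X 0) x (\<lambda>\<omega>. f (proj {0..k+1} (\<lambda>i. Y i \<omega> / x))) = cond_mean M (X 0) x (\<lambda>\<omega>. F x (proj {0..k} (\<lambda>i. Y i \<omega> / x)))"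
    if x: "x \<noteq> 0" for x
  proof -
    define h where "h z = f ((\<lambda>i. fst (fst z) i / x)(k+1 := \<Phi> (fst (fst z) k) (snd z) / x)) * indicator {y. \<bar>y\<bar> > x} (snd (fst z))"
      for z :: "((int \<Rightarrow> real) \<times> real) \<times> 's"
    have hm: "h \<in> borel_measurable ((borel \<Otimes>\<^sub>M borel) \<Otimes>\<^sub>M borel)"
    proof -
      have c: "(\<lambda>z. fst (fst z) i) \<in> borel_measurable (((borel::(int\<Rightarrow>real) measure) \<Otimes>\<^sub>M (borel::real measure)) \<Otimes>\<^sub>M (borel::'s measure))" for i
        by (rule measurable_compose[OF measurable_fst measurable_compose[OF measurable_fst measurable_coordinate]])
      show ?thesis unfolding h_def
        by (intro borel_measurable_times measurable_compose[OF _ fm] measurable_fun_upd_borel borel_measurable_divide \<Phi>_comp c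
            measurable_coordinatewise_then_product) auto
    qed
    have hbd: "\<bar>h z\<bar> \<le> D" for z
    proof -
      have "0 \<le> D" using D[of undefined] by linarith
      then show ?thesis using D by (auto simp: h_def indicator_def)
    qed
    have Yk: "AE \<omega> in M. Y (k+1) \<omega> = \<Phi> (Y k \<omega>) (\<epsilon> (k+1) \<omega>)" using Yrec[of "k+1"] by simp
    have d: "(\<lambda>i. proj {0..k} (\<lambda>i. Y i \<omega>) i / x) = proj {0..k} (\<lambda>i. Y i \<omega> / x)" for \<omega>
      by (auto simp: proj_def)
    have pk: "proj {0..k} v k = v k" for v using k0 by (simp add: proj_def)
    have "(\<integral>\<omega>. f (proj {0..k+1} (\<lambda>i. Y i \<omega> / x)) * indicator {\<omega>. \<bar>X 0 \<omega>\<bar> > x} \<omega> \<partial>M)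
      = (\<integral>\<omega>. h ((proj {0..k} (\<lambda>i. Y i \<omega>), X 0 \<omega>), \<epsilon> (k+1) \<omega>) \<partial>M)"
    proof (rule integral_cong_AE)
      have "(\<lambda>\<omega>. f (proj {0..k+1} (\<lambda>i. Y i \<omega> / x))) \<in> borel_measurable M"
        by (rule measurable_compose[OF measurable_proj fm]) simp
      then show "(\<lambda>\<omega>. f (proj {0..k+1} (\<lambda>i. Y i \<omega> / x)) * indicator {\<omega>. \<bar>X 0 \<omega>\<bar> > x} \<omega>) \<in> borel_measurable M" by measurable
      show "(\<lambda>\<omega>. h ((proj {0..k} (\<lambda>i. Y i \<omega>), X 0 \<omega>), \<epsilon> (k+1) \<omega>)) \<in> borel_measurable M"
        by (intro measurable_compose[OF _ hm] measurable_Pair measurable_proj) auto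
      show "AE \<omega> in M. f (proj {0..k+1} (\<lambda>i. Y i \<omega> / x)) * indicator {\<omega>. \<bar>X 0 \<omega>\<bar> > x} \<omega> =
          h ((proj {0..k} (\<lambda>i. Y i \<omega>), X 0 \<omega>), \<epsilon> (k+1) \<omega>)"
        using Yk by eventually_elim (simp add: h_def d pk ins proj_insert indicator_def)
    qed
    also have "\<dots> = (\<integral>\<omega>. (\<integral>\<omega>'. h ((proj {0..k} (\<lambda>i. Y i \<omega>), X 0 \<omega>), \<epsilon> (k+1) \<omega>') \<partial>M) \<partial>M)"
      by (rule indep_rv_integral[OF M forward_indep[OF k] hm hbd])
    also have "\<dots> = (\<integral>\<omega>. F x (proj {0..k} (\<lambda>i. Y i \<omega> / x)) * indicator {\<omega>. \<bar>X 0 \<omega>\<bar> > x} \<omega> \<partial>M)"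
      using x by (intro Bochner_Integration.integral_cong refl) (simp add: h_def F_def d pk indicator_def)
    finally show ?thesis by (simp add: cond_mean_def)
  qed
  have lim: "(\<lambda>n. cond_mean M (X 0) (r n) (\<lambda>\<omega>. F (r n) (proj {0..k} (\<lambda>i. Y i \<omega> / r n)))) \<longlonglongrightarrow> (\<integral>\<omega>. F0 (proj {0..k} (\<lambda>i. Z i \<omega>)) \<partial>N)"
    by (rule seq_limit_ext[OF M N Xm Ym Z pos sl cc FB Fm r])
  have "\<forall>\<^sub>F n in sequentially. r n > 0" using r by (simp add: filterlim_at_top_dense)
  then have "\<forall>\<^sub>F n in sequentially. cond_mean M (X 0) (r n) (\<lambda>\<omega>. F (r n) (proj {0..k} (\<lambda>i. Y i \<omega> / r n)))
      = cond_mean M (X 0) (r n) (\<lambda>\<omega>. f (proj {0..k+1} (\<lambda>i. Y i \<omega> / r n)))"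
    by eventually_elim (simp add: step)
  from Lim_transform_eventually[OF lim this]
  have lim': "(\<lambda>n. cond_mean M (X 0) (r n) (\<lambda>\<omega>. f (proj {0..k+1} (\<lambda>i. Y i \<omega> / r n)))) \<longlonglongrightarrow> (\<integral>\<omega>. F0 (proj {0..k} (\<lambda>i. Z i \<omega>)) \<partial>N)" .
  have "(\<integral>\<omega>. F0 (proj {0..k} (\<lambda>i. Z i \<omega>)) \<partial>N) = (\<integral>\<omega>. f (proj {0..k+1} (\<lambda>i. Z i \<omega>)) \<partial>N)"
  proof -
    define h where "h z = f ((fst z)(k+1 := tail_step (fst z k) (fst (snd z)) (snd (snd z))))"
      for z :: "(int \<Rightarrow> real) \<times> (real \<times> real)"
    have hm: "h \<in> borel_measurable (borel \<Otimes>\<^sub>M (borel \<Otimes>\<^sub>M borel))"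
      unfolding h_def
      by (intro measurable_compose[OF _ fm] measurable_fun_upd_borel tail_step_measurable measurable_compose[OF measurable_fst measurable_coordinate]) measurable
    have hbd: "\<bar>h z\<bar> \<le> D" for z using D by (simp add: h_def)
    have pk: "proj {0..k} v k = v k" for v using k0 by (simp add: proj_def)
    have pm: "(\<lambda>\<omega>. proj {0..k} (\<lambda>i. Z i \<omega>)) \<in> borel_measurable N" by (rule measurable_proj) simp
    have "(\<integral>\<omega>. f (proj {0..k+1} (\<lambda>i. Z i \<omega>)) \<partial>N) = (\<integral>\<omega>. h (proj {0..k} (\<lambda>i. Z i \<omega>), (a \<omega>, b \<omega>)) \<partial>N)"
    proof (rule integral_cong_AE)
      show "(\<lambda>\<omega>. f (proj {0..k+1} (\<lambda>i. Z i \<omega>))) \<in> borel_measurable N"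
        by (rule measurable_compose[OF measurable_proj fm]) simp
      show "(\<lambda>\<omega>. h (proj {0..k} (\<lambda>i. Z i \<omega>), (a \<omega>, b \<omega>))) \<in> borel_measurable N"
        by (intro measurable_compose[OF _ hm] measurable_Pair pm abm)
      show "AE \<omega> in N. f (proj {0..k+1} (\<lambda>i. Z i \<omega>)) = h (proj {0..k} (\<lambda>i. Z i \<omega>), (a \<omega>, b \<omega>))"
        using rec by eventually_elim (simp add: h_def pk ins proj_insert)
    qed
    also have "\<dots> = (\<integral>\<omega>. (\<integral>\<omega>'. h (proj {0..k} (\<lambda>i. Z i \<omega>), (a \<omega>', b \<omega>')) \<partial>N) \<partial>N)"
      by (rule indep_rv_integral[OF N ind hm hbd])
    also have "\<dots> = (\<integral>\<omega>. F0 (proj {0..k} (\<lambda>i. Z i \<omega>)) \<partial>N)"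
    proof (rule integral_cong_AE)
      show "(\<lambda>\<omega>. \<integral>\<omega>'. h (proj {0..k} (\<lambda>i. Z i \<omega>), (a \<omega>', b \<omega>')) \<partial>N) \<in> borel_measurable N"
      proof (rule N.borel_measurable_lebesgue_integral)
        have "(\<lambda>z. h (proj {0..k} (\<lambda>i. Z i (fst z)), (a (snd z), b (snd z)))) \<in> borel_measurable (N \<Otimes>\<^sub>M N)"
          by (intro measurable_compose[OF _ hm] measurable_Pair measurable_compose[OF measurable_fst pm]) measurable
        then show "(\<lambda>(\<omega>, \<omega>'). h (proj {0..k} (\<lambda>i. Z i \<omega>), (a \<omega>', b \<omega>'))) \<in> borel_measurable (N \<Otimes>\<^sub>M N)"
          by (simp add: case_prod_beta')
      qed
      show "(\<lambda>\<omega>. F0 (proj {0..k} (\<lambda>i. Z i \<omega>))) \<in> borel_measurable N"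
        by (rule measurable_compose[OF pm cconv_limit_measurable[OF cc Fm]])
      have "AE \<omega> in N. (Z k \<omega> > 0 \<longrightarrow> (\<forall>v. (\<integral>\<omega>'. f (v(k+1 := Z k \<omega> * a \<omega>')) \<partial>N) = (\<integral>\<omega>'. f (v(k+1 := Z k \<omega> * \<phi> (\<epsilon> (k+1) \<omega>') 1)) \<partial>M)))"
        using hA
      proof
        assume "AE \<omega> in N. Z k \<omega> \<le> 0"
        then show ?thesis by eventually_elim auto
      next
        assume A: "\<forall>(g :: real \<Rightarrow> real) B. g \<in> borel_measurable borel \<longrightarrow> (\<forall>y. \<bar>g y\<bar> \<le> B) \<longrightarrow> (\<integral>\<omega>. g (a \<omega>) \<partial>N) = (\<integral>\<omega>. g (\<phi> (\<epsilon> (k + 1) \<omega>) 1) \<partial>M)"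
        have "(\<integral>\<omega>'. f (v(k+1 := w * a \<omega>')) \<partial>N) = (\<integral>\<omega>'. f (v(k+1 := w * \<phi> (\<epsilon> (k+1) \<omega>') 1)) \<partial>M)" for v w
        proof (rule A[rule_format, where g="\<lambda>y. f (v(k+1 := w * y))" and B=D])
          show "(\<lambda>y. f (v(k+1 := w * y))) \<in> borel_measurable borel"
            by (intro measurable_compose[OF _ fm] measurable_fun_upd_borel) auto
        qed (rule D)
        then show ?thesis by simp
      qed
      moreover have "AE \<omega> in N. (Z k \<omega> < 0 \<longrightarrow> (\<forall>v. (\<integral>\<omega>'. f (v(k+1 := Z k \<omega> * b \<omega>')) \<partial>N) = (\<integral>\<omega>'. f (v(k+1 := Z k \<omega> * \<phi> (\<epsilon> (k+1) \<omega>') (-1))) \<partial>M)))"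
        using hB
      proof
        assume "AE \<omega> in N. Z k \<omega> \<ge> 0"
        then show ?thesis by eventually_elim auto
      next
        assume A: "\<forall>(g :: real \<Rightarrow> real) B. g \<in> borel_measurable borel \<longrightarrow> (\<forall>y. \<bar>g y\<bar> \<le> B) \<longrightarrow> (\<integral>\<omega>. g (b \<omega>) \<partial>N) = (\<integral>\<omega>. g (\<phi> (\<epsilon> (k + 1) \<omega>) (-1)) \<partial>M)"
        have "(\<integral>\<omega>'. f (v(k+1 := w * b \<omega>')) \<partial>N) = (\<integral>\<omega>'. f (v(k+1 := w * \<phi> (\<epsilon> (k+1) \<omega>') (-1))) \<partial>M)" for v w
        proof (rule A[rule_format, where g="\<lambda>y. f (v(k+1 := w * y))" and B=D])
          show "(\<lambda>y. f (v(k+1 := w * y))) \<in> borel_measurable borel"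
            by (intro measurable_compose[OF _ fm] measurable_fun_upd_borel) auto
        qed (rule D)
        then show ?thesis by simp
      qed
      ultimately show "AE \<omega> in N. (\<integral>\<omega>'. h (proj {0..k} (\<lambda>i. Z i \<omega>), (a \<omega>', b \<omega>')) \<partial>N) = F0 (proj {0..k} (\<lambda>i. Z i \<omega>))"
      proof eventually_elim
        case (elim \<omega>)
        \<comment> \<open>At 0 the conventions differ, \<open>sign_ge\<close> choosing the positive
          branch and \<open>tail_step\<close> neither; the factor 0 makes both results 0.\<close>
        consider "Z k \<omega> > 0" | "Z k \<omega> < 0" | "Z k \<omega> = 0" by linarith
        then show ?case
          using elim by cases (simp_all add: h_def F0_def pk tail_step_def sign_ge_def N.prob_space prob_space)
      qed
    qed
    finally show ?thesis by simp
  qed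
  then show "(\<lambda>n. cond_mean M (X 0) (r n) (\<lambda>\<omega>. f (proj {0..k+1} (\<lambda>i. Y i \<omega> / r n)))) \<longlonglongrightarrow> (\<integral>\<omega>. f (proj {0..k+1} (\<lambda>i. Z i \<omega>)) \<partial>N)"
    using lim' by simp
qed

section \<open>Limits of integrals over the tail measure\<close>

text \<open>Written with positive and negative parts, the tail step is visibly continuous in
  \<open>y\<close>, also at 0.\<close>

lemma tail_step_eq: "tail_step y a b = a * max y 0 + b * min y 0"
  by (auto simp: tail_step_def indicator_def max_def min_def)

lemma integral_swap_bounded:
  fixes f :: "'a \<Rightarrow> 'b \<Rightarrow> real"
  assumes "prob_space M" "prob_space N" and f: "(\<lambda>(x, y). f x y) \<in> borel_measurable (M \<Otimes>\<^sub>M N)"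
    and B: "\<And>x y. \<bar>f x y\<bar> \<le> B"
  shows "(\<integral>x. (\<integral>y. f x y \<partial>N) \<partial>M) = (\<integral>y. (\<integral>x. f x y \<partial>M) \<partial>N)"
proof -
  interpret M: prob_space M by fact
  interpret N: prob_space N by fact
  interpret P: pair_prob_space M N ..
  have "integrable (M \<Otimes>\<^sub>M N) (\<lambda>(x, y). f x y)"
    by (rule P.integrable_const_bound[of _ B]) (use B f in auto)
  from P.Fubini_integral[OF this] show ?thesis by simp
qed

lemma integral_cong_space:
  "(\<And>\<omega>. \<omega> \<in> space M \<Longrightarrow> f \<omega> = g \<omega>) \<Longrightarrow> (\<integral>\<omega>. f \<omega> \<partial>M) = (\<integral>\<omega>. g \<omega> \<partial>M :: real)"
  by (rule Bochner_Integration.integral_cong) auto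

locale tail_setting = innovation_series M \<epsilon> X Y \<Phi> \<Psi> \<phi> \<psi> s
  for M :: "'a measure" and \<epsilon> :: "int \<Rightarrow> 'a \<Rightarrow> 's :: {metric_space, second_countable_topology}"
    and X Y :: "int \<Rightarrow> 'a \<Rightarrow> real" and \<Phi> \<Psi> \<phi> \<psi> s +
  fixes K :: "'c measure" and M0 M1 Mneg :: "'c \<Rightarrow> real" and \<epsilon>Y :: "'c \<Rightarrow> 's" and \<alpha> p :: real
  assumes Yrv: "regularly_varying_tails M (Y 0) \<alpha> p" and \<alpha>: "\<alpha> > 0" and p: "p \<in> {0..1}"
    and Ydist: "\<And>t. distr M borel (Y t) = distr M borel (Y 0)"
    and K: "prob_space K" and M0: "\<P>(\<omega> in K. M0 \<omega> = 1) = p" "\<P>(\<omega> in K. M0 \<omega> = -1) = 1 - p"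
    and M0_\<epsilon>Y: "indep_rv K borel M0 borel \<epsilon>Y" and \<epsilon>Y: "distr K borel \<epsilon>Y = distr M borel (\<epsilon> 1)"
    and M1[measurable]: "M1 \<in> borel_measurable K" and M1_eq: "AE \<omega> in K. M1 \<omega> = M0 \<omega> * \<phi> (\<epsilon>Y \<omega>) (sign_ge (M0 \<omega>))"
    and Mneg[measurable]: "Mneg \<in> borel_measurable K" and adj: "adjoint_law K \<alpha> M0 M1 Mneg"
begin

lemma M0_measurable[measurable]: "M0 \<in> borel_measurable K" and \<epsilon>Y_measurable[measurable]: "\<epsilon>Y \<in> borel_measurable K"
  using M0_\<epsilon>Y by (auto simp: indep_rv_def)

lemma eps_dist: "distr M borel (\<epsilon> t) = distr M borel (\<epsilon> u)"
  using iid unfolding iid_def by metis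

lemma integral_eps: "(\<integral>\<omega>. g (\<epsilon>Y \<omega>) \<partial>K) = (\<integral>\<omega>. g (\<epsilon> t \<omega>) \<partial>M)"
  if "g \<in> borel_measurable borel" for g :: "'s \<Rightarrow> real"
proof -
  have "(\<integral>\<omega>. g (\<epsilon>Y \<omega>) \<partial>K) = (\<integral>z. g z \<partial>distr K borel \<epsilon>Y)" by (rule integral_distr[symmetric]) (use that in auto)
  also have "\<dots> = (\<integral>z. g z \<partial>distr M borel (\<epsilon> t))" by (simp only: \<epsilon>Y eps_dist[of 1 t])
  also have "\<dots> = (\<integral>\<omega>. g (\<epsilon> t \<omega>) \<partial>M)" by (rule integral_distr) (use that in auto)
  finally show ?thesis .
qed

lemma integral_Y: "(\<integral>\<omega>. g (Y t \<omega>) \<partial>M) = (\<integral>\<omega>. g (Y 0 \<omega>) \<partial>M)"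
  if "g \<in> borel_measurable borel" for g :: "real \<Rightarrow> real"
proof -
  have "(\<integral>\<omega>. g (Y t \<omega>) \<partial>M) = (\<integral>z. g z \<partial>distr M borel (Y t))" by (rule integral_distr[symmetric]) (use that in auto)
  also have "\<dots> = (\<integral>z. g z \<partial>distr M borel (Y 0))" by (simp only: Ydist[of t])
  also have "\<dots> = (\<integral>\<omega>. g (Y 0 \<omega>) \<partial>M)" by (rule integral_distr) (use that in auto)
  finally show ?thesis .
qed

definition q :: "real \<Rightarrow> real" where "q x = \<P>(\<omega> in M. \<bar>Y 0 \<omega>\<bar> > x)"

lemma q_pos: "q x > 0" unfolding q_def by (rule regularly_varying_tails_pos[OF M Ym Yrv])

lemma tail_limit_Y:
  fixes H :: "real \<Rightarrow> real \<Rightarrow> real"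
  assumes cc: "cconv H H0" and B: "\<And>x w. \<bar>H x w\<bar> \<le> B" and H: "\<And>x. H x \<in> borel_measurable borel"
    and eta: "\<eta> > 0" and zero: "\<And>x w. \<bar>w\<bar> \<le> \<eta> \<Longrightarrow> H x w = 0" and r: "filterlim r at_top sequentially"
  shows "(\<lambda>n. (\<integral>\<omega>. H (r n) (Y j \<omega> / r n) \<partial>M) / q (r n)) \<longlonglongrightarrow> (\<integral>t. (\<integral>\<omega>. H0 (tail_radius \<alpha> t * M0 \<omega>) \<partial>K) \<partial>lborel)"
proof -
  have "(\<integral>\<omega>. H (r n) (Y j \<omega> / r n) \<partial>M) = (\<integral>\<omega>. H (r n) (Y 0 \<omega> / r n) \<partial>M)" for n
    by (rule integral_Y[of "\<lambda>y. H (r n) (y / r n)"]) (rule measurable_compose[OF _ H], measurable)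
  then show ?thesis
    using tail_vague[OF M Ym Yrv \<alpha> eta p cc B H zero r K M0 M0_measurable] by (simp add: q_def)
qed

lemma \<phi>_sign_measurable:
  assumes [measurable]: "f \<in> borel_measurable S" "e \<in> borel_measurable S"
  shows "(\<lambda>z. \<phi> (e z) (sign_ge (f z))) \<in> borel_measurable S"
proof -
  have [measurable]: "(\<lambda>z. \<phi> (e z) 1) \<in> borel_measurable S" "(\<lambda>z. \<phi> (e z) (-1)) \<in> borel_measurable S"
    by (rule measurable_compose[OF _ \<phi>_measurable(1)], measurable, rule measurable_compose[OF _ \<phi>_measurable(2)], measurable)
  have "(\<lambda>z. \<phi> (e z) (sign_ge (f z))) = (\<lambda>z. if f z \<ge> 0 then \<phi> (e z) 1 else \<phi> (e z) (-1))"
    by (auto simp: sign_ge_def)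
  then show ?thesis by simp
qed

text \<open>\<open>Y j\<close> is a function of \<open>Y (j - 1)\<close> and an independent
  innovation. Averaging the innovation out leaves a function of one variable that still vanishes
  near 0, so the one-dimensional limit applies. Afterwards \<open>\<epsilon>Y\<close> takes the
  place of the innovation, and the second coordinate becomes a multiple of
  \<open>M1\<close>.\<close>

lemma forward_tail_limit:
  fixes \<Gamma> :: "real \<Rightarrow> real \<times> real \<Rightarrow> real"
  assumes cc: "cconv \<Gamma> \<Gamma>0" and B: "\<And>x z. \<bar>\<Gamma> x z\<bar> \<le> B" and \<Gamma>: "\<And>x. \<Gamma> x \<in> borel_measurable borel"
    and eta: "\<eta> > 0" and zero: "\<And>x u w. \<bar>u\<bar> \<le> \<eta> \<Longrightarrow> \<Gamma> x (u, w) = 0" and r: "filterlim r at_top sequentially"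
  shows "(\<lambda>n. (\<integral>\<omega>. \<Gamma> (r n) (Y (j - 1) \<omega> / r n, Y j \<omega> / r n) \<partial>M) / q (r n)) \<longlonglongrightarrow>
      (\<integral>t. (\<integral>\<omega>. \<Gamma>0 (tail_radius \<alpha> t * M0 \<omega>, tail_radius \<alpha> t * M1 \<omega>) \<partial>K) \<partial>lborel)"
proof -
  define H where "H x u = (\<integral>\<omega>. \<Gamma> x (u, \<Phi> (x * u) (\<epsilon> j \<omega>) / x) \<partial>M)" for x u
  define H0 where "H0 u = (\<integral>\<omega>. \<Gamma>0 (u, u * \<phi> (\<epsilon> j \<omega>) (sign_ge u)) \<partial>M)" for u
  have \<Gamma>0: "\<Gamma>0 \<in> borel_measurable borel" by (rule cconv_limit_measurable[OF cc \<Gamma>])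
  have \<Gamma>0B: "\<bar>\<Gamma>0 z\<bar> \<le> B" for z by (rule cconv_limit_bounded[OF cc B])
  have idc: "cconv (\<lambda>x u. u) (\<lambda>u. u :: real)" by (simp add: cconv_def)
  have ccH: "cconv H H0" unfolding H_def H0_def
  proof (rule cconv_integral[OF M])
    show "cconv (\<lambda>x u. \<Gamma> x (u, \<Phi> (x * u) (\<epsilon> j \<omega>) / x)) (\<lambda>u. \<Gamma>0 (u, u * \<phi> (\<epsilon> j \<omega>) (sign_ge u)))" for \<omega>
      by (rule cconv_compose[OF cc cconv_Pair[OF idc \<Phi>_cconv]])
    show "(\<lambda>\<omega>. \<Gamma> x (u, \<Phi> (x * u) (\<epsilon> j \<omega>) / x)) \<in> borel_measurable M" for x u
      by (rule measurable_compose[OF borel_measurable_Pair \<Gamma>]) (auto intro!: borel_measurable_divide \<Phi>_comp)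
  qed (rule B)
  have Hm: "H x \<in> borel_measurable borel" for x unfolding H_def
  proof (rule borel_measurable_lebesgue_integral)
    have "(\<lambda>z. \<Gamma> x (fst z, \<Phi> (x * fst z) (\<epsilon> j (snd z)) / x)) \<in> borel_measurable (borel \<Otimes>\<^sub>M M)"
      by (rule measurable_compose[OF borel_measurable_Pair \<Gamma>])
        (auto intro!: borel_measurable_divide \<Phi>_comp measurable_compose[OF measurable_snd eps_measurable])
    then show "(\<lambda>(u, \<omega>). \<Gamma> x (u, \<Phi> (x * u) (\<epsilon> j \<omega>) / x)) \<in> borel_measurable (borel \<Otimes>\<^sub>M M)"
      by (simp add: case_prod_beta')
  qed
  have HB: "\<bar>H x u\<bar> \<le> B" for x u unfolding H_def by (rule abs_integral_le[OF M B])
  have Hz: "H x u = 0" if "\<bar>u\<bar> \<le> \<eta>" for x u unfolding H_def using zero[OF that] by simp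
  have lim: "(\<lambda>n. (\<integral>\<omega>. H (r n) (Y (j - 1) \<omega> / r n) \<partial>M) / q (r n)) \<longlonglongrightarrow> (\<integral>t. (\<integral>\<omega>. H0 (tail_radius \<alpha> t * M0 \<omega>) \<partial>K) \<partial>lborel)"
    by (rule tail_limit_Y[OF ccH HB Hm eta Hz r])
  have ind: "indep_rv M borel (Y (j - 1)) borel (\<epsilon> j)"
  proof -
    have "(\<lambda>y. y (j - 1)) \<in> measurable (PiM {..j - 1} (\<lambda>_. borel)) borel" "(\<lambda>e. e j) \<in> measurable (PiM {j - 1<..} (\<lambda>_. borel)) borel"
      by (rule measurable_component_singleton; simp)+
    from indep_rv_compose[OF M indep_rv_sym[OF M innovations] this] show ?thesis by (simp add: vec_of_def)
  qed
  have e1: "(\<integral>\<omega>. \<Gamma> x (Y (j - 1) \<omega> / x, Y j \<omega> / x) \<partial>M) = (\<integral>\<omega>. H x (Y (j - 1) \<omega> / x) \<partial>M)" if x: "x \<noteq> 0" for x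
  proof -
    define h where "h z = \<Gamma> x (fst z / x, \<Phi> (fst z) (snd z) / x)" for z
    have hm: "h \<in> borel_measurable (borel \<Otimes>\<^sub>M borel)" unfolding h_def
      by (rule measurable_compose[OF borel_measurable_Pair \<Gamma>]) (auto intro!: borel_measurable_divide \<Phi>_comp)
    have "(\<integral>\<omega>. \<Gamma> x (Y (j - 1) \<omega> / x, Y j \<omega> / x) \<partial>M) = (\<integral>\<omega>. h (Y (j - 1) \<omega>, \<epsilon> j \<omega>) \<partial>M)"
    proof (rule integral_cong_AE)
      show "(\<lambda>\<omega>. \<Gamma> x (Y (j - 1) \<omega> / x, Y j \<omega> / x)) \<in> borel_measurable M"
        by (rule measurable_compose[OF borel_measurable_Pair \<Gamma>]) auto
      show "(\<lambda>\<omega>. h (Y (j - 1) \<omega>, \<epsilon> j \<omega>)) \<in> borel_measurable M"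
        by (rule measurable_compose[OF _ hm]) auto
      show "AE \<omega> in M. \<Gamma> x (Y (j - 1) \<omega> / x, Y j \<omega> / x) = h (Y (j - 1) \<omega>, \<epsilon> j \<omega>)"
        using Yrec[of j] by eventually_elim (simp add: h_def)
    qed
    also have "\<dots> = (\<integral>\<omega>. (\<integral>\<omega>'. h (Y (j - 1) \<omega>, \<epsilon> j \<omega>') \<partial>M) \<partial>M)"
      by (rule indep_rv_integral[OF M ind hm]) (use B in \<open>simp add: h_def\<close>)
    also have "\<dots> = (\<integral>\<omega>. H x (Y (j - 1) \<omega> / x) \<partial>M)" using x by (simp add: h_def H_def)
    finally show ?thesis .
  qed
  have ev: "\<forall>\<^sub>F n in sequentially. (\<integral>\<omega>. H (r n) (Y (j - 1) \<omega> / r n) \<partial>M) / q (r n)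
      = (\<integral>\<omega>. \<Gamma> (r n) (Y (j - 1) \<omega> / r n, Y j \<omega> / r n) \<partial>M) / q (r n)"
  proof -
    have "\<forall>\<^sub>F n in sequentially. r n > 0" using r by (simp add: filterlim_at_top_dense)
    then show ?thesis by eventually_elim (simp add: e1)
  qed
  have e2: "(\<integral>\<omega>. H0 (tail_radius \<alpha> t * M0 \<omega>) \<partial>K) = (\<integral>\<omega>. \<Gamma>0 (tail_radius \<alpha> t * M0 \<omega>, tail_radius \<alpha> t * M1 \<omega>) \<partial>K)" for t
  proof -
    define z where "z = tail_radius \<alpha> t"
    have z0: "z \<ge> 0" by (simp add: z_def tail_radius_nonneg)
    \<comment> \<open>A positive radius preserves signs. At radius 0 the values of
      \<open>sign_ge\<close> may differ, but both sides are 0.\<close>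
    have sgn: "z * m * \<phi> e (sign_ge m) = z * m * \<phi> e (sign_ge (z * m))" for m e
      using z0 by (cases "z = 0") (auto simp: sign_ge_def zero_le_mult_iff)
    define h where "h y = \<Gamma>0 (z * fst y, z * fst y * \<phi> (snd y) (sign_ge (fst y)))" for y
    have hm: "h \<in> borel_measurable (borel \<Otimes>\<^sub>M borel)" unfolding h_def
      by (rule measurable_compose[OF borel_measurable_Pair \<Gamma>0]) (auto intro!: borel_measurable_times \<phi>_sign_measurable)
    have "(\<integral>\<omega>. \<Gamma>0 (z * M0 \<omega>, z * M1 \<omega>) \<partial>K) = (\<integral>\<omega>. h (M0 \<omega>, \<epsilon>Y \<omega>) \<partial>K)"
    proof (rule integral_cong_AE)
      show "(\<lambda>\<omega>. \<Gamma>0 (z * M0 \<omega>, z * M1 \<omega>)) \<in> borel_measurable K"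
        by (rule measurable_compose[OF borel_measurable_Pair \<Gamma>0]) auto
      show "(\<lambda>\<omega>. h (M0 \<omega>, \<epsilon>Y \<omega>)) \<in> borel_measurable K" by (rule measurable_compose[OF _ hm]) auto
      show "AE \<omega> in K. \<Gamma>0 (z * M0 \<omega>, z * M1 \<omega>) = h (M0 \<omega>, \<epsilon>Y \<omega>)"
        using M1_eq by eventually_elim (simp add: h_def mult.assoc)
    qed
    also have "\<dots> = (\<integral>\<omega>. (\<integral>\<omega>'. h (M0 \<omega>, \<epsilon>Y \<omega>') \<partial>K) \<partial>K)"
      by (rule indep_rv_integral[OF K M0_\<epsilon>Y hm]) (use \<Gamma>0B in \<open>simp add: h_def\<close>)
    also have "\<dots> = (\<integral>\<omega>. H0 (z * M0 \<omega>) \<partial>K)"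
    proof (rule integral_cong_space)
      fix \<omega>
      have "(\<integral>\<omega>'. h (M0 \<omega>, \<epsilon>Y \<omega>') \<partial>K) = (\<integral>\<omega>'. h (M0 \<omega>, \<epsilon> j \<omega>') \<partial>M)"
        by (rule integral_eps[of "\<lambda>e. h (M0 \<omega>, e)"]) (rule measurable_compose[OF _ hm], simp)
      also have "\<dots> = H0 (z * M0 \<omega>)" by (simp add: h_def H0_def sgn)
      finally show "(\<integral>\<omega>'. h (M0 \<omega>, \<epsilon>Y \<omega>') \<partial>K) = H0 (z * M0 \<omega>)" .
    qed
    finally show ?thesis by (simp add: z_def)
  qed
  show ?thesis using Lim_transform_eventually[OF lim ev] by (simp add: e2)
qed

section \<open>Averaging over the innovations after time \<open>j\<close>\<close>

text \<open>The conditional expectation of \<open>g\<close> at the scaled path times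
  \<open>\<kappa> (X 0 / x)\<close>, given that \<open>(Y (j - 1) / x, Y j / x)\<close> equals
  \<open>z\<close>.\<close>

definition future_exp :: "int \<Rightarrow> ((int \<Rightarrow> real) \<Rightarrow> real) \<Rightarrow> (real \<Rightarrow> real) \<Rightarrow> real \<Rightarrow> real \<times> real \<Rightarrow> real" where
  "future_exp j g \<kappa> x z = (\<integral>\<omega>. g ((path j (\<lambda>t. \<epsilon> t \<omega>) x (snd z))(j - 1 := fst z)) * \<kappa> (trigger j (\<lambda>t. \<epsilon> t \<omega>) x (snd z)) \<partial>M)"

definition future_exp_lim :: "int \<Rightarrow> ((int \<Rightarrow> real) \<Rightarrow> real) \<Rightarrow> (real \<Rightarrow> real) \<Rightarrow> real \<times> real \<Rightarrow> real" where
  "future_exp_lim j g \<kappa> z = (\<integral>\<omega>. g ((path_lim j (\<lambda>t. \<epsilon> t \<omega>) (snd z))(j - 1 := fst z)) * \<kappa> (trigger_lim j (\<lambda>t. \<epsilon> t \<omega>) (snd z)) \<partial>M)"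

lemma future_measurable:
  fixes g :: "(int \<Rightarrow> real) \<Rightarrow> real" and \<kappa> :: "real \<Rightarrow> real"
  assumes j: "j \<le> 0" and g: "g \<in> borel_measurable borel" and \<kappa>: "\<kappa> \<in> borel_measurable borel"
    and u: "u \<in> borel_measurable S" and w: "w \<in> borel_measurable S" and e: "e \<in> measurable S (PiM {j<..} (\<lambda>_. borel))"
  shows "(\<lambda>y. g ((path j (e y) x (w y))(j - 1 := u y)) * \<kappa> (trigger j (e y) x (w y))) \<in> borel_measurable S"
proof -
  have we: "(\<lambda>y. (w y, e y)) \<in> measurable S (borel \<Otimes>\<^sub>M PiM {j<..} (\<lambda>_. borel))" using w e by simp
  have 1: "(\<lambda>y. path j (e y) x (w y)) \<in> borel_measurable S"
  proof (rule measurable_coordinatewise_then_product)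
    show "(\<lambda>y. path j (e y) x (w y) i) \<in> borel_measurable S" for i
      using measurable_compose[OF we path_measurable[of j i "{j<..}" x]] by (auto simp: subset_iff)
  qed
  have 2: "(\<lambda>y. trigger j (e y) x (w y)) \<in> borel_measurable S"
    using measurable_compose[OF we trigger_measurable[OF j, of "{j<..}" x]] by (auto simp: subset_iff)
  show ?thesis
    by (rule borel_measurable_times[OF measurable_compose[OF measurable_fun_upd_borel[OF 1 u] g] measurable_compose[OF 2 \<kappa>]])
qed

lemma vec_measurable: "vec_of {j<..} \<epsilon> \<in> measurable M (PiM {j<..} (\<lambda>_. borel))"
  unfolding vec_of_def[abs_def] by (intro measurable_restrict) simp

lemma path_vec: "path j (vec_of {j<..} \<epsilon> \<omega>) x w = path j (\<lambda>t. \<epsilon> t \<omega>) x w"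
proof
  show "path j (vec_of {j<..} \<epsilon> \<omega>) x w i = path j (\<lambda>t. \<epsilon> t \<omega>) x w i" for i
    unfolding vec_of_def by (rule path_restrict) auto
qed

lemma trigger_vec: "j \<le> 0 \<Longrightarrow> trigger j (vec_of {j<..} \<epsilon> \<omega>) x w = trigger j (\<lambda>t. \<epsilon> t \<omega>) x w"
  unfolding vec_of_def by (rule trigger_restrict) auto

context
  fixes j :: int and g :: "(int \<Rightarrow> real) \<Rightarrow> real" and \<kappa> :: "real \<Rightarrow> real" and B :: real
  assumes j: "j \<le> 0" and gc: "cconv (\<lambda>_. g) g" and gm: "g \<in> borel_measurable borel" and gB: "\<And>v. \<bar>g v\<bar> \<le> B"
    and \<kappa>c: "continuous_on UNIV \<kappa>" and \<kappa>1: "\<And>y. \<bar>\<kappa> y\<bar> \<le> 1"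
begin

lemma g\<kappa>_bound: "\<bar>g v * \<kappa> y\<bar> \<le> B"
  using mult_mono[OF gB[of v] \<kappa>1[of y]] gB[of v] by (simp add: abs_mult)

lemma \<kappa>m: "\<kappa> \<in> borel_measurable borel" by (rule borel_measurable_continuous_onI[OF \<kappa>c])

lemma future_exp_integrand_measurable:
  assumes "u \<in> borel_measurable S" "w \<in> borel_measurable S"
  shows "(\<lambda>y. g ((path j (\<lambda>t. \<epsilon> t (snd y)) x (w (fst y)))(j - 1 := u (fst y))) * \<kappa> (trigger j (\<lambda>t. \<epsilon> t (snd y)) x (w (fst y)))) \<in> borel_measurable (S \<Otimes>\<^sub>M M)"
  using future_measurable[OF j gm \<kappa>m measurable_compose[OF measurable_fst assms(1)] measurable_compose[OF measurable_fst assms(2)]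
      measurable_compose[OF measurable_snd vec_measurable[of j]], of x]
  by (simp add: path_vec trigger_vec[OF j])

lemma future_exp_bound: "\<bar>future_exp j g \<kappa> x z\<bar> \<le> B"
  unfolding future_exp_def by (rule abs_integral_le[OF M g\<kappa>_bound])

lemma future_exp_cconv: "cconv (future_exp j g \<kappa>) (future_exp_lim j g \<kappa>)"
  unfolding future_exp_def future_exp_lim_def
proof (rule cconv_integral[OF M])
  have s: "cconv (\<lambda>x z. snd z) (\<lambda>z :: real \<times> real. snd z)" "cconv (\<lambda>x z. fst z) (\<lambda>z :: real \<times> real. fst z)"
    unfolding cconv_def by (auto dest: tendsto_snd tendsto_fst)
  show "cconv (\<lambda>x z. g ((path j (\<lambda>t. \<epsilon> t \<omega>) x (snd z))(j - 1 := fst z)) * \<kappa> (trigger j (\<lambda>t. \<epsilon> t \<omega>) x (snd z)))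
      (\<lambda>z. g ((path_lim j (\<lambda>t. \<epsilon> t \<omega>) (snd z))(j - 1 := fst z)) * \<kappa> (trigger_lim j (\<lambda>t. \<epsilon> t \<omega>) (snd z)))" for \<omega>
    by (intro cconv_mult cconv_compose[OF gc] cconv_compose[OF cconv_const[OF \<kappa>c]] cconv_fun_upd
        cconv_compose[OF path_cconv] cconv_compose[OF trigger_cconv] s)
  show "(\<lambda>\<omega>. g ((path j (\<lambda>t. \<epsilon> t \<omega>) x (snd z))(j - 1 := fst z)) * \<kappa> (trigger j (\<lambda>t. \<epsilon> t \<omega>) x (snd z))) \<in> borel_measurable M" for x z
    using future_measurable[where u="\<lambda>_. fst z" and w="\<lambda>_. snd z", OF j gm \<kappa>m borel_measurable_const borel_measurable_const vec_measurable]
    by (simp add: path_vec trigger_vec[OF j])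
qed (rule g\<kappa>_bound)

lemma future_exp_measurable: "future_exp j g \<kappa> x \<in> borel_measurable borel"
  unfolding future_exp_def
proof (rule borel_measurable_lebesgue_integral)
  have "fst \<in> borel_measurable (borel :: (real \<times> real) measure)" "snd \<in> borel_measurable (borel :: (real \<times> real) measure)"
    by (auto simp: borel_prod[symmetric])
  from future_exp_integrand_measurable[OF this]
  show "(\<lambda>(z, \<omega>). g ((path j (\<lambda>t. \<epsilon> t \<omega>) x (snd z))(j - 1 := fst z)) * \<kappa> (trigger j (\<lambda>t. \<epsilon> t \<omega>) x (snd z))) \<in> borel_measurable (borel \<Otimes>\<^sub>M M)"
    by (simp add: case_prod_beta')
qed

lemma future_exp_lim_0: "\<kappa> 0 = 0 \<Longrightarrow> future_exp_lim j g \<kappa> (u, 0) = 0"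
  by (simp add: future_exp_lim_def trigger_lim_0)

text \<open>The tower property: the two values at \<open>j - 1\<close> and \<open>j\<close> are
  independent of the innovations after \<open>j\<close>, which determine the rest of the path and
  \<open>X 0\<close>. The weight \<open>\<theta>\<close> depends on \<open>Y j\<close> only and is
  carried along.\<close>

lemma integral_future_exp:
  assumes gdep: "\<And>v w. (\<And>i. i \<ge> j - 1 \<Longrightarrow> v i = w i) \<Longrightarrow> g v = g w"
    and \<theta>: "\<theta> \<in> borel_measurable borel" "\<And>y. \<bar>\<theta> y\<bar> \<le> 1" and x: "x \<noteq> 0"
  shows "(\<integral>\<omega>. g (\<lambda>i. Y i \<omega> / x) * \<kappa> (X 0 \<omega> / x) * \<theta> (Y j \<omega> / x) \<partial>M) =
    (\<integral>\<omega>. future_exp j g \<kappa> x (Y (j - 1) \<omega> / x, Y j \<omega> / x) * \<theta> (Y j \<omega> / x) \<partial>M)"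
proof -
  define h where "h y = g ((path j (snd y) x (snd (fst y) / x))(j - 1 := fst (fst y) / x)) * \<kappa> (trigger j (snd y) x (snd (fst y) / x)) * \<theta> (snd (fst y) / x)"
    for y :: "(real \<times> real) \<times> (int \<Rightarrow> 's)"
  have hm: "h \<in> borel_measurable ((borel \<Otimes>\<^sub>M borel) \<Otimes>\<^sub>M PiM {j<..} (\<lambda>_. borel))"
    unfolding h_def
    by (intro borel_measurable_times[OF future_measurable[OF j gm \<kappa>m] measurable_compose[OF _ \<theta>(1)]]) auto
  have hB: "\<bar>h y\<bar> \<le> B" for y
    unfolding h_def using mult_mono[OF g\<kappa>_bound \<theta>(2)] gB[of undefined] by (simp add: abs_mult)
  have ym: "(\<lambda>\<omega> i. Y i \<omega> / x) \<in> borel_measurable M"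
    by (rule measurable_coordinatewise_then_product) simp
  have "(\<integral>\<omega>. g (\<lambda>i. Y i \<omega> / x) * \<kappa> (X 0 \<omega> / x) * \<theta> (Y j \<omega> / x) \<partial>M) = (\<integral>\<omega>. h ((Y (j - 1) \<omega>, Y j \<omega>), vec_of {j<..} \<epsilon> \<omega>) \<partial>M)"
  proof (rule integral_cong_AE)
    show "(\<lambda>\<omega>. g (\<lambda>i. Y i \<omega> / x) * \<kappa> (X 0 \<omega> / x) * \<theta> (Y j \<omega> / x)) \<in> borel_measurable M"
      by (intro borel_measurable_times measurable_compose[OF ym gm] measurable_compose[OF _ \<kappa>m] measurable_compose[OF _ \<theta>(1)]) auto
    show "(\<lambda>\<omega>. h ((Y (j - 1) \<omega>, Y j \<omega>), vec_of {j<..} \<epsilon> \<omega>)) \<in> borel_measurable M"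
      by (intro measurable_compose[OF _ hm] measurable_Pair vec_measurable) auto
    show "AE \<omega> in M. g (\<lambda>i. Y i \<omega> / x) * \<kappa> (X 0 \<omega> / x) * \<theta> (Y j \<omega> / x) = h ((Y (j - 1) \<omega>, Y j \<omega>), vec_of {j<..} \<epsilon> \<omega>)"
      using path_eq[OF x, of j] trigger_eq[OF x j]
    proof eventually_elim
      case (elim \<omega>)
      have "g (\<lambda>i. Y i \<omega> / x) = g ((path j (\<lambda>t. \<epsilon> t \<omega>) x (Y j \<omega> / x))(j - 1 := Y (j - 1) \<omega> / x))"
      proof (rule gdep)
        fix i assume "j - 1 \<le> i"
        then show "Y i \<omega> / x = ((path j (\<lambda>t. \<epsilon> t \<omega>) x (Y j \<omega> / x))(j - 1 := Y (j - 1) \<omega> / x)) i"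
          using elim(1) by (cases "i = j - 1") auto
      qed
      then show ?case using elim(2) by (simp add: h_def path_vec trigger_vec[OF j])
    qed
  qed
  also have "\<dots> = (\<integral>\<omega>. (\<integral>\<omega>'. h ((Y (j - 1) \<omega>, Y j \<omega>), vec_of {j<..} \<epsilon> \<omega>') \<partial>M) \<partial>M)"
    by (rule indep_rv_integral[OF M future_indep hm hB]) simp
  also have "\<dots> = (\<integral>\<omega>. future_exp j g \<kappa> x (Y (j - 1) \<omega> / x, Y j \<omega> / x) * \<theta> (Y j \<omega> / x) \<partial>M)"
    by (simp add: h_def future_exp_def path_vec trigger_vec[OF j])
  finally show ?thesis .
qed

end

end

section \<open>The backward step\<close>

context tail_setting
begin

text \<open>\<open>hA\<close> and \<open>hB\<close> state the laws of the backward multipliers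
  without normalisation, so that they remain true when the conditioning event is null. Division by
  \<open>M0 = -1\<close> causes the sign in front of \<open>Mneg\<close> in
  \<open>hB\<close>.\<close>

context
  fixes N :: "'b measure" and a b :: "'b \<Rightarrow> real" and j :: int and g :: "(int \<Rightarrow> real) \<Rightarrow> real" and B \<eta> :: real
  assumes N: "prob_space N" and am[measurable]: "a \<in> borel_measurable N" and bm[measurable]: "b \<in> borel_measurable N"
    and hA: "\<And>(f :: real \<Rightarrow> real) D. f \<in> borel_measurable borel \<Longrightarrow> (\<And>y. \<bar>f y\<bar> \<le> D) \<Longrightarrow>
        (\<integral>\<omega>. f (a \<omega>) \<partial>N) * p = (\<integral>\<omega>. f (Mneg \<omega>) * indicator {\<omega>\<in>space K. M0 \<omega> = 1} \<omega> \<partial>K)"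
    and hB: "\<And>(f :: real \<Rightarrow> real) D. f \<in> borel_measurable borel \<Longrightarrow> (\<And>y. \<bar>f y\<bar> \<le> D) \<Longrightarrow>
        (\<integral>\<omega>. f (b \<omega>) \<partial>N) * (1 - p) = (\<integral>\<omega>. f (- Mneg \<omega>) * indicator {\<omega>\<in>space K. M0 \<omega> = -1} \<omega> \<partial>K)"
    and j: "j \<le> 0" and gc: "cconv (\<lambda>_. g) g" and gm: "g \<in> borel_measurable borel" and gB: "\<And>v. \<bar>g v\<bar> \<le> B"
    and gdep: "\<And>v w. (\<And>i. i \<ge> j - 1 \<Longrightarrow> v i = w i) \<Longrightarrow> g v = g w"
    and eta: "\<eta> > 0" and gz: "\<And>v. \<bar>v (j - 1)\<bar> \<le> \<eta> \<Longrightarrow> g v = 0"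
begin

text \<open>In the limit process this is the conditional mean of \<open>g\<close> given the
  coordinates from \<open>j\<close> on. It is applied to the original series as well; since it
  ignores coordinate \<open>j - 1\<close>, the induction hypothesis covers it.\<close>

definition back_mean :: "(int \<Rightarrow> real) \<Rightarrow> real" where
  "back_mean v = (\<integral>\<nu>. g (v(j - 1 := tail_step (v j) (a \<nu>) (b \<nu>))) \<partial>N)"

lemma tail_step_cconv: "cconv (\<lambda>x y. tail_step y \<xi> \<zeta>) (\<lambda>y. tail_step y \<xi> \<zeta>)"
  unfolding cconv_def tail_step_eq by (intro allI impI tendsto_intros)

lemma back_mean_cconv: "cconv (\<lambda>_. back_mean) back_mean"
  unfolding back_mean_def
proof (rule cconv_integral[OF N])
  have idc: "cconv (\<lambda>x v. v) (\<lambda>v. v :: int \<Rightarrow> real)" by (simp add: cconv_def)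
  show "cconv (\<lambda>x v. g (v(j - 1 := tail_step (v j) (a \<nu>) (b \<nu>)))) (\<lambda>v. g (v(j - 1 := tail_step (v j) (a \<nu>) (b \<nu>))))" for \<nu>
    by (intro cconv_compose[OF gc] cconv_fun_upd idc cconv_compose[OF tail_step_cconv cconv_coordinate])
  show "(\<lambda>\<nu>. g (v(j - 1 := tail_step (v j) (a \<nu>) (b \<nu>)))) \<in> borel_measurable N" for v
    by (intro measurable_compose[OF _ gm] measurable_fun_upd_borel tail_step_measurable) auto
qed (rule gB)

lemma back_mean_bound: "\<bar>back_mean v\<bar> \<le> B"
  unfolding back_mean_def by (rule abs_integral_le[OF N gB])

lemma back_mean_measurable: "back_mean \<in> borel_measurable borel"
proof -
  interpret N: prob_space N by (rule N)
  have "(\<lambda>z. g ((fst z)(j - 1 := tail_step (fst z j) (a (snd z)) (b (snd z))))) \<in> borel_measurable (borel \<Otimes>\<^sub>M N)"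
    by (intro measurable_compose[OF _ gm] measurable_fun_upd_borel tail_step_measurable
        measurable_compose[OF measurable_fst measurable_coordinate] measurable_compose[OF measurable_snd am]
        measurable_compose[OF measurable_snd bm] measurable_fst)
  then show ?thesis unfolding back_mean_def
    by (intro N.borel_measurable_lebesgue_integral) (simp add: case_prod_beta')
qed

lemma back_mean_dep: "(\<And>i. i \<ge> j \<Longrightarrow> v i = w i) \<Longrightarrow> back_mean v = back_mean w"
  unfolding back_mean_def by (intro Bochner_Integration.integral_cong refl gdep) auto

text \<open>A tail step from 0 ends at 0, where \<open>g\<close> vanishes. In the limit process,
  too, nothing is lost by cutting out small values of coordinate \<open>j\<close>.\<close>

lemma back_mean_0: "v j = 0 \<Longrightarrow> back_mean v = 0"
proof -
  assume v: "v j = 0"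
  have "g (v(j - 1 := 0)) = 0" by (rule gz) (use eta in simp)
  then show ?thesis using v by (simp add: back_mean_def tail_step_def)
qed

text \<open>For \<open>z > 0\<close>, the tail step from \<open>z * M0\<close> is
  \<open>z * a\<close> on \<open>M0 = 1\<close> and \<open>- z * b\<close> on
  \<open>M0 = -1\<close>; for \<open>z = 0\<close> it is 0. On each of the two events
  \<open>hA\<close> or \<open>hB\<close> identifies the result with \<open>z * Mneg\<close> in
  law.\<close>

lemma integral_Mneg:
  fixes \<Gamma> :: "real \<times> real \<Rightarrow> real"
  assumes \<Gamma>: "\<Gamma> \<in> borel_measurable borel" and D: "\<And>z. \<bar>\<Gamma> z\<bar> \<le> D" and z: "z \<ge> 0"
  shows "(\<integral>\<omega>. \<Gamma> (z * Mneg \<omega>, z * M0 \<omega>) \<partial>K) =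
    (\<integral>\<omega>. (\<integral>\<nu>. \<Gamma> (tail_step (z * M0 \<omega>) (a \<nu>) (b \<nu>), z * M0 \<omega>) \<partial>N) \<partial>K)"
proof -
  interpret N: prob_space N by (rule N)
  define H where "H w = (\<integral>\<nu>. \<Gamma> (tail_step w (a \<nu>) (b \<nu>), w) \<partial>N)" for w
  have Hm: "H \<in> borel_measurable borel"
  proof -
    have "(\<lambda>y. \<Gamma> (tail_step (fst y) (a (snd y)) (b (snd y)), fst y)) \<in> borel_measurable (borel \<Otimes>\<^sub>M N)"
      by (intro measurable_compose[OF borel_measurable_Pair \<Gamma>] tail_step_measurable) measurable
    then show ?thesis unfolding H_def
      by (intro N.borel_measurable_lebesgue_integral) (simp add: case_prod_beta')
  qed
  have HB: "\<bar>H w\<bar> \<le> D" for w unfolding H_def by (rule abs_integral_le[OF N D])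
  have \<Gamma>m: "(\<lambda>\<omega>. \<Gamma> (z * Mneg \<omega>, z * M0 \<omega>)) \<in> borel_measurable K"
    by (intro measurable_compose[OF borel_measurable_Pair \<Gamma>]) auto
  have Hm': "(\<lambda>\<omega>. H (z * M0 \<omega>)) \<in> borel_measurable K" by (rule measurable_compose[OF _ Hm]) auto
  have 1: "(\<integral>\<omega>. \<Gamma> (z * Mneg \<omega>, z * M0 \<omega>) * indicator {\<omega>\<in>space K. M0 \<omega> = 1} \<omega> \<partial>K)
      = (\<integral>\<omega>. H (z * M0 \<omega>) * indicator {\<omega>\<in>space K. M0 \<omega> = 1} \<omega> \<partial>K)"
  proof -
    have "(\<integral>\<omega>. \<Gamma> (z * Mneg \<omega>, z * M0 \<omega>) * indicator {\<omega>\<in>space K. M0 \<omega> = 1} \<omega> \<partial>K)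
        = (\<integral>\<omega>. \<Gamma> (z * Mneg \<omega>, z) * indicator {\<omega>\<in>space K. M0 \<omega> = 1} \<omega> \<partial>K)"
      by (rule integral_cong_space) (auto simp: indicator_def)
    also have "\<dots> = (\<integral>\<omega>. \<Gamma> (z * a \<omega>, z) \<partial>N) * p"
      by (rule hA[of "\<lambda>y. \<Gamma> (z * y, z)" D, symmetric])
        (use D in \<open>auto intro!: measurable_compose[OF borel_measurable_Pair \<Gamma>]\<close>)
    also have "(\<integral>\<omega>. \<Gamma> (z * a \<omega>, z) \<partial>N) = H z"
      unfolding H_def using z by (intro integral_cong_space) (auto simp: tail_step_def indicator_def)
    also have "H z * p = (\<integral>\<omega>. H z * indicator {\<omega>\<in>space K. M0 \<omega> = 1} \<omega> \<partial>K)" using M0(1) by simp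
    also have "\<dots> = (\<integral>\<omega>. H (z * M0 \<omega>) * indicator {\<omega>\<in>space K. M0 \<omega> = 1} \<omega> \<partial>K)"
      by (rule integral_cong_space) (auto simp: indicator_def)
    finally show ?thesis .
  qed
  have 2: "(\<integral>\<omega>. \<Gamma> (z * Mneg \<omega>, z * M0 \<omega>) * indicator {\<omega>\<in>space K. M0 \<omega> = -1} \<omega> \<partial>K)
      = (\<integral>\<omega>. H (z * M0 \<omega>) * indicator {\<omega>\<in>space K. M0 \<omega> = -1} \<omega> \<partial>K)"
  proof -
    have "(\<integral>\<omega>. \<Gamma> (z * Mneg \<omega>, z * M0 \<omega>) * indicator {\<omega>\<in>space K. M0 \<omega> = -1} \<omega> \<partial>K)
        = (\<integral>\<omega>. \<Gamma> (- (z * (- Mneg \<omega>)), - z) * indicator {\<omega>\<in>space K. M0 \<omega> = -1} \<omega> \<partial>K)"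
      by (rule integral_cong_space) (auto simp: indicator_def)
    also have "\<dots> = (\<integral>\<omega>. \<Gamma> (- (z * b \<omega>), - z) \<partial>N) * (1 - p)"
      by (rule hB[of "\<lambda>y. \<Gamma> (- (z * y), - z)" D, symmetric])
        (use D in \<open>auto intro!: measurable_compose[OF borel_measurable_Pair \<Gamma>]\<close>)
    also have "(\<integral>\<omega>. \<Gamma> (- (z * b \<omega>), - z) \<partial>N) = H (- z)"
      unfolding H_def using z by (intro integral_cong_space) (auto simp: tail_step_def indicator_def)
    also have "H (- z) * (1 - p) = (\<integral>\<omega>. H (- z) * indicator {\<omega>\<in>space K. M0 \<omega> = -1} \<omega> \<partial>K)" using M0(2) by simp
    also have "\<dots> = (\<integral>\<omega>. H (z * M0 \<omega>) * indicator {\<omega>\<in>space K. M0 \<omega> = -1} \<omega> \<partial>K)"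
      by (rule integral_cong_space) (auto simp: indicator_def)
    finally show ?thesis .
  qed
  have "(\<integral>\<omega>. \<Gamma> (z * Mneg \<omega>, z * M0 \<omega>) \<partial>K) = (\<integral>\<omega>. H (z * M0 \<omega>) \<partial>K)"
    using integral_sign_split[OF K M0 M0_measurable \<Gamma>m D] integral_sign_split[OF K M0 M0_measurable Hm' HB] 1 2 by simp
  then show ?thesis by (simp add: H_def)
qed

context
  fixes \<kappa> :: "real \<Rightarrow> real"
  assumes \<kappa>c: "continuous_on UNIV \<kappa>" and \<kappa>1: "\<And>y. \<bar>\<kappa> y\<bar> \<le> 1" and \<kappa>0: "\<kappa> 0 = 0"
begin

lemma future_exp_zero: "\<bar>u\<bar> \<le> \<eta> \<Longrightarrow> future_exp j g \<kappa> x (u, w) = 0"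
  unfolding future_exp_def using gz by simp

lemma future_exp_lim_zero: "\<bar>u\<bar> \<le> \<eta> \<Longrightarrow> future_exp_lim j g \<kappa> (u, w) = 0"
  unfolding future_exp_lim_def using gz by simp

text \<open>Averages over the future innovations and over the backward pair commute. The argument
  \<open>u\<close> disappears because \<open>back_mean\<close> overwrites coordinate
  \<open>j - 1\<close>, and the tail step starts from \<open>w\<close>, the value of the path at
  \<open>j\<close>.\<close>

lemma future_exp_back_mean:
  "future_exp j back_mean \<kappa> x (u, w) = (\<integral>\<nu>. future_exp j g \<kappa> x (tail_step w (a \<nu>) (b \<nu>), w) \<partial>N)"
proof -
  have \<kappa>m: "\<kappa> \<in> borel_measurable borel" by (rule borel_measurable_continuous_onI[OF \<kappa>c])
  have pj: "path j e x w j = w" for e by (simp add: path_def)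
  have "future_exp j back_mean \<kappa> x (u, w) = (\<integral>\<omega>. (\<integral>\<nu>. g ((path j (\<lambda>t. \<epsilon> t \<omega>) x w)(j - 1 := tail_step w (a \<nu>) (b \<nu>)))
      * \<kappa> (trigger j (\<lambda>t. \<epsilon> t \<omega>) x w) \<partial>N) \<partial>M)"
    by (simp add: future_exp_def back_mean_def pj)
  also have "\<dots> = (\<integral>\<nu>. (\<integral>\<omega>. g ((path j (\<lambda>t. \<epsilon> t \<omega>) x w)(j - 1 := tail_step w (a \<nu>) (b \<nu>)))
      * \<kappa> (trigger j (\<lambda>t. \<epsilon> t \<omega>) x w) \<partial>M) \<partial>N)"
  proof (rule integral_swap_bounded[OF M N _ g\<kappa>_bound[OF j gc gm gB \<kappa>c \<kappa>1]])
    have ts: "(\<lambda>y. tail_step w (a (snd y)) (b (snd y))) \<in> borel_measurable (M \<Otimes>\<^sub>M N)"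
      by (intro tail_step_measurable) measurable
    from future_measurable[where w="\<lambda>_. w", OF j gm \<kappa>m ts borel_measurable_const measurable_compose[OF measurable_fst vec_measurable], of x]
    show "(\<lambda>(\<omega>, \<nu>). g ((path j (\<lambda>t. \<epsilon> t \<omega>) x w)(j - 1 := tail_step w (a \<nu>) (b \<nu>))) * \<kappa> (trigger j (\<lambda>t. \<epsilon> t \<omega>) x w)) \<in> borel_measurable (M \<Otimes>\<^sub>M N)"
      by (simp add: path_vec trigger_vec[OF j] case_prod_beta')
  qed
  finally show ?thesis by (simp add: future_exp_def)
qed

text \<open>Here \<open>\<theta>\<close> will be a cutoff that removes small \<open>Y j / x\<close>,
  or the complement of such a cutoff.\<close>

definition weighted :: "((int \<Rightarrow> real) \<Rightarrow> real) \<Rightarrow> (real \<Rightarrow> real) \<Rightarrow> real \<Rightarrow> real" where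
  "weighted f \<theta> x = (\<integral>\<omega>. f (\<lambda>i. Y i \<omega> / x) * \<kappa> (X 0 \<omega> / x) * \<theta> (Y j \<omega> / x) \<partial>M)"

text \<open>\<open>\<theta>\<close> may be nonzero at 0: that \<open>g\<close> vanishes for small
  \<open>Y (j - 1) / x\<close> is all the localisation that \<open>forward_tail_limit\<close>
  requires.\<close>

lemma weighted_limit:
  assumes \<theta>c: "continuous_on UNIV \<theta>" and \<theta>1: "\<And>y. \<bar>\<theta> y\<bar> \<le> 1" and r: "filterlim r at_top sequentially"
  shows "(\<lambda>n. weighted g \<theta> (r n) / q (r n)) \<longlonglongrightarrow>
     (\<integral>t. (\<integral>\<omega>. future_exp_lim j g \<kappa> (tail_radius \<alpha> t * M0 \<omega>, tail_radius \<alpha> t * M1 \<omega>) * \<theta> (tail_radius \<alpha> t * M1 \<omega>) \<partial>K) \<partial>lborel)"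
proof -
  note ctx = j gc gm gB \<kappa>c \<kappa>1
  have \<theta>m: "\<theta> \<in> borel_measurable borel" by (rule borel_measurable_continuous_onI[OF \<theta>c])
  have sm: "snd \<in> borel_measurable (borel :: (real \<times> real) measure)" by (auto simp: borel_prod[symmetric])
  have sc: "cconv (\<lambda>x z. snd z) (\<lambda>z :: real \<times> real. snd z)" unfolding cconv_def by (auto dest: tendsto_snd)
  have "(\<lambda>n. (\<integral>\<omega>. (\<lambda>x z. future_exp j g \<kappa> x z * \<theta> (snd z)) (r n) (Y (j - 1) \<omega> / r n, Y j \<omega> / r n) \<partial>M) / q (r n)) \<longlonglongrightarrow>
     (\<integral>t. (\<integral>\<omega>. (\<lambda>z. future_exp_lim j g \<kappa> z * \<theta> (snd z)) (tail_radius \<alpha> t * M0 \<omega>, tail_radius \<alpha> t * M1 \<omega>) \<partial>K) \<partial>lborel)"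
  proof (rule forward_tail_limit[OF _ _ _ eta _ r])
    show "cconv (\<lambda>x z. future_exp j g \<kappa> x z * \<theta> (snd z)) (\<lambda>z. future_exp_lim j g \<kappa> z * \<theta> (snd z))"
      by (intro cconv_mult future_exp_cconv[OF ctx] cconv_compose[OF cconv_const[OF \<theta>c] sc])
    show "\<bar>future_exp j g \<kappa> x z * \<theta> (snd z)\<bar> \<le> B" for x z
      using mult_mono[OF future_exp_bound[OF ctx, of x z] \<theta>1[of "snd z"]] gB[of undefined] by (simp add: abs_mult)
    show "(\<lambda>z. future_exp j g \<kappa> x z * \<theta> (snd z)) \<in> borel_measurable borel" for x
      by (rule borel_measurable_times[OF future_exp_measurable[OF ctx] measurable_compose[OF sm \<theta>m]])
  qed (simp add: future_exp_zero)
  moreover have "\<forall>\<^sub>F n in sequentially. (\<integral>\<omega>. (\<lambda>x z. future_exp j g \<kappa> x z * \<theta> (snd z)) (r n) (Y (j - 1) \<omega> / r n, Y j \<omega> / r n) \<partial>M) / q (r n)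
      = weighted g \<theta> (r n) / q (r n)"
  proof -
    have "\<forall>\<^sub>F n in sequentially. r n > 0" using r by (simp add: filterlim_at_top_dense)
    then show ?thesis
      by eventually_elim (simp add: weighted_def integral_future_exp[OF ctx gdep \<theta>m \<theta>1])
  qed
  ultimately show ?thesis using Lim_transform_eventually by fastforce
qed

text \<open>The limit is the one of \<open>weighted g\<close>, which is the point of the adjointness
  argument. As \<open>back_mean\<close> ignores coordinate \<open>j - 1\<close>, the localisation
  must now come from \<open>\<theta>\<close>, hence the margin \<open>d\<close>. The prelimit
  depends on \<open>Y j\<close> alone; its limit is an integral over \<open>(Mneg, M0)\<close> by
  \<open>integral_Mneg\<close>, and adjointness converts this to \<open>(M0, M1)\<close>.\<close>

lemma weighted_back_mean_limit:
  assumes \<theta>c: "continuous_on UNIV \<theta>" and \<theta>1: "\<And>y. \<bar>\<theta> y\<bar> \<le> 1" and r: "filterlim r at_top sequentially"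
    and d: "d > 0" and \<theta>z: "\<And>w. \<bar>w\<bar> \<le> d \<Longrightarrow> \<theta> w = 0"
  shows "(\<lambda>n. weighted back_mean \<theta> (r n) / q (r n)) \<longlonglongrightarrow>
     (\<integral>t. (\<integral>\<omega>. future_exp_lim j g \<kappa> (tail_radius \<alpha> t * M0 \<omega>, tail_radius \<alpha> t * M1 \<omega>) * \<theta> (tail_radius \<alpha> t * M1 \<omega>) \<partial>K) \<partial>lborel)"
proof -
  interpret N: prob_space N by (rule N)
  note ctx = j gc gm gB \<kappa>c \<kappa>1
  note ctxb = j back_mean_cconv back_mean_measurable back_mean_bound \<kappa>c \<kappa>1
  have \<theta>m: "\<theta> \<in> borel_measurable borel" by (rule borel_measurable_continuous_onI[OF \<theta>c])
  have sm: "snd \<in> borel_measurable (borel :: (real \<times> real) measure)" by (auto simp: borel_prod[symmetric])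
  have sc: "cconv (\<lambda>x z. snd z) (\<lambda>z :: real \<times> real. snd z)" unfolding cconv_def by (auto dest: tendsto_snd)
  define \<Gamma> where "\<Gamma> x z = future_exp j g \<kappa> x z * \<theta> (snd z)" for x z
  define \<Gamma>0 where "\<Gamma>0 z = future_exp_lim j g \<kappa> z * \<theta> (snd z)" for z
  have \<Gamma>c: "cconv \<Gamma> \<Gamma>0" unfolding \<Gamma>_def \<Gamma>0_def
    by (intro cconv_mult future_exp_cconv[OF ctx] cconv_compose[OF cconv_const[OF \<theta>c] sc])
  have \<Gamma>B: "\<bar>\<Gamma> x z\<bar> \<le> B" for x z unfolding \<Gamma>_def
    using mult_mono[OF future_exp_bound[OF ctx, of x z] \<theta>1[of "snd z"]] gB[of undefined] by (simp add: abs_mult)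
  have \<Gamma>m: "\<Gamma> x \<in> borel_measurable borel" for x unfolding \<Gamma>_def
    by (rule borel_measurable_times[OF future_exp_measurable[OF ctx] measurable_compose[OF sm \<theta>m]])
  have \<Gamma>0m: "\<Gamma>0 \<in> borel_measurable borel" by (rule cconv_limit_measurable[OF \<Gamma>c \<Gamma>m])
  have \<Gamma>0B: "\<bar>\<Gamma>0 z\<bar> \<le> B" for z by (rule cconv_limit_bounded[OF \<Gamma>c \<Gamma>B])
  define H where "H x w = (\<integral>\<nu>. \<Gamma> x (tail_step w (a \<nu>) (b \<nu>), w) \<partial>N)" for x w
  define H0 where "H0 w = (\<integral>\<nu>. \<Gamma>0 (tail_step w (a \<nu>) (b \<nu>), w) \<partial>N)" for w
  have idc: "cconv (\<lambda>x u. u) (\<lambda>u. u :: real)" by (simp add: cconv_def)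
  have Hc: "cconv H H0" unfolding H_def H0_def
  proof (rule cconv_integral[OF N])
    show "cconv (\<lambda>x w. \<Gamma> x (tail_step w (a \<nu>) (b \<nu>), w)) (\<lambda>w. \<Gamma>0 (tail_step w (a \<nu>) (b \<nu>), w))" for \<nu>
      by (rule cconv_compose[OF \<Gamma>c cconv_Pair[OF tail_step_cconv idc]])
    show "(\<lambda>\<nu>. \<Gamma> x (tail_step w (a \<nu>) (b \<nu>), w)) \<in> borel_measurable N" for x w
      by (intro measurable_compose[OF borel_measurable_Pair \<Gamma>m] tail_step_measurable) auto
  qed (rule \<Gamma>B)
  have Hm: "H x \<in> borel_measurable borel" for x
  proof -
    have "(\<lambda>y. \<Gamma> x (tail_step (fst y) (a (snd y)) (b (snd y)), fst y)) \<in> borel_measurable (borel \<Otimes>\<^sub>M N)"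
      by (intro measurable_compose[OF borel_measurable_Pair \<Gamma>m] tail_step_measurable) measurable
    then show ?thesis unfolding H_def
      by (intro N.borel_measurable_lebesgue_integral) (simp add: case_prod_beta')
  qed
  have HB: "\<bar>H x w\<bar> \<le> B" for x w unfolding H_def by (rule abs_integral_le[OF N \<Gamma>B])
  have Hz: "H x w = 0" if "\<bar>w\<bar> \<le> d" for x w unfolding H_def \<Gamma>_def using \<theta>z[OF that] by simp
  have lim: "(\<lambda>n. (\<integral>\<omega>. H (r n) (Y j \<omega> / r n) \<partial>M) / q (r n)) \<longlonglongrightarrow> (\<integral>t. (\<integral>\<omega>. H0 (tail_radius \<alpha> t * M0 \<omega>) \<partial>K) \<partial>lborel)"
    by (rule tail_limit_Y[OF Hc HB Hm d Hz r])
  have "(\<integral>t. (\<integral>\<omega>. H0 (tail_radius \<alpha> t * M0 \<omega>) \<partial>K) \<partial>lborel) = (\<integral>t. (\<integral>\<omega>. \<Gamma>0 (tail_radius \<alpha> t * Mneg \<omega>, tail_radius \<alpha> t * M0 \<omega>) \<partial>K) \<partial>lborel)"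
    by (simp add: H0_def integral_Mneg[OF \<Gamma>0m \<Gamma>0B tail_radius_nonneg])
  \<comment> \<open>Both axes are avoided: \<open>g\<close> gives the margin \<open>\<eta>\<close>
    in the first coordinate and \<open>\<theta>\<close> the margin \<open>d\<close> in the
    second.\<close>
  also have "\<dots> = (\<integral>t. (\<integral>\<omega>. \<Gamma>0 (tail_radius \<alpha> t * M0 \<omega>, tail_radius \<alpha> t * M1 \<omega>) \<partial>K) \<partial>lborel)"
    by (rule adjoint_integral_eq[OF K \<alpha> M0_measurable M1 Mneg adj AE_sign[OF K M0 M0_measurable] eta d \<Gamma>0m \<Gamma>0B, symmetric])
      (auto simp: \<Gamma>0_def future_exp_lim_zero \<theta>z)
  finally have lim': "(\<lambda>n. (\<integral>\<omega>. H (r n) (Y j \<omega> / r n) \<partial>M) / q (r n)) \<longlonglongrightarrow>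
     (\<integral>t. (\<integral>\<omega>. \<Gamma>0 (tail_radius \<alpha> t * M0 \<omega>, tail_radius \<alpha> t * M1 \<omega>) \<partial>K) \<partial>lborel)" using lim by simp
  have "weighted back_mean \<theta> x = (\<integral>\<omega>. H x (Y j \<omega> / x) \<partial>M)" if x: "x \<noteq> 0" for x
  proof -
    have "weighted back_mean \<theta> x = (\<integral>\<omega>. future_exp j back_mean \<kappa> x (Y (j - 1) \<omega> / x, Y j \<omega> / x) * \<theta> (Y j \<omega> / x) \<partial>M)"
      unfolding weighted_def by (rule integral_future_exp[OF ctxb _ \<theta>m \<theta>1 x]) (rule back_mean_dep, simp)
    then show ?thesis by (simp add: future_exp_back_mean H_def \<Gamma>_def)
  qed
  moreover have "\<forall>\<^sub>F n in sequentially. r n > 0" using r by (simp add: filterlim_at_top_dense)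
  ultimately have "\<forall>\<^sub>F n in sequentially. (\<integral>\<omega>. H (r n) (Y j \<omega> / r n) \<partial>M) / q (r n) = weighted back_mean \<theta> (r n) / q (r n)"
    by (auto elim!: eventually_mono)
  from Lim_transform_eventually[OF lim' this] show ?thesis by (simp add: \<Gamma>0_def)
qed

text \<open>The weights tend to 0 off the axis where the second coordinate is 0. On that axis the
  other factor is 0, because the trigger vanishes there and \<open>\<kappa> 0 = 0\<close>. Dominated
  convergence is applied first over \<open>K\<close>, then over the radius.\<close>

lemma cutoff_error_vanishes:
  assumes \<theta>m: "\<And>n. \<theta> n \<in> borel_measurable borel" and \<theta>1: "\<And>n y. \<bar>\<theta> n y\<bar> \<le> 1"
    and \<theta>0: "\<And>y. y \<noteq> 0 \<Longrightarrow> (\<lambda>n. \<theta> n y) \<longlonglongrightarrow> 0"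
  shows "(\<lambda>n. \<integral>t. (\<integral>\<omega>. future_exp_lim j g \<kappa> (tail_radius \<alpha> t * M0 \<omega>, tail_radius \<alpha> t * M1 \<omega>) * \<theta> n (tail_radius \<alpha> t * M1 \<omega>) \<partial>K) \<partial>lborel) \<longlonglongrightarrow> 0"
proof -
  interpret K: prob_space K by (rule K)
  note ctx = j gc gm gB \<kappa>c \<kappa>1
  define F where "F t n \<omega> = future_exp_lim j g \<kappa> (tail_radius \<alpha> t * M0 \<omega>, tail_radius \<alpha> t * M1 \<omega>) * \<theta> n (tail_radius \<alpha> t * M1 \<omega>)" for t n \<omega>
  have B0: "0 \<le> B" using gB[of undefined] by linarith
  have Lm: "future_exp_lim j g \<kappa> \<in> borel_measurable borel"
    by (rule cconv_limit_measurable[OF future_exp_cconv[OF ctx] future_exp_measurable[OF ctx]])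
  have LB: "\<bar>future_exp_lim j g \<kappa> z\<bar> \<le> B" for z
    by (rule cconv_limit_bounded[OF future_exp_cconv[OF ctx] future_exp_bound[OF ctx]])
  have FB: "\<bar>F t n \<omega>\<bar> \<le> B" for t n \<omega>
    unfolding F_def using mult_mono[OF LB \<theta>1] B0 by (simp add: abs_mult)
  have Fm2: "(\<lambda>(t, \<omega>). F t n \<omega>) \<in> borel_measurable (lborel \<Otimes>\<^sub>M K)" for n
  proof -
    have 1: "(\<lambda>y. tail_radius \<alpha> (fst y) * M0 (snd y)) \<in> borel_measurable (lborel \<Otimes>\<^sub>M K)" by measurable
    have 2: "(\<lambda>y. tail_radius \<alpha> (fst y) * M1 (snd y)) \<in> borel_measurable (lborel \<Otimes>\<^sub>M K)" by measurable
    show ?thesis unfolding F_def case_prod_beta'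
      by (rule borel_measurable_times[OF measurable_compose[OF borel_measurable_Pair[OF 1 2] Lm] measurable_compose[OF 2 \<theta>m]])
  qed
  have Fm: "(\<lambda>\<omega>. F t n \<omega>) \<in> borel_measurable K" for t n
    unfolding F_def
    by (intro borel_measurable_times measurable_compose[OF borel_measurable_Pair Lm] measurable_compose[OF _ \<theta>m]) auto
  have inner: "(\<lambda>n. \<integral>\<omega>. F t n \<omega> \<partial>K) \<longlonglongrightarrow> 0" for t
  proof -
    have "(\<lambda>n. F t n \<omega>) \<longlonglongrightarrow> 0" for \<omega>
    proof (cases "tail_radius \<alpha> t * M1 \<omega> = 0")
      case True
      show ?thesis unfolding F_def True by (simp add: future_exp_lim_0[OF ctx \<kappa>0])
    next
      case False
      then show ?thesis unfolding F_def by (intro tendsto_mult_right_zero \<theta>0)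
    qed
    then have "(\<lambda>n. \<integral>\<omega>. F t n \<omega> \<partial>K) \<longlonglongrightarrow> (\<integral>\<omega>. 0 \<partial>K)"
      by (intro integral_dominated_convergence[where w="\<lambda>_. B"]) (use Fm FB in auto)
    then show ?thesis by simp
  qed
  \<comment> \<open>An integrable majorant in \<open>t\<close>: off the interval the radius is at
    most \<open>\<eta>\<close>, and \<open>M0\<close> of modulus 1 leaves the first coordinate where
    \<open>g\<close> vanishes.\<close>
  have bound: "\<bar>\<integral>\<omega>. F t n \<omega> \<partial>K\<bar> \<le> B * indicator {0<..<\<eta> powr (-\<alpha>)} t" for t n
  proof (cases "t \<in> {0<..<\<eta> powr (-\<alpha>)}")
    case True
    then show ?thesis using abs_integral_le[OF K FB] by simp
  next
    case False
    then have le: "tail_radius \<alpha> t \<le> \<eta>" using tail_radius_gt_iff[OF \<alpha> eta, of t] by auto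
    have "AE \<omega> in K. F t n \<omega> = 0"
      using AE_sign[OF K M0 M0_measurable]
    proof eventually_elim
      case (elim \<omega>)
      then have "\<bar>tail_radius \<alpha> t * M0 \<omega>\<bar> \<le> \<eta>" using le tail_radius_nonneg[of \<alpha> t] by (auto simp: abs_mult)
      then show ?case by (simp add: F_def future_exp_lim_zero)
    qed
    then have "(\<integral>\<omega>. F t n \<omega> \<partial>K) = (\<integral>\<omega>. 0 \<partial>K)" using Fm by (intro integral_cong_AE) auto
    then show ?thesis using False by simp
  qed
  have "(\<lambda>n. \<integral>t. (\<integral>\<omega>. F t n \<omega> \<partial>K) \<partial>lborel) \<longlonglongrightarrow> (\<integral>t. 0 \<partial>(lborel :: real measure))"
  proof (rule integral_dominated_convergence[where f="\<lambda>t. 0" and s="\<lambda>n t. \<integral>\<omega>. F t n \<omega> \<partial>K" and w="\<lambda>t. B * indicator {0<..<\<eta> powr (-\<alpha>)} t"])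
    show "(\<lambda>t. \<integral>\<omega>. F t n \<omega> \<partial>K) \<in> borel_measurable lborel" for n
      by (rule K.borel_measurable_lebesgue_integral[OF Fm2])
    show "integrable lborel (\<lambda>t. B * indicator {0<..<\<eta> powr (-\<alpha>)} t :: real)"
      by (intro integrable_mult_right integrable_real_indicator) auto
  qed (use inner bound in auto)
  then show ?thesis by (simp add: F_def)
qed

end

lemma back_mean_dep':
  assumes gdep': "\<And>v w. (\<And>i. i \<in> {j - 1..k} \<Longrightarrow> v i = w i) \<Longrightarrow> g v = g w" and jk: "j \<le> k"
    and vw: "\<And>i. i \<in> {j..k} \<Longrightarrow> v i = w i"
  shows "back_mean v = back_mean w"
  unfolding back_mean_def using jk vw by (intro Bochner_Integration.integral_cong refl gdep') auto

text \<open>In the limit process the replacement of \<open>g\<close> by \<open>back_mean\<close> is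
  exact, because the pair is independent of the coordinates from \<open>j\<close> to
  \<open>k\<close>.\<close>

lemma back_mean_integral:
  fixes Z :: "int \<Rightarrow> 'b \<Rightarrow> real"
  assumes Z[measurable]: "\<And>t. Z t \<in> borel_measurable N"
    and gdep': "\<And>v w. (\<And>i. i \<in> {j - 1..k} \<Longrightarrow> v i = w i) \<Longrightarrow> g v = g w" and jk: "j \<le> k"
    and ind: "indep_rv N borel (\<lambda>\<omega>. proj {j..k} (\<lambda>i. Z i \<omega>)) (borel \<Otimes>\<^sub>M borel) (\<lambda>\<omega>. (a \<omega>, b \<omega>))"
    and rec: "AE \<omega> in N. Z (j - 1) \<omega> = tail_step (Z j \<omega>) (a \<omega>) (b \<omega>)"
  shows "(\<integral>\<omega>. g (\<lambda>i. Z i \<omega>) \<partial>N) = (\<integral>\<omega>. back_mean (proj {j..k} (\<lambda>i. Z i \<omega>)) \<partial>N)"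
proof -
  define h where "h z = g ((fst z)(j - 1 := tail_step (fst z j) (fst (snd z)) (snd (snd z))))" for z :: "(int \<Rightarrow> real) \<times> (real \<times> real)"
  have hm: "h \<in> borel_measurable (borel \<Otimes>\<^sub>M (borel \<Otimes>\<^sub>M borel))"
    unfolding h_def
    by (intro measurable_compose[OF _ gm] measurable_fun_upd_borel tail_step_measurable measurable_compose[OF measurable_fst measurable_coordinate]) measurable
  have pj: "proj {j..k} v j = v j" for v using jk by (simp add: proj_def)
  have pm: "(\<lambda>\<omega>. proj {j..k} (\<lambda>i. Z i \<omega>)) \<in> borel_measurable N" by (rule measurable_proj) simp
  have zm: "(\<lambda>\<omega> i. Z i \<omega>) \<in> borel_measurable N" by (rule measurable_coordinatewise_then_product) simp
  have "(\<integral>\<omega>. g (\<lambda>i. Z i \<omega>) \<partial>N) = (\<integral>\<omega>. h (proj {j..k} (\<lambda>i. Z i \<omega>), (a \<omega>, b \<omega>)) \<partial>N)"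
  proof (rule integral_cong_AE)
    show "(\<lambda>\<omega>. g (\<lambda>i. Z i \<omega>)) \<in> borel_measurable N" by (rule measurable_compose[OF zm gm])
    show "(\<lambda>\<omega>. h (proj {j..k} (\<lambda>i. Z i \<omega>), (a \<omega>, b \<omega>))) \<in> borel_measurable N"
      by (intro measurable_compose[OF _ hm] measurable_Pair pm am bm)
    show "AE \<omega> in N. g (\<lambda>i. Z i \<omega>) = h (proj {j..k} (\<lambda>i. Z i \<omega>), (a \<omega>, b \<omega>))"
      using rec
    proof eventually_elim
      case (elim \<omega>)
      show ?case unfolding h_def fst_conv snd_conv pj
      proof (rule gdep')
        fix i assume "i \<in> {j - 1..k}"
        then have "i = j - 1 \<or> i \<in> {j..k}" by auto
        then show "Z i \<omega> = ((proj {j..k} (\<lambda>i. Z i \<omega>))(j - 1 := tail_step (Z j \<omega>) (a \<omega>) (b \<omega>))) i"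
          using elim by (auto simp: proj_def)
      qed
    qed
  qed
  also have "\<dots> = (\<integral>\<omega>. (\<integral>\<omega>'. h (proj {j..k} (\<lambda>i. Z i \<omega>), (a \<omega>', b \<omega>')) \<partial>N) \<partial>N)"
    by (rule indep_rv_integral[OF N ind hm, where B=B]) (use gB in \<open>simp add: h_def\<close>)
  also have "\<dots> = (\<integral>\<omega>. back_mean (proj {j..k} (\<lambda>i. Z i \<omega>)) \<partial>N)"
    by (simp add: h_def back_mean_def)
  finally show ?thesis .
qed

text \<open>The ramp \<open>\<kappa>\<close> lies between the indicators of \<open>|X 0| > x\<close>
  and \<open>|X 0| > (1 - \<delta>) * x\<close>, so the error is at most \<open>D\<close> times the
  probability between the two levels. Only the bound \<open>D\<close> of the test function
  enters.\<close>

lemma trigger_smoothing: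
  fixes \<delta> x :: real
  defines "\<kappa> \<equiv> \<lambda>y. min 1 (max 0 ((\<bar>y\<bar> - (1 - \<delta>)) / \<delta>))" and "c \<equiv> \<lambda>x. \<P>(\<omega> in M. \<bar>X 0 \<omega>\<bar> > x)"
  assumes d: "0 < \<delta>" "\<delta> < 1" and x: "x > 0" and h[measurable]: "h \<in> borel_measurable M" and hD: "\<And>\<omega>. \<bar>h \<omega>\<bar> \<le> D"
    and pos: "c x > 0"
  shows "\<bar>(\<integral>\<omega>. h \<omega> * \<kappa> (X 0 \<omega> / x) \<partial>M) / c x - cond_mean M (X 0) x h\<bar> \<le> D * (c ((1 - \<delta>) * x) / c x - 1)"
proof -
  have D0: "0 \<le> D" using hD[of undefined] by linarith
  have km[measurable]: "\<kappa> \<in> borel_measurable borel" unfolding \<kappa>_def by measurable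
  have k01: "0 \<le> \<kappa> y" "\<kappa> y \<le> 1" for y by (auto simp: \<kappa>_def)
  let ?i = "\<lambda>\<omega>. indicator {\<omega>. \<bar>X 0 \<omega>\<bar> > x} \<omega> :: real"
  let ?A = "{\<omega>\<in>space M. \<bar>X 0 \<omega>\<bar> > (1 - \<delta>) * x}" and ?E = "{\<omega>\<in>space M. \<bar>X 0 \<omega>\<bar> > x}"
  have sub: "(1 - \<delta>) * x \<le> x" using d x by (simp add: mult_le_cancel_right1)
  have i1: "integrable M (\<lambda>\<omega>. h \<omega> * \<kappa> (X 0 \<omega> / x))"
    by (rule integrable_const_bound[of _ D]) (use mult_mono[OF hD, of "\<kappa> _" 1] k01 D0 in \<open>auto simp: abs_mult\<close>)
  have i2: "integrable M (\<lambda>\<omega>. h \<omega> * ?i \<omega>)"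
    by (rule integrable_const_bound[of _ D]) (use hD D0 in \<open>auto simp: indicator_def\<close>)
  have ind: "integrable M (\<lambda>\<omega>. indicator ?A \<omega> :: real)" "integrable M (\<lambda>\<omega>. indicator ?E \<omega> :: real)"
    by (rule integrable_real_indicator; auto simp: emeasure_eq_measure)+
  have pt: "\<bar>h \<omega> * \<kappa> (X 0 \<omega> / x) - h \<omega> * ?i \<omega>\<bar> \<le> D * (indicator ?A \<omega> - indicator ?E \<omega>)" if "\<omega> \<in> space M" for \<omega>
  proof -
    have ab: "\<bar>X 0 \<omega> / x\<bar> = \<bar>X 0 \<omega>\<bar> / x" using x by simp
    consider "\<bar>X 0 \<omega>\<bar> > x" | "\<bar>X 0 \<omega>\<bar> \<le> (1 - \<delta>) * x" | "\<bar>X 0 \<omega>\<bar> \<le> x" "\<bar>X 0 \<omega>\<bar> > (1 - \<delta>) * x" by linarith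
    then show ?thesis
    proof cases
      case 1
      then have "\<bar>X 0 \<omega>\<bar> / x \<ge> 1" using x by (simp add: field_simps)
      then have "\<kappa> (X 0 \<omega> / x) = 1" unfolding \<kappa>_def ab using d by (simp add: field_simps)
      then show ?thesis using 1 sub that by (simp add: indicator_def)
    next
      case 2
      then have "\<bar>X 0 \<omega>\<bar> / x \<le> 1 - \<delta>" using x by (simp add: field_simps)
      then have "(\<bar>X 0 \<omega>\<bar> / x - (1 - \<delta>)) / \<delta> \<le> 0" using d by (intro divide_nonpos_pos) auto
      then have "\<kappa> (X 0 \<omega> / x) = 0" unfolding \<kappa>_def ab by (simp add: max_absorb1)
      then show ?thesis using 2 sub by (simp add: indicator_def)
    next
      case 3
      then show ?thesis using mult_mono[OF hD[of \<omega>] k01(2)[of "X 0 \<omega> / x"]] k01 D0 that by (simp add: indicator_def abs_mult)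
    qed
  qed
  have "\<bar>(\<integral>\<omega>. h \<omega> * \<kappa> (X 0 \<omega> / x) \<partial>M) - (\<integral>\<omega>. h \<omega> * ?i \<omega> \<partial>M)\<bar> = \<bar>\<integral>\<omega>. h \<omega> * \<kappa> (X 0 \<omega> / x) - h \<omega> * ?i \<omega> \<partial>M\<bar>"
    using i1 i2 by simp
  also have "\<dots> \<le> (\<integral>\<omega>. \<bar>h \<omega> * \<kappa> (X 0 \<omega> / x) - h \<omega> * ?i \<omega>\<bar> \<partial>M)" by (rule integral_abs_bound)
  also have "\<dots> \<le> (\<integral>\<omega>. D * (indicator ?A \<omega> - indicator ?E \<omega>) \<partial>M)"
    using i1 i2 ind pt by (intro integral_mono integrable_abs Bochner_Integration.integrable_diff integrable_mult_right) auto
  also have "\<dots> = D * (c ((1 - \<delta>) * x) - c x)" using ind by (simp add: c_def)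
  finally have main: "\<bar>(\<integral>\<omega>. h \<omega> * \<kappa> (X 0 \<omega> / x) \<partial>M) - (\<integral>\<omega>. h \<omega> * ?i \<omega> \<partial>M)\<bar> \<le> D * (c ((1 - \<delta>) * x) - c x)" .
  have "(\<integral>\<omega>. h \<omega> * \<kappa> (X 0 \<omega> / x) \<partial>M) / c x - cond_mean M (X 0) x h = ((\<integral>\<omega>. h \<omega> * \<kappa> (X 0 \<omega> / x) \<partial>M) - (\<integral>\<omega>. h \<omega> * ?i \<omega> \<partial>M)) / c x"
    by (simp add: cond_mean_def c_def diff_divide_distrib)
  also have "\<bar>\<dots>\<bar> \<le> D * (c ((1 - \<delta>) * x) - c x) / c x"
    using main pos by (simp add: divide_right_mono)
  also have "\<dots> = D * (c ((1 - \<delta>) * x) / c x - 1)" using pos by (simp add: field_simps)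
  finally show ?thesis .
qed

text \<open>Since \<open>g\<close> and its conditional mean have the same limit once the event \<open>Y j \<approx> 0\<close> is cut out
  and the indicator of \<open>|X 0| > x\<close> is smoothed, only the errors of these two changes remain.\<close>

lemma backward_limit:
  fixes Z :: "int \<Rightarrow> 'b \<Rightarrow> real"
  assumes Z[measurable]: "\<And>t. Z t \<in> borel_measurable N" and sl: "seq_limit M X Y {j..k} N Z"
    and gdep': "\<And>v w. (\<And>i. i \<in> {j - 1..k} \<Longrightarrow> v i = w i) \<Longrightarrow> g v = g w" and jk: "j \<le> k"
    and ind: "indep_rv N borel (\<lambda>\<omega>. proj {j..k} (\<lambda>i. Z i \<omega>)) (borel \<Otimes>\<^sub>M borel) (\<lambda>\<omega>. (a \<omega>, b \<omega>))"
    and rec: "AE \<omega> in N. Z (j - 1) \<omega> = tail_step (Z j \<omega>) (a \<omega>) (b \<omega>)"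
    and cpos: "\<And>x. \<P>(\<omega> in M. \<bar>X 0 \<omega>\<bar> > x) > 0"
    and crv: "\<And>u. u > 0 \<Longrightarrow> ((\<lambda>x. \<P>(\<omega> in M. \<bar>X 0 \<omega>\<bar> > u * x) / \<P>(\<omega> in M. \<bar>X 0 \<omega>\<bar> > x)) \<longlongrightarrow> u powr (-\<alpha>)) at_top"
    and C: "C > 0" and cq: "((\<lambda>x. \<P>(\<omega> in M. \<bar>X 0 \<omega>\<bar> > x) / q x) \<longlongrightarrow> C) at_top"
    and r: "filterlim r at_top sequentially"
  shows "(\<lambda>n. cond_mean M (X 0) (r n) (\<lambda>\<omega>. g (\<lambda>i. Y i \<omega> / r n))) \<longlonglongrightarrow> (\<integral>\<omega>. g (\<lambda>i. Z i \<omega>) \<partial>N)"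
proof (rule tendstoI)
  fix e :: real assume e: "e > 0"
  interpret N: prob_space N by (rule N)
  define c where "c x = \<P>(\<omega> in M. \<bar>X 0 \<omega>\<bar> > x)" for x
  have c0: "c x > 0" for x using cpos by (simp add: c_def)
  have B0: "0 \<le> B" using gB[of undefined] by linarith
  \<comment> \<open>\<open>\<tau> m\<close> is 0 up to \<open>1 / m\<close> and 1 from
    \<open>2 / m\<close> on; \<open>\<theta> m\<close> is the part cut out.\<close>
  define \<tau> where "\<tau> m w = min 1 (max 0 (real m * \<bar>w\<bar> - 1))" for m and w :: real
  define \<theta> where "\<theta> m w = 1 - \<tau> m w" for m w
  have \<tau>c: "continuous_on UNIV (\<tau> m)" for m unfolding \<tau>_def by (intro continuous_intros)
  have \<theta>c: "continuous_on UNIV (\<theta> m)" for m unfolding \<theta>_def using \<tau>c by (intro continuous_intros) auto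
  have \<tau>m: "\<tau> m \<in> borel_measurable borel" and \<theta>m: "\<theta> m \<in> borel_measurable borel" for m
    by (rule borel_measurable_continuous_onI[OF \<tau>c], rule borel_measurable_continuous_onI[OF \<theta>c])
  have \<tau>1: "\<bar>\<tau> m w\<bar> \<le> 1" and \<theta>1: "\<bar>\<theta> m w\<bar> \<le> 1" for m w by (auto simp: \<tau>_def \<theta>_def)
  have \<tau>lim: "(\<lambda>m. \<tau> m w) \<longlonglongrightarrow> 1" if "w \<noteq> 0" for w
  proof -
    obtain m0 where m0: "2 / \<bar>w\<bar> < real m0" using reals_Archimedean2 by blast
    have "\<tau> m w = 1" if "m \<ge> m0" for m
    proof -
      have "2 / \<bar>w\<bar> < real m" using m0 that by linarith
      then have "2 < real m * \<bar>w\<bar>" using \<open>w \<noteq> 0\<close> by (simp add: field_simps)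
      then show ?thesis by (simp add: \<tau>_def)
    qed
    then show ?thesis by (intro tendsto_eventually eventually_sequentiallyI[of m0]) auto
  qed
  have \<theta>lim: "(\<lambda>m. \<theta> m w) \<longlonglongrightarrow> 0" if "w \<noteq> 0" for w
    using tendsto_diff[OF tendsto_const[of 1] \<tau>lim[OF that]] by (simp add: \<theta>_def)
  \<comment> \<open>The limiting smoothing error is made smaller than \<open>e / 6\<close>. The
    shift by 2 keeps \<open>\<delta> = 1 / (l + 2)\<close> strictly below 1.\<close>
  have "(\<lambda>l. B * ((1 - 1 / real (l + 2)) powr (-\<alpha>) - 1)) \<longlonglongrightarrow> B * ((1 - 0) powr (-\<alpha>) - 1)"
  proof (intro tendsto_intros)
    show "(\<lambda>l. 1 / real (l + 2)) \<longlonglongrightarrow> 0"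
      using LIMSEQ_ignore_initial_segment[OF lim_const_over_n[of 1], of 2] by simp
  qed simp
  then have "\<forall>\<^sub>F l in sequentially. B * ((1 - 1 / real (l + 2)) powr (-\<alpha>) - 1) < e / 6"
    using e by (intro order_tendstoD) auto
  then obtain l where l: "B * ((1 - 1 / real (l + 2)) powr (-\<alpha>) - 1) < e / 6"
    by (auto simp: eventually_sequentially)
  define \<delta> where "\<delta> = 1 / real (l + 2)"
  have d: "0 < \<delta>" "\<delta> < 1" by (auto simp: \<delta>_def)
  define \<kappa> where "\<kappa> = (\<lambda>y::real. min 1 (max 0 ((\<bar>y\<bar> - (1 - \<delta>)) / \<delta>)))"
  have \<kappa>c: "continuous_on UNIV \<kappa>" unfolding \<kappa>_def using d by (intro continuous_intros) auto
  have \<kappa>1: "\<bar>\<kappa> y\<bar> \<le> 1" for y by (auto simp: \<kappa>_def)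
  have \<kappa>0: "\<kappa> 0 = 0"
  proof -
    have "(\<bar>0\<bar> - (1 - \<delta>)) / \<delta> \<le> 0" using d by (intro divide_nonpos_pos) auto
    then show ?thesis by (simp add: \<kappa>_def max_absorb1)
  qed
  have \<kappa>m: "\<kappa> \<in> borel_measurable borel" by (rule borel_measurable_continuous_onI[OF \<kappa>c])
  note kctx = \<kappa>c \<kappa>1 \<kappa>0
  define \<Lambda> where "\<Lambda> m = (\<integral>t. (\<integral>\<omega>. future_exp_lim j g \<kappa> (tail_radius \<alpha> t * M0 \<omega>, tail_radius \<alpha> t * M1 \<omega>) * \<theta> m (tail_radius \<alpha> t * M1 \<omega>) \<partial>K) \<partial>lborel)" for m
  define T where "T = (\<integral>\<omega>. g (\<lambda>i. Z i \<omega>) \<partial>N)"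
  define T\<tau> where "T\<tau> m = (\<integral>\<omega>. back_mean (proj {j..k} (\<lambda>i. Z i \<omega>)) * \<tau> m (proj {j..k} (\<lambda>i. Z i \<omega>) j) \<partial>N)" for m
  have \<Lambda>0: "\<Lambda> \<longlonglongrightarrow> 0" unfolding \<Lambda>_def by (rule cutoff_error_vanishes[OF kctx \<theta>m \<theta>1 \<theta>lim])
  have pm: "(\<lambda>\<omega>. proj {j..k} (\<lambda>i. Z i \<omega>)) \<in> borel_measurable N" by (rule measurable_proj) simp
  have bm: "(\<lambda>\<omega>. back_mean (proj {j..k} (\<lambda>i. Z i \<omega>))) \<in> borel_measurable N"
    by (rule measurable_compose[OF pm back_mean_measurable])
  have T: "T = (\<integral>\<omega>. back_mean (proj {j..k} (\<lambda>i. Z i \<omega>)) \<partial>N)"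
    unfolding T_def by (rule back_mean_integral[OF Z gdep' jk ind rec])
  have T\<tau>lim: "T\<tau> \<longlonglongrightarrow> T" unfolding T\<tau>_def T
  proof (rule integral_dominated_convergence[where w="\<lambda>_. B"])
    show "AE \<omega> in N. (\<lambda>m. back_mean (proj {j..k} (\<lambda>i. Z i \<omega>)) * \<tau> m (proj {j..k} (\<lambda>i. Z i \<omega>) j)) \<longlonglongrightarrow> back_mean (proj {j..k} (\<lambda>i. Z i \<omega>))"
    proof (rule AE_I2)
      fix \<omega>
      show "(\<lambda>m. back_mean (proj {j..k} (\<lambda>i. Z i \<omega>)) * \<tau> m (proj {j..k} (\<lambda>i. Z i \<omega>) j)) \<longlonglongrightarrow> back_mean (proj {j..k} (\<lambda>i. Z i \<omega>))"
      proof (cases "proj {j..k} (\<lambda>i. Z i \<omega>) j = 0")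
        case True
        then show ?thesis using back_mean_0[of "proj {j..k} (\<lambda>i. Z i \<omega>)"] by simp
      next
        case False
        from tendsto_mult_left[OF \<tau>lim[OF this], of "back_mean (proj {j..k} (\<lambda>i. Z i \<omega>))"] show ?thesis by simp
      qed
    qed
    show "AE \<omega> in N. norm (back_mean (proj {j..k} (\<lambda>i. Z i \<omega>)) * \<tau> m (proj {j..k} (\<lambda>i. Z i \<omega>) j)) \<le> B" for m
      using mult_mono[OF back_mean_bound \<tau>1] B0 by (simp add: abs_mult)
    show "(\<lambda>\<omega>. back_mean (proj {j..k} (\<lambda>i. Z i \<omega>)) * \<tau> m (proj {j..k} (\<lambda>i. Z i \<omega>) j)) \<in> borel_measurable N" for m
      by (intro borel_measurable_times bm measurable_compose[OF measurable_compose[OF pm measurable_coordinate] \<tau>m])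
  qed (use bm in auto)
  have "\<forall>\<^sub>F m in sequentially. \<bar>\<Lambda> m\<bar> / C < e / 6 \<and> \<bar>T\<tau> m - T\<bar> < e / 6"
  proof (rule eventually_conj)
    have "(\<lambda>m. \<bar>\<Lambda> m\<bar> / C) \<longlonglongrightarrow> \<bar>0\<bar> / C" by (intro tendsto_intros \<Lambda>0) (use C in auto)
    then show "\<forall>\<^sub>F m in sequentially. \<bar>\<Lambda> m\<bar> / C < e / 6" using e by (intro order_tendstoD) auto
    show "\<forall>\<^sub>F m in sequentially. \<bar>T\<tau> m - T\<bar> < e / 6" using tendstoD[OF T\<tau>lim, of "e/6"] e by (simp add: dist_real_def)
  qed
  then obtain m0 where m0: "\<And>m. m \<ge> m0 \<Longrightarrow> \<bar>\<Lambda> m\<bar> / C < e / 6 \<and> \<bar>T\<tau> m - T\<bar> < e / 6"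
    by (auto simp: eventually_sequentially)
  \<comment> \<open>The successor makes \<open>1 / m\<close> a genuine positive margin for the
    cutoff.\<close>
  define m where "m = Suc m0"
  have m: "\<bar>\<Lambda> m\<bar> / C < e / 6" "\<bar>T\<tau> m - T\<bar> < e / 6" using m0[of m] by (auto simp: m_def)
  have \<tau>z: "\<tau> m w = 0" if "\<bar>w\<bar> \<le> 1 / real m" for w
  proof -
    have "real m * \<bar>w\<bar> \<le> 1" using that by (simp add: m_def field_simps)
    then show ?thesis by (simp add: \<tau>_def)
  qed
  define W where "W f \<theta> x = weighted \<kappa> f \<theta> x" for f \<theta> x
  have W\<theta>: "(\<lambda>n. W g (\<theta> m) (r n) / q (r n)) \<longlonglongrightarrow> \<Lambda> m"
    unfolding W_def \<Lambda>_def by (rule weighted_limit[OF kctx \<theta>c \<theta>1 r])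
  have Wd: "(\<lambda>n. W g (\<tau> m) (r n) / q (r n) - W back_mean (\<tau> m) (r n) / q (r n)) \<longlonglongrightarrow> 0"
  proof -
    have "0 < 1 / real m" by (simp add: m_def)
    from tendsto_diff[OF weighted_limit[OF kctx \<tau>c[of m] \<tau>1 r] weighted_back_mean_limit[OF kctx \<tau>c[of m] \<tau>1 r this \<tau>z]]
    show ?thesis by (simp add: W_def)
  qed
  have cq': "(\<lambda>n. c (r n) / q (r n)) \<longlonglongrightarrow> C" using filterlim_compose[OF cq r] by (simp add: c_def)
  have qne: "q x \<noteq> 0" for x using q_pos[of x] by simp
  have lim1: "(\<lambda>n. W g (\<theta> m) (r n) / c (r n)) \<longlonglongrightarrow> \<Lambda> m / C"
    using tendsto_divide[OF W\<theta> cq'] C by (simp add: qne)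
  have lim2: "(\<lambda>n. (W g (\<tau> m) (r n) - W back_mean (\<tau> m) (r n)) / c (r n)) \<longlonglongrightarrow> 0"
    using tendsto_divide[OF Wd cq'] C by (simp add: qne diff_divide_distrib[symmetric])
  define S where "S n = cond_mean M (X 0) (r n) (\<lambda>\<omega>. back_mean (\<lambda>i. Y i \<omega> / r n) * \<tau> m (Y j \<omega> / r n))" for n
  have lim3: "S \<longlonglongrightarrow> T\<tau> m"
  proof -
    have "(\<lambda>n. cond_mean M (X 0) (r n) (\<lambda>\<omega>. (\<lambda>x v. back_mean v * \<tau> m (v j)) (r n) (proj {j..k} (\<lambda>i. Y i \<omega> / r n)))) \<longlonglongrightarrow>
        (\<integral>\<omega>. (\<lambda>v. back_mean v * \<tau> m (v j)) (proj {j..k} (\<lambda>i. Z i \<omega>)) \<partial>N)"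
    proof (rule seq_limit_ext[OF M N Xm Ym Z cpos sl _ _ _ r])
      show "cconv (\<lambda>x v. back_mean v * \<tau> m (v j)) (\<lambda>v. back_mean v * \<tau> m (v j))"
        by (intro cconv_mult back_mean_cconv cconv_compose[OF cconv_const[OF \<tau>c] cconv_coordinate])
      show "\<bar>back_mean v * \<tau> m (v j)\<bar> \<le> B" for v
        using mult_mono[OF back_mean_bound \<tau>1] B0 by (simp add: abs_mult)
      show "(\<lambda>v. back_mean v * \<tau> m (v j)) \<in> borel_measurable borel"
        by (intro borel_measurable_times back_mean_measurable measurable_compose[OF measurable_coordinate \<tau>m])
    qed
    moreover have "back_mean (proj {j..k} v) = back_mean v" for v
      by (rule back_mean_dep'[OF gdep' jk]) (auto simp: proj_def)
    moreover have "proj {j..k} v j = v j" for v using jk by (simp add: proj_def)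
    ultimately show ?thesis by (simp add: S_def[abs_def] T\<tau>_def)
  qed
  have lim4: "(\<lambda>n. B * (c ((1 - \<delta>) * r n) / c (r n) - 1)) \<longlonglongrightarrow> B * ((1 - \<delta>) powr (-\<alpha>) - 1)"
    using filterlim_compose[OF crv[of "1 - \<delta>"] r] d by (intro tendsto_intros) (simp add: c_def)
  \<comment> \<open>The error budget: two smoothings, the part of \<open>g\<close> cut out, the
    exchange of \<open>g\<close> for \<open>back_mean\<close>, the induction hypothesis, and the
    cutoff in the limit process. In the limit these amount to less than
    \<open>2/6 + 1/6 + 0 + 0 + 1/6\<close> of \<open>e\<close>.\<close>
  have "(\<lambda>n. 2 * (B * (c ((1 - \<delta>) * r n) / c (r n) - 1)) + \<bar>W g (\<theta> m) (r n) / c (r n)\<bar>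
      + \<bar>(W g (\<tau> m) (r n) - W back_mean (\<tau> m) (r n)) / c (r n)\<bar> + \<bar>S n - T\<tau> m\<bar> + \<bar>T\<tau> m - T\<bar>)
    \<longlonglongrightarrow> 2 * (B * ((1 - \<delta>) powr (-\<alpha>) - 1)) + \<bar>\<Lambda> m / C\<bar> + \<bar>0\<bar> + \<bar>T\<tau> m - T\<tau> m\<bar> + \<bar>T\<tau> m - T\<bar>"
    by (intro tendsto_add tendsto_mult tendsto_const tendsto_rabs lim1 lim2 lim4 tendsto_diff lim3)
  moreover have "2 * (B * ((1 - \<delta>) powr (-\<alpha>) - 1)) + \<bar>\<Lambda> m / C\<bar> + \<bar>0\<bar> + \<bar>T\<tau> m - T\<tau> m\<bar> + \<bar>T\<tau> m - T\<bar> < e"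
  proof -
    have "\<bar>\<Lambda> m / C\<bar> = \<bar>\<Lambda> m\<bar> / C" using C by (simp add: abs_divide)
    moreover have "B * ((1 - \<delta>) powr (-\<alpha>) - 1) < e / 6" using l by (simp only: \<delta>_def)
    ultimately show ?thesis using m e by linarith
  qed
  ultimately have ev: "\<forall>\<^sub>F n in sequentially. 2 * (B * (c ((1 - \<delta>) * r n) / c (r n) - 1)) + \<bar>W g (\<theta> m) (r n) / c (r n)\<bar>
      + \<bar>(W g (\<tau> m) (r n) - W back_mean (\<tau> m) (r n)) / c (r n)\<bar> + \<bar>S n - T\<tau> m\<bar> + \<bar>T\<tau> m - T\<bar> < e"
    by (rule order_tendstoD(2))
  have "\<forall>\<^sub>F n in sequentially. r n > 0" using r by (simp add: filterlim_at_top_dense)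
  with ev show "\<forall>\<^sub>F n in sequentially. dist (cond_mean M (X 0) (r n) (\<lambda>\<omega>. g (\<lambda>i. Y i \<omega> / r n))) (\<integral>\<omega>. g (\<lambda>i. Z i \<omega>) \<partial>N) < e"
  proof eventually_elim
    case (elim n)
    let ?x = "r n"
    have x: "?x > 0" by (rule elim)
    have ym: "(\<lambda>\<omega> i. Y i \<omega> / ?x) \<in> borel_measurable M" by (rule measurable_coordinatewise_then_product) simp
    have gYm: "(\<lambda>\<omega>. g (\<lambda>i. Y i \<omega> / ?x)) \<in> borel_measurable M" by (rule measurable_compose[OF ym gm])
    have bYm: "(\<lambda>\<omega>. back_mean (\<lambda>i. Y i \<omega> / ?x) * \<tau> m (Y j \<omega> / ?x)) \<in> borel_measurable M"
      by (intro borel_measurable_times measurable_compose[OF ym back_mean_measurable] measurable_compose[OF _ \<tau>m]) auto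
    have kXm: "(\<lambda>\<omega>. \<kappa> (X 0 \<omega> / ?x)) \<in> borel_measurable M" by (rule measurable_compose[OF _ \<kappa>m]) auto
    have s1: "\<bar>(\<integral>\<omega>. g (\<lambda>i. Y i \<omega> / ?x) * \<kappa> (X 0 \<omega> / ?x) \<partial>M) / c ?x - cond_mean M (X 0) ?x (\<lambda>\<omega>. g (\<lambda>i. Y i \<omega> / ?x))\<bar>
        \<le> B * (c ((1 - \<delta>) * ?x) / c ?x - 1)"
      using trigger_smoothing[OF d x gYm gB] c0[of ?x] unfolding \<kappa>_def c_def by simp
    have s2: "\<bar>(\<integral>\<omega>. back_mean (\<lambda>i. Y i \<omega> / ?x) * \<tau> m (Y j \<omega> / ?x) * \<kappa> (X 0 \<omega> / ?x) \<partial>M) / c ?x - S n\<bar>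
        \<le> B * (c ((1 - \<delta>) * ?x) / c ?x - 1)"
    proof -
      have "\<bar>back_mean v * \<tau> m w\<bar> \<le> B" for v w using mult_mono[OF back_mean_bound \<tau>1] B0 by (simp add: abs_mult)
      from trigger_smoothing[OF d x bYm this] show ?thesis using c0[of ?x] unfolding \<kappa>_def c_def S_def by simp
    qed
    have W2: "(\<integral>\<omega>. back_mean (\<lambda>i. Y i \<omega> / ?x) * \<tau> m (Y j \<omega> / ?x) * \<kappa> (X 0 \<omega> / ?x) \<partial>M) = W back_mean (\<tau> m) ?x"
      unfolding W_def weighted_def[OF kctx] by (intro Bochner_Integration.integral_cong) auto
    have W1: "(\<integral>\<omega>. g (\<lambda>i. Y i \<omega> / ?x) * \<kappa> (X 0 \<omega> / ?x) \<partial>M) = W g (\<theta> m) ?x + W g (\<tau> m) ?x"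
    proof -
      have i: "integrable M (\<lambda>\<omega>. g (\<lambda>i. Y i \<omega> / ?x) * \<kappa> (X 0 \<omega> / ?x) * f (Y j \<omega> / ?x))"
        if "f \<in> borel_measurable borel" "\<And>y. \<bar>f y\<bar> \<le> 1" for f :: "real \<Rightarrow> real"
      proof (rule integrable_const_bound[of _ B])
        show "AE \<omega> in M. norm (g (\<lambda>i. Y i \<omega> / ?x) * \<kappa> (X 0 \<omega> / ?x) * f (Y j \<omega> / ?x)) \<le> B"
          using mult_mono[OF g\<kappa>_bound[OF j gc gm gB \<kappa>c \<kappa>1] that(2)] B0 by (simp add: abs_mult)
        show "(\<lambda>\<omega>. g (\<lambda>i. Y i \<omega> / ?x) * \<kappa> (X 0 \<omega> / ?x) * f (Y j \<omega> / ?x)) \<in> borel_measurable M"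
          by (intro borel_measurable_times gYm kXm measurable_compose[OF _ that(1)]) auto
      qed
      have "(\<integral>\<omega>. g (\<lambda>i. Y i \<omega> / ?x) * \<kappa> (X 0 \<omega> / ?x) \<partial>M) =
        (\<integral>\<omega>. g (\<lambda>i. Y i \<omega> / ?x) * \<kappa> (X 0 \<omega> / ?x) * \<theta> m (Y j \<omega> / ?x) + g (\<lambda>i. Y i \<omega> / ?x) * \<kappa> (X 0 \<omega> / ?x) * \<tau> m (Y j \<omega> / ?x) \<partial>M)"
        by (intro Bochner_Integration.integral_cong) (auto simp: \<theta>_def algebra_simps)
      then show ?thesis unfolding W_def weighted_def[OF kctx] using i[OF \<theta>m \<theta>1] i[OF \<tau>m \<tau>1] by simp
    qed
    have "\<bar>cond_mean M (X 0) ?x (\<lambda>\<omega>. g (\<lambda>i. Y i \<omega> / ?x)) - T\<bar> < e"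
      using s1 s2 elim(1) unfolding W1 W2 add_divide_distrib diff_divide_distrib by linarith
    then show ?case by (simp add: dist_real_def T_def)
  qed
qed

end

end

lemma cond_mean_bound:
  assumes "prob_space M" and [measurable]: "X0 \<in> borel_measurable M" and D: "\<And>\<omega>. \<bar>h \<omega>\<bar> \<le> D"
    and pos: "\<P>(\<omega> in M. \<bar>X0 \<omega>\<bar> > x) > 0" and h[measurable]: "h \<in> borel_measurable M"
  shows "\<bar>cond_mean M X0 x h\<bar> \<le> D"
proof -
  interpret prob_space M by fact
  have "prob_space (uniform_measure M {\<omega> \<in> space M. \<bar>X0 \<omega>\<bar> > x})"
    using pos by (intro prob_space_uniform_measure) (auto simp: emeasure_eq_measure)
  from abs_integral_le[OF this, of h D] D show ?thesis by (simp add: integral_uniform_measure_cond_mean[OF assms(1)])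
qed

lemma cond_mean_add:
  fixes f g :: "'a \<Rightarrow> real"
  assumes "prob_space M" and [measurable]: "X0 \<in> borel_measurable M" "f \<in> borel_measurable M" "g \<in> borel_measurable M"
    and D: "\<And>\<omega>. \<bar>f \<omega>\<bar> \<le> D" "\<And>\<omega>. \<bar>g \<omega>\<bar> \<le> D'"
  shows "cond_mean M X0 x (\<lambda>\<omega>. f \<omega> + g \<omega>) = cond_mean M X0 x f + cond_mean M X0 x g"
proof -
  interpret prob_space M by fact
  have "0 \<le> D" "0 \<le> D'" using D(1)[of undefined] D(2)[of undefined] by linarith+
  then have "integrable M (\<lambda>\<omega>. f \<omega> * indicator {\<omega>. \<bar>X0 \<omega>\<bar> > x} \<omega>)" "integrable M (\<lambda>\<omega>. g \<omega> * indicator {\<omega>. \<bar>X0 \<omega>\<bar> > x} \<omega>)"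
    using D by (intro integrable_const_bound[of _ D], auto simp: indicator_def)
      (intro integrable_const_bound[of _ D'], auto simp: indicator_def)
  then show ?thesis by (simp add: cond_mean_def distrib_right add_divide_distrib)
qed

text \<open>The test function is \<open>F0 + g + d\<close>. \<open>F0\<close> puts 0 at coordinate
  \<open>j - 1\<close> and falls under the given limit on \<open>{j..k}\<close>; \<open>g\<close>
  vanishes when that coordinate is at most \<open>\<eta>\<close> in modulus and falls under
  \<open>backward_limit\<close>; \<open>d\<close> is uniformly small by the Lipschitz
  condition.\<close>

lemma (in tail_setting) backward_step:
  fixes Z :: "int \<Rightarrow> 'b \<Rightarrow> real"
  assumes N: "prob_space N" and am: "a \<in> borel_measurable N" and bm: "b \<in> borel_measurable N"
    and hA: "\<And>(f :: real \<Rightarrow> real) D. f \<in> borel_measurable borel \<Longrightarrow> (\<And>y. \<bar>f y\<bar> \<le> D) \<Longrightarrow>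
        (\<integral>\<omega>. f (a \<omega>) \<partial>N) * p = (\<integral>\<omega>. f (Mneg \<omega>) * indicator {\<omega>\<in>space K. M0 \<omega> = 1} \<omega> \<partial>K)"
    and hB: "\<And>(f :: real \<Rightarrow> real) D. f \<in> borel_measurable borel \<Longrightarrow> (\<And>y. \<bar>f y\<bar> \<le> D) \<Longrightarrow>
        (\<integral>\<omega>. f (b \<omega>) \<partial>N) * (1 - p) = (\<integral>\<omega>. f (- Mneg \<omega>) * indicator {\<omega>\<in>space K. M0 \<omega> = -1} \<omega> \<partial>K)"
    and j: "j \<le> 0" and jk: "j \<le> k"
    and Z[measurable]: "\<And>t. Z t \<in> borel_measurable N" and sl: "seq_limit M X Y {j..k} N Z"
    and ind: "indep_rv N borel (\<lambda>\<omega>. proj {j..k} (\<lambda>i. Z i \<omega>)) (borel \<Otimes>\<^sub>M borel) (\<lambda>\<omega>. (a \<omega>, b \<omega>))"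
    and rec: "AE \<omega> in N. Z (j - 1) \<omega> = tail_step (Z j \<omega>) (a \<omega>) (b \<omega>)"
    and cpos: "\<And>x. \<P>(\<omega> in M. \<bar>X 0 \<omega>\<bar> > x) > 0"
    and crv: "\<And>u. u > 0 \<Longrightarrow> ((\<lambda>x. \<P>(\<omega> in M. \<bar>X 0 \<omega>\<bar> > u * x) / \<P>(\<omega> in M. \<bar>X 0 \<omega>\<bar> > x)) \<longlongrightarrow> u powr (-\<alpha>)) at_top"
    and C: "C > 0" and cq: "((\<lambda>x. \<P>(\<omega> in M. \<bar>X 0 \<omega>\<bar> > x) / q x) \<longlongrightarrow> C) at_top"
  shows "seq_limit M X Y {j-1..k} N Z"
  unfolding seq_limit_def
proof (intro allI impI tendstoI)
  fix f :: "(int \<Rightarrow> real) \<Rightarrow> real" and L and r :: "nat \<Rightarrow> real" and e :: real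
  assume f: "L-lipschitz_on UNIV f" "bounded (range f)" and r: "filterlim r at_top sequentially" and e: "e > 0"
  interpret N: prob_space N by fact
  let ?I = "{j - 1..k}"
  obtain D where D: "\<And>v. \<bar>f v\<bar> \<le> D" using f(2) by (auto simp: bounded_iff)
  have L0: "L \<ge> 0" by (rule lipschitz_on_nonneg[OF f(1)])
  \<comment> \<open>\<open>d\<close> costs at most \<open>2 * (L * \<eta>)\<close> in each of the
    two means, together at most \<open>e / 2\<close>; \<open>L + 1\<close> excludes division by
    0.\<close>
  define \<eta> where "\<eta> = e / (8 * (L + 1))"
  have eta: "\<eta> > 0" using e L0 by (simp add: \<eta>_def)
  have etaL: "4 * (L * \<eta>) < e"
  proof -
    have "L * \<eta> \<le> (L + 1) * \<eta>" using eta by (intro mult_right_mono) auto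
    also have "(L + 1) * \<eta> = e / 8" using L0 by (simp add: \<eta>_def field_simps)
    finally show ?thesis using e by linarith
  qed
  \<comment> \<open>Soft thresholding: continuous, zero on \<open>{-\<eta>..\<eta>}\<close>, and
    within \<open>\<eta>\<close> of the identity.\<close>
  define soft where "soft u = u - max (- \<eta>) (min \<eta> u)" for u :: real
  have soft0: "soft u = 0" if "\<bar>u\<bar> \<le> \<eta>" for u using that by (auto simp: soft_def)
  have soft1: "\<bar>soft u - u\<bar> \<le> \<eta>" for u using eta by (auto simp: soft_def)
  define F where "F v = f (proj ?I v)" for v
  define Fs where "Fs v = F (v(j - 1 := soft (v (j - 1))))" for v
  define F0 where "F0 v = F (v(j - 1 := 0))" for v
  define g where "g v = Fs v - F0 v" for v
  define d where "d v = F v - Fs v" for v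
  have Fc: "cconv (\<lambda>_. F) F" unfolding F_def
    by (rule cconv_compose[OF cconv_const[OF lipschitz_on_continuous_on[OF f(1)]] cconv_const[OF continuous_proj]])
  have idc: "cconv (\<lambda>x v. v) (\<lambda>v. v :: int \<Rightarrow> real)" by (simp add: cconv_def)
  have softc: "continuous_on UNIV soft" unfolding soft_def by (intro continuous_intros)
  have Fsc: "cconv (\<lambda>_. Fs) Fs" unfolding Fs_def
    by (intro cconv_compose[OF Fc] cconv_fun_upd idc cconv_compose[OF cconv_const[OF softc] cconv_coordinate])
  have F0c: "cconv (\<lambda>_. F0) F0" unfolding F0_def
    by (intro cconv_compose[OF Fc] cconv_fun_upd idc) (simp add: cconv_def)
  have gc: "cconv (\<lambda>_. g) g"
    using Fsc F0c unfolding g_def cconv_def by (auto intro!: tendsto_diff)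
  have Fm: "F \<in> borel_measurable borel" unfolding F_def
    by (rule measurable_compose[OF borel_measurable_continuous_onI[OF continuous_proj] lipschitz_borel[OF f(1)]])
  have Fsm: "Fs \<in> borel_measurable borel" unfolding Fs_def
    by (intro measurable_compose[OF _ Fm] measurable_fun_upd_borel
        measurable_compose[OF measurable_coordinate borel_measurable_continuous_onI[OF softc]]) auto
  have F0m: "F0 \<in> borel_measurable borel" unfolding F0_def
    by (intro measurable_compose[OF _ Fm] measurable_fun_upd_borel) auto
  have gm: "g \<in> borel_measurable borel" and dm: "d \<in> borel_measurable borel"
    unfolding g_def d_def using Fsm F0m Fm by (auto intro: borel_measurable_diff)
  have FD: "\<bar>F v\<bar> \<le> D" "\<bar>Fs v\<bar> \<le> D" "\<bar>F0 v\<bar> \<le> D" for v using D by (auto simp: F_def Fs_def F0_def)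
  have gB: "\<bar>g v\<bar> \<le> 2 * D" for v using FD(2,3)[of v] by (auto simp: g_def)
  have dep: "g v = g w" if vw: "\<And>i. i \<in> ?I \<Longrightarrow> v i = w i" for v w
  proof -
    have j1: "v (j - 1) = w (j - 1)" using vw jk by auto
    have "proj ?I (v(j - 1 := c)) = proj ?I (w(j - 1 := c))" for c using vw by (auto simp: proj_def)
    then show ?thesis by (simp add: g_def Fs_def F0_def F_def j1)
  qed
  have gz: "g v = 0" if "\<bar>v (j - 1)\<bar> \<le> \<eta>" for v using soft0[OF that] by (simp add: g_def Fs_def F0_def)
  have dB: "\<bar>d v\<bar> \<le> 2 * (L * \<eta>)" for v
  proof -
    have pu: "proj ?I (v(j - 1 := c)) = (proj ?I v)(j - 1 := c)" for c using jk by (auto simp: proj_def)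
    have pj: "proj ?I v (j - 1) = v (j - 1)" using jk by (simp add: proj_def)
    have "\<bar>d v\<bar> = dist (f ((proj ?I v)(j - 1 := soft (v (j - 1))))) (f (proj ?I v))"
      by (simp add: d_def Fs_def F_def pu dist_real_def abs_minus_commute)
    also have "\<dots> \<le> L * dist ((proj ?I v)(j - 1 := soft (v (j - 1)))) (proj ?I v)"
      by (rule lipschitz_onD[OF f(1)]) auto
    also have "\<dots> \<le> L * (2 * \<bar>soft (v (j - 1)) - v (j - 1)\<bar>)"
      using dist_fun_upd[of "proj ?I v" "j - 1" "soft (v (j - 1))"] L0 by (intro mult_left_mono) (auto simp: pj)
    also have "\<dots> \<le> L * (2 * \<eta>)" using soft1 L0 by (intro mult_left_mono) auto
    finally show ?thesis by simp
  qed
  have F0eq: "F0 v = f (proj {j..k} v)" for v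
  proof -
    have "proj ?I (v(j - 1 := 0)) = proj {j..k} v" by (auto simp: proj_def)
    then show ?thesis by (simp add: F0_def F_def)
  qed
  have lim1: "(\<lambda>n. cond_mean M (X 0) (r n) (\<lambda>\<omega>. F0 (\<lambda>i. Y i \<omega> / r n))) \<longlonglongrightarrow> (\<integral>\<omega>. F0 (\<lambda>i. Z i \<omega>) \<partial>N)"
    using sl[unfolded seq_limit_def, rule_format, OF f r] by (simp add: F0eq)
  have lim2: "(\<lambda>n. cond_mean M (X 0) (r n) (\<lambda>\<omega>. g (\<lambda>i. Y i \<omega> / r n))) \<longlonglongrightarrow> (\<integral>\<omega>. g (\<lambda>i. Z i \<omega>) \<partial>N)"
  proof (rule backward_limit[OF N am bm hA hB j gc gm gB _ eta gz Z sl dep jk ind rec cpos crv C cq r])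
    show "g v = g w" if "\<And>i. j - 1 \<le> i \<Longrightarrow> v i = w i" for v w by (rule dep) (use that in auto)
  qed auto
  have zm: "(\<lambda>\<omega> i. Z i \<omega>) \<in> borel_measurable N" by (rule measurable_coordinatewise_then_product) simp
  have Nint: "integrable N (\<lambda>\<omega>. h (\<lambda>i. Z i \<omega>))" if "h \<in> borel_measurable borel" "\<And>v. \<bar>h v\<bar> \<le> E" for h :: "(int \<Rightarrow> real) \<Rightarrow> real" and E
    by (rule N.integrable_const_bound[of _ E]) (use that measurable_compose[OF zm that(1)] in auto)
  have Neq: "(\<integral>\<omega>. f (proj ?I (\<lambda>i. Z i \<omega>)) \<partial>N) = (\<integral>\<omega>. F0 (\<lambda>i. Z i \<omega>) \<partial>N) + (\<integral>\<omega>. g (\<lambda>i. Z i \<omega>) \<partial>N) + (\<integral>\<omega>. d (\<lambda>i. Z i \<omega>) \<partial>N)"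
  proof -
    have "(\<integral>\<omega>. f (proj ?I (\<lambda>i. Z i \<omega>)) \<partial>N) = (\<integral>\<omega>. F0 (\<lambda>i. Z i \<omega>) + g (\<lambda>i. Z i \<omega>) + d (\<lambda>i. Z i \<omega>) \<partial>N)"
      by (intro integral_cong_space) (simp add: g_def d_def F_def)
    then show ?thesis using Nint[OF F0m FD(3)] Nint[OF gm gB] Nint[OF dm dB] by simp
  qed
  have Nd: "\<bar>\<integral>\<omega>. d (\<lambda>i. Z i \<omega>) \<partial>N\<bar> \<le> 2 * (L * \<eta>)" by (rule abs_integral_le[OF N dB])
  have Meq: "cond_mean M (X 0) x (\<lambda>\<omega>. f (proj ?I (\<lambda>i. Y i \<omega> / x))) =
      cond_mean M (X 0) x (\<lambda>\<omega>. F0 (\<lambda>i. Y i \<omega> / x)) + cond_mean M (X 0) x (\<lambda>\<omega>. g (\<lambda>i. Y i \<omega> / x)) + cond_mean M (X 0) x (\<lambda>\<omega>. d (\<lambda>i. Y i \<omega> / x))"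
    and Md: "\<bar>cond_mean M (X 0) x (\<lambda>\<omega>. d (\<lambda>i. Y i \<omega> / x))\<bar> \<le> 2 * (L * \<eta>)" for x
  proof -
    have ym: "(\<lambda>\<omega> i. Y i \<omega> / x) \<in> borel_measurable M" by (rule measurable_coordinatewise_then_product) simp
    note ms = measurable_compose[OF ym F0m] measurable_compose[OF ym gm] measurable_compose[OF ym dm]
    have "cond_mean M (X 0) x (\<lambda>\<omega>. f (proj ?I (\<lambda>i. Y i \<omega> / x))) =
       cond_mean M (X 0) x (\<lambda>\<omega>. (F0 (\<lambda>i. Y i \<omega> / x) + g (\<lambda>i. Y i \<omega> / x)) + d (\<lambda>i. Y i \<omega> / x))"
      by (simp add: g_def d_def F_def)
    also have "\<dots> = cond_mean M (X 0) x (\<lambda>\<omega>. F0 (\<lambda>i. Y i \<omega> / x) + g (\<lambda>i. Y i \<omega> / x)) + cond_mean M (X 0) x (\<lambda>\<omega>. d (\<lambda>i. Y i \<omega> / x))"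
    proof (rule cond_mean_add[OF M Xm _ ms(3) _ dB])
      show "\<bar>F0 (\<lambda>i. Y i \<omega> / x) + g (\<lambda>i. Y i \<omega> / x)\<bar> \<le> 3 * D" for \<omega>
        using FD(3)[of "\<lambda>i. Y i \<omega> / x"] gB[of "\<lambda>i. Y i \<omega> / x"] by linarith
    qed (intro borel_measurable_add ms)
    also have "cond_mean M (X 0) x (\<lambda>\<omega>. F0 (\<lambda>i. Y i \<omega> / x) + g (\<lambda>i. Y i \<omega> / x)) =
       cond_mean M (X 0) x (\<lambda>\<omega>. F0 (\<lambda>i. Y i \<omega> / x)) + cond_mean M (X 0) x (\<lambda>\<omega>. g (\<lambda>i. Y i \<omega> / x))"
      by (rule cond_mean_add[OF M Xm ms(1,2) FD(3) gB])
    finally show "cond_mean M (X 0) x (\<lambda>\<omega>. f (proj ?I (\<lambda>i. Y i \<omega> / x))) =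
      cond_mean M (X 0) x (\<lambda>\<omega>. F0 (\<lambda>i. Y i \<omega> / x)) + cond_mean M (X 0) x (\<lambda>\<omega>. g (\<lambda>i. Y i \<omega> / x)) + cond_mean M (X 0) x (\<lambda>\<omega>. d (\<lambda>i. Y i \<omega> / x))" .
    show "\<bar>cond_mean M (X 0) x (\<lambda>\<omega>. d (\<lambda>i. Y i \<omega> / x))\<bar> \<le> 2 * (L * \<eta>)"
      by (rule cond_mean_bound[OF M Xm dB cpos ms(3)])
  qed
  have "\<forall>\<^sub>F n in sequentially. dist (cond_mean M (X 0) (r n) (\<lambda>\<omega>. F0 (\<lambda>i. Y i \<omega> / r n)) + cond_mean M (X 0) (r n) (\<lambda>\<omega>. g (\<lambda>i. Y i \<omega> / r n)))
     ((\<integral>\<omega>. F0 (\<lambda>i. Z i \<omega>) \<partial>N) + (\<integral>\<omega>. g (\<lambda>i. Z i \<omega>) \<partial>N)) < e - 4 * (L * \<eta>)"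
    using etaL by (intro tendstoD[OF tendsto_add[OF lim1 lim2]]) simp
  then show "\<forall>\<^sub>F n in sequentially. dist (cond_mean M (X 0) (r n) (\<lambda>\<omega>. f (proj ?I (\<lambda>i. Y i \<omega> / r n))))
     (\<integral>\<omega>. f (proj ?I (\<lambda>i. Z i \<omega>)) \<partial>N) < e"
  proof eventually_elim
    case (elim n)
    then show ?case using Md[of "r n"] Nd unfolding Meq Neq dist_real_def by linarith
  qed
qed

section \<open>The limit theorem\<close>

text \<open>Multiplied by the probability of the conditioning event, the identities hold also for a
  null event, where both sides are 0. On \<open>M0 = \<sigma>\<close> the ratio
  \<open>M' / M0\<close> is \<open>\<sigma> * M'\<close>.\<close>

lemma ratio_laws_integral:
  fixes f :: "real \<Rightarrow> real"
  assumes N: "prob_space N" and K: "prob_space K" and rl: "ratio_laws N A B K M0 M'"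
    and M0[measurable]: "M0 \<in> borel_measurable K" and M'[measurable]: "M' \<in> borel_measurable K"
    and f[measurable]: "f \<in> borel_measurable borel" and D: "\<And>y. \<bar>f y\<bar> \<le> D"
  shows "(\<integral>\<omega>. f (A \<omega>) \<partial>N) * \<P>(\<omega> in K. M0 \<omega> = 1) = (\<integral>\<omega>. f (M' \<omega>) * indicator {\<omega>\<in>space K. M0 \<omega> = 1} \<omega> \<partial>K)"
    and "(\<integral>\<omega>. f (B \<omega>) \<partial>N) * \<P>(\<omega> in K. M0 \<omega> = -1) = (\<integral>\<omega>. f (- M' \<omega>) * indicator {\<omega>\<in>space K. M0 \<omega> = -1} \<omega> \<partial>K)"
proof -
  interpret K: prob_space K by fact
  interpret N: prob_space N by fact
  have ABm: "A \<in> borel_measurable N" "B \<in> borel_measurable N"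
    using rl unfolding ratio_laws_def N.indep_var_eq by auto
  have gen: "(\<integral>\<omega>. f (V \<omega>) \<partial>N) * \<P>(\<omega> in K. M0 \<omega> = \<sigma>) = (\<integral>\<omega>. f (\<sigma> * M' \<omega>) * indicator {\<omega>\<in>space K. M0 \<omega> = \<sigma>} \<omega> \<partial>K)"
    if V: "V \<in> borel_measurable N" and \<sigma>: "\<sigma> = 1 \<or> \<sigma> = -1"
      and law: "\<P>(\<omega> in K. M0 \<omega> = \<sigma>) > 0 \<longrightarrow> distr N borel V = cond_law K {\<omega> \<in> space K. M0 \<omega> = \<sigma>} borel (\<lambda>\<omega>. M' \<omega> / M0 \<omega>)"
    for V :: "'a \<Rightarrow> real" and \<sigma>
  proof (cases "\<P>(\<omega> in K. M0 \<omega> = \<sigma>) > 0")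
    case True
    have "(\<integral>\<omega>. f (V \<omega>) \<partial>N) = (\<integral>z. f z \<partial>distr N borel V)" by (rule integral_distr[symmetric]) (use V in auto)
    also have "\<dots> = (\<integral>z. f z \<partial>distr (uniform_measure K {\<omega> \<in> space K. M0 \<omega> = \<sigma>}) borel (\<lambda>\<omega>. M' \<omega> / M0 \<omega>))"
      using law True by (simp add: cond_law_def)
    also have "\<dots> = (\<integral>\<omega>. f (M' \<omega> / M0 \<omega>) \<partial>uniform_measure K {\<omega> \<in> space K. M0 \<omega> = \<sigma>})"
      by (rule integral_distr) (auto simp: measurable_cong_sets[OF sets_uniform_measure refl])
    also have "\<dots> = (\<integral>\<omega>. f (M' \<omega> / M0 \<omega>) * indicator {\<omega> \<in> space K. M0 \<omega> = \<sigma>} \<omega> \<partial>K) / \<P>(\<omega> in K. M0 \<omega> = \<sigma>)"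
      by (rule integral_uniform_measure_real) (auto simp: K.emeasure_eq_measure)
    also have "(\<integral>\<omega>. f (M' \<omega> / M0 \<omega>) * indicator {\<omega> \<in> space K. M0 \<omega> = \<sigma>} \<omega> \<partial>K) = (\<integral>\<omega>. f (\<sigma> * M' \<omega>) * indicator {\<omega>\<in>space K. M0 \<omega> = \<sigma>} \<omega> \<partial>K)"
      using \<sigma> by (intro integral_cong_space) (auto simp: indicator_def)
    finally show ?thesis using True by simp
  next
    case False
    then have 0: "\<P>(\<omega> in K. M0 \<omega> = \<sigma>) = 0" by (simp add: zero_less_measure_iff)
    have "{\<omega>\<in>space K. M0 \<omega> = \<sigma>} \<in> null_sets K" using 0 by (simp add: null_sets_def K.emeasure_eq_measure)
    from AE_not_in[OF this] have "AE \<omega> in K. f (\<sigma> * M' \<omega>) * indicator {\<omega>\<in>space K. M0 \<omega> = \<sigma>} \<omega> = 0"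
      by eventually_elim (auto simp: indicator_def)
    then have "(\<integral>\<omega>. f (\<sigma> * M' \<omega>) * indicator {\<omega>\<in>space K. M0 \<omega> = \<sigma>} \<omega> \<partial>K) = 0"
      by (rule integral_eq_zero_AE)
    then show ?thesis using 0 by simp
  qed
  show "(\<integral>\<omega>. f (A \<omega>) \<partial>N) * \<P>(\<omega> in K. M0 \<omega> = 1) = (\<integral>\<omega>. f (M' \<omega>) * indicator {\<omega>\<in>space K. M0 \<omega> = 1} \<omega> \<partial>K)"
    using gen[OF ABm(1), of 1] rl by (simp add: ratio_laws_def)
  show "(\<integral>\<omega>. f (B \<omega>) \<partial>N) * \<P>(\<omega> in K. M0 \<omega> = -1) = (\<integral>\<omega>. f (- M' \<omega>) * indicator {\<omega>\<in>space K. M0 \<omega> = -1} \<omega> \<partial>K)"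
    using gen[OF ABm(2), of "-1"] rl by (simp add: ratio_laws_def)
qed

lemma integral_pair_law:
  fixes f :: "real \<Rightarrow> real"
  assumes eq: "distr N (borel \<Otimes>\<^sub>M borel) (\<lambda>\<omega>. (A \<omega>, B \<omega>)) = distr N (borel \<Otimes>\<^sub>M borel) (\<lambda>\<omega>. (A' \<omega>, B' \<omega>))"
    and [measurable]: "A \<in> borel_measurable N" "B \<in> borel_measurable N" "A' \<in> borel_measurable N" "B' \<in> borel_measurable N"
    and [measurable]: "f \<in> borel_measurable borel"
  shows "(\<integral>\<omega>. f (A \<omega>) \<partial>N) = (\<integral>\<omega>. f (A' \<omega>) \<partial>N)" "(\<integral>\<omega>. f (B \<omega>) \<partial>N) = (\<integral>\<omega>. f (B' \<omega>) \<partial>N)"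
proof -
  have *: "(\<integral>z. h z \<partial>distr N (borel \<Otimes>\<^sub>M borel) (\<lambda>\<omega>. (U \<omega>, V \<omega>))) = (\<integral>\<omega>. h (U \<omega>, V \<omega>) \<partial>N)"
    if "h \<in> borel_measurable (borel \<Otimes>\<^sub>M borel)" "U \<in> borel_measurable N" "V \<in> borel_measurable N"
    for h :: "real \<times> real \<Rightarrow> real" and U V by (rule integral_distr) (use that in auto)
  have m: "(\<lambda>z. f (fst z)) \<in> borel_measurable (borel \<Otimes>\<^sub>M borel)" "(\<lambda>z. f (snd z)) \<in> borel_measurable (borel \<Otimes>\<^sub>M borel)"
    by measurable
  show "(\<integral>\<omega>. f (A \<omega>) \<partial>N) = (\<integral>\<omega>. f (A' \<omega>) \<partial>N)" using *[OF m(1), of A B] *[OF m(1), of A' B'] eq by simp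
  show "(\<integral>\<omega>. f (B \<omega>) \<partial>N) = (\<integral>\<omega>. f (B' \<omega>) \<partial>N)" using *[OF m(2), of A B] *[OF m(2), of A' B'] eq by simp
qed

lemma stationary_marginal:
  assumes "stationary M Z"
  shows "distr M borel (Z t) = distr M borel (Z 0)"
proof -
  have m: "vec_of UNIV W \<in> measurable M (PiM UNIV (\<lambda>_. borel))" if "\<And>t. W t \<in> borel_measurable M" for W :: "int \<Rightarrow> 'a \<Rightarrow> real"
    unfolding vec_of_def[abs_def] by (intro measurable_restrict that)
  have c: "(\<lambda>v. v 0) \<in> measurable (PiM (UNIV :: int set) (\<lambda>_. borel)) (borel :: real measure)"
    by (rule measurable_component_singleton) simp
  have *: "distr (law_vec M UNIV W) borel (\<lambda>v. v 0) = distr M borel (W 0)" if "\<And>t. W t \<in> borel_measurable M" for W :: "int \<Rightarrow> 'a \<Rightarrow> real"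
    unfolding law_vec_def using c m[OF that] by (subst distr_distr) (auto simp: o_def vec_of_def)
  have "law_vec M UNIV (\<lambda>i. Z (i + t)) = law_vec M UNIV Z" using assms by (auto simp: stationary_def)
  then show ?thesis using *[of "\<lambda>i. Z (i + t)"] *[of Z] assms by (simp add: stationary_def)
qed

text \<open>On \<open>M0 = \<sigma>\<close> the product \<open>\<sigma> * M1\<close> is
  \<open>\<phi> (\<epsilon>Y \<omega>) \<sigma>\<close>, since the square of \<open>\<sigma>\<close>
  is 1; and \<open>\<epsilon>Y\<close> is independent of \<open>M0\<close> with the law of any
  innovation.\<close>

lemma (in tail_setting) forward_ratio_integral:
  fixes f :: "real \<Rightarrow> real"
  assumes \<sigma>: "\<sigma> = 1 \<or> \<sigma> = -1" and f: "f \<in> borel_measurable borel" and D: "\<And>y. \<bar>f y\<bar> \<le> D"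
  shows "(\<integral>\<omega>. f (\<sigma> * M1 \<omega>) * indicator {\<omega>\<in>space K. M0 \<omega> = \<sigma>} \<omega> \<partial>K) =
    (\<integral>\<omega>. f (\<phi> (\<epsilon> t \<omega>) \<sigma>) \<partial>M) * \<P>(\<omega> in K. M0 \<omega> = \<sigma>)"
proof -
  interpret K: prob_space K by (rule K)
  have D0: "0 \<le> D" using D[of 0] by linarith
  define h where "h z = f (\<phi> (snd z) \<sigma>) * indicator {\<sigma>} (fst z)" for z :: "real \<times> 's"
  have \<phi>m: "(\<lambda>c. \<phi> c \<sigma>) \<in> borel_measurable borel" using \<sigma> \<phi>_measurable by auto
  have hm: "h \<in> borel_measurable (borel \<Otimes>\<^sub>M borel)"
    unfolding h_def
    by (intro borel_measurable_times measurable_compose[OF _ f] measurable_compose[OF measurable_snd \<phi>m]) auto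
  have "(\<integral>\<omega>. f (\<sigma> * M1 \<omega>) * indicator {\<omega>\<in>space K. M0 \<omega> = \<sigma>} \<omega> \<partial>K) = (\<integral>\<omega>. h (M0 \<omega>, \<epsilon>Y \<omega>) \<partial>K)"
  proof (rule integral_cong_AE)
    have "(\<lambda>\<omega>. f (\<sigma> * M1 \<omega>)) \<in> borel_measurable K" by (rule measurable_compose[OF _ f]) simp
    then show "(\<lambda>\<omega>. f (\<sigma> * M1 \<omega>) * indicator {\<omega>\<in>space K. M0 \<omega> = \<sigma>} \<omega>) \<in> borel_measurable K" by measurable
    show "(\<lambda>\<omega>. h (M0 \<omega>, \<epsilon>Y \<omega>)) \<in> borel_measurable K" by (rule measurable_compose[OF _ hm]) simp
    show "AE \<omega> in K. f (\<sigma> * M1 \<omega>) * indicator {\<omega>\<in>space K. M0 \<omega> = \<sigma>} \<omega> = h (M0 \<omega>, \<epsilon>Y \<omega>)"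
      using M1_eq AE_space by eventually_elim (use \<sigma> in \<open>auto simp: h_def indicator_def sign_ge_def\<close>)
  qed
  also have "\<dots> = (\<integral>\<omega>. (\<integral>\<omega>'. h (M0 \<omega>, \<epsilon>Y \<omega>') \<partial>K) \<partial>K)"
    by (rule indep_rv_integral[OF K M0_\<epsilon>Y hm, where B=D]) (use D D0 in \<open>auto simp: h_def indicator_def\<close>)
  also have "\<dots> = (\<integral>\<omega>. (\<integral>\<omega>'. f (\<phi> (\<epsilon>Y \<omega>') \<sigma>) \<partial>K) * indicator {\<omega>\<in>space K. M0 \<omega> = \<sigma>} \<omega> \<partial>K)"
    by (rule integral_cong_space) (auto simp: h_def indicator_def)
  also have "\<dots> = (\<integral>\<omega>'. f (\<phi> (\<epsilon>Y \<omega>') \<sigma>) \<partial>K) * \<P>(\<omega> in K. M0 \<omega> = \<sigma>)" by simp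
  also have "(\<integral>\<omega>'. f (\<phi> (\<epsilon>Y \<omega>') \<sigma>) \<partial>K) = (\<integral>\<omega>. f (\<phi> (\<epsilon> t \<omega>) \<sigma>) \<partial>M)"
    by (rule integral_eps[of "\<lambda>c. f (\<phi> c \<sigma>)"]) (rule measurable_compose[OF \<phi>m f])
  finally show ?thesis .
qed

text \<open>As \<open>C > 0\<close>, the tails of \<open>|X 0|\<close> and \<open>|Y 0|\<close> are
  comparable. A sign without weight in the tail of \<open>Y\<close> is therefore negligible relative
  to the conditioning event too, at every time by stationarity.\<close>

lemma (in tail_setting) relative_tail_zero:
  assumes cond: "((\<lambda>x. \<P>(\<omega> in M. \<bar>X 0 \<omega>\<bar> > x) / q x) \<longlongrightarrow> C) at_top" "C > 0" and u: "u > 0"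
  shows "p = 0 \<Longrightarrow> ((\<lambda>x. \<P>(\<omega> in M. 1 * Y t \<omega> > u * x) / \<P>(\<omega> in M. \<bar>X 0 \<omega>\<bar> > x)) \<longlongrightarrow> 0) at_top"
    and "p = 1 \<Longrightarrow> ((\<lambda>x. \<P>(\<omega> in M. (-1) * Y t \<omega> > u * x) / \<P>(\<omega> in M. \<bar>X 0 \<omega>\<bar> > x)) \<longlongrightarrow> 0) at_top"
proof -
  have e: "\<P>(\<omega> in M. Y t \<omega> \<in> S) = \<P>(\<omega> in M. Y 0 \<omega> \<in> S)" if "S \<in> sets borel" for S
  proof -
    have "measure (distr M borel (Y t)) S = measure (distr M borel (Y 0)) S" by (simp only: Ydist[of t])
    then show ?thesis using that by (simp add: measure_distr vimage_def Int_def conj_commute)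
  qed
  have e1: "\<P>(\<omega> in M. 1 * Y t \<omega> > y) = \<P>(\<omega> in M. Y 0 \<omega> > y)" for y using e[of "{y<..}"] by simp
  have e2: "\<P>(\<omega> in M. (-1) * Y t \<omega> > y) = \<P>(\<omega> in M. - Y 0 \<omega> > y)" for y
  proof -
    have "{z. y < - z} = {..< - y}" by auto
    then show ?thesis using e[of "{..< - y}"] by (simp add: less_minus_iff)
  qed
  have cancel: "(a / q x) / (b / q x) = a / b" for a b x using q_pos[of x] by simp
  show "((\<lambda>x. \<P>(\<omega> in M. 1 * Y t \<omega> > u * x) / \<P>(\<omega> in M. \<bar>X 0 \<omega>\<bar> > x)) \<longlongrightarrow> 0) at_top" if "p = 0"
    using tendsto_divide[OF regularly_varying_tails_upper[OF M Ym Yrv u, folded q_def] cond(1)] cond(2) that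
    unfolding e1 cancel by simp
  show "((\<lambda>x. \<P>(\<omega> in M. (-1) * Y t \<omega> > u * x) / \<P>(\<omega> in M. \<bar>X 0 \<omega>\<bar> > x)) \<longlongrightarrow> 0) at_top" if "p = 1"
    using tendsto_divide[OF regularly_varying_tails_lower[OF M Ym Yrv u, folded q_def] cond(1)] cond(2) that
    unfolding e2 cancel by simp
qed

theorem proposition4p1:
  fixes M :: "'a measure" and N :: "'b measure" and K :: "'c measure"
    and \<epsilon> :: "int \<Rightarrow> 'a \<Rightarrow> 's :: {metric_space, second_countable_topology}"
    and X Y :: "int \<Rightarrow> 'a \<Rightarrow> real"
    and \<Phi> :: "real \<Rightarrow> 's \<Rightarrow> real" and \<Psi> :: "real \<Rightarrow> (nat \<Rightarrow> 's) \<Rightarrow> real"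
    and \<phi> :: "'s \<Rightarrow> real \<Rightarrow> real" and \<psi> :: "(nat \<Rightarrow> 's) \<Rightarrow> real \<Rightarrow> real"
    and s m n :: nat and \<alpha> p p' C :: real
    and M0 M1 Mneg :: "'c \<Rightarrow> real" and \<epsilon>Y :: "'c \<Rightarrow> 's"
    and YX A B :: "int \<Rightarrow> 'b \<Rightarrow> real"
  assumes "prob_space M" and "prob_space N" and "prob_space K"
    and "s \<ge> 1"
    \<comment> \<open>the time series\<close>
    and \<epsilon>: "iid M \<epsilon>"
    and \<Phi>: "case_prod \<Phi> \<in> borel_measurable (borel \<Otimes>\<^sub>M borel)"
    and \<Psi>: "case_prod \<Psi> \<in> borel_measurable (borel \<Otimes>\<^sub>M PiM {1..s} (\<lambda>_. borel))"
    and Y_stationary: "stationary M Y" and X_stationary: "stationary M X"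
    and Y: "\<And>t. AE \<omega> in M. Y t \<omega> = \<Phi> (Y (t - 1) \<omega>) (\<epsilon> t \<omega>)"
    and X: "\<And>t. AE \<omega> in M. X t \<omega> = \<Psi> (Y t \<omega>) (\<lambda>i\<in>{1..s}. \<epsilon> (t + int i) \<omega>)"
    and innovations: "\<And>r. indep_rv M (PiM {r<..} (\<lambda>_. borel)) (vec_of {r<..} \<epsilon>)
                                     (PiM {..r} (\<lambda>_. borel)) (vec_of {..r} Y)"
    \<comment> \<open>Condition 1\<close>
    and "\<alpha> > 0" and "p \<in> {0..1}" and "p' \<in> {0..1}" and "C > 0"
    and cond_1a: "regularly_varying_tails M (Y 0) \<alpha> p"
    and cond_1b: "regularly_varying_tails M (X 0) \<alpha> p'"
    and cond_1c: "((\<lambda>x. \<P>(\<omega> in M. \<bar>X 0 \<omega>\<bar> > x) / \<P>(\<omega> in M. \<bar>Y 0 \<omega>\<bar> > x)) \<longlongrightarrow> C) at_top"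
    \<comment> \<open>Condition 2\<close>
    and cond_2a: "asymptotically_homogeneous euclidean \<Phi> \<phi>"
    and cond_2b: "asymptotically_homogeneous (product_topology (\<lambda>_. euclidean) {1..s}) \<Psi> \<psi>"
    \<comment> \<open>Condition 3\<close>
    and YX: "\<And>t. YX t \<in> borel_measurable N"
    and cond_3: "exceedance_limit M X Y {0..int s} N YX"
    \<comment> \<open>the laws of \<open>(A 1, B 1)\<close> and \<open>(A (-1), B (-1))\<close>\<close>
    and M0_\<epsilon>Y: "indep_rv K borel M0 borel \<epsilon>Y"
    and M0: "\<P>(\<omega> in K. M0 \<omega> = 1) = p" "\<P>(\<omega> in K. M0 \<omega> = -1) = 1 - p"
    and \<epsilon>Y: "distr K borel \<epsilon>Y = distr M borel (\<epsilon> 1)"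
    and M1: "M1 \<in> borel_measurable K" "AE \<omega> in K. M1 \<omega> = M0 \<omega> * \<phi> (\<epsilon>Y \<omega>) (sign_ge (M0 \<omega>))"
    and Mneg: "Mneg \<in> borel_measurable K" "adjoint_law K \<alpha> M0 M1 Mneg"
    and AB_forward: "ratio_laws N (A 1) (B 1) K M0 M1"
    and AB_backward: "ratio_laws N (A (-1)) (B (-1)) K M0 Mneg"
    \<comment> \<open>the limit process\<close>
    and AB_indep: "prob_space.indep_vars N (\<lambda>_. borel \<Otimes>\<^sub>M borel) (\<lambda>t \<omega>. (A t \<omega>, B t \<omega>)) (- {0})"
    and AB_YX_indep: "indep_rv N
          (PiM (- {0}) (\<lambda>_. borel \<Otimes>\<^sub>M borel)) (vec_of (- {0}) (\<lambda>t \<omega>. (A t \<omega>, B t \<omega>)))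
          (PiM {0..int s} (\<lambda>_. borel)) (vec_of {0..int s} YX)"
    and AB_pos: "\<And>t. t \<ge> 1 \<Longrightarrow> distr N (borel \<Otimes>\<^sub>M borel) (\<lambda>\<omega>. (A t \<omega>, B t \<omega>)) =
                                distr N (borel \<Otimes>\<^sub>M borel) (\<lambda>\<omega>. (A 1 \<omega>, B 1 \<omega>))"
    and AB_neg: "\<And>t. t \<le> -1 \<Longrightarrow> distr N (borel \<Otimes>\<^sub>M borel) (\<lambda>\<omega>. (A t \<omega>, B t \<omega>)) =
                                 distr N (borel \<Otimes>\<^sub>M borel) (\<lambda>\<omega>. (A (-1) \<omega>, B (-1) \<omega>))"
    and YX_forward: "\<And>t. t > int s \<Longrightarrow>
          AE \<omega> in N. YX t \<omega> = tail_step (YX (t - 1) \<omega>) (A t \<omega>) (B t \<omega>)"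
    and YX_backward: "\<And>t. t > 0 \<Longrightarrow>
          AE \<omega> in N. YX (- t) \<omega> = tail_step (YX (- t + 1) \<omega>) (A (- t) \<omega>) (B (- t) \<omega>)"
  shows "exceedance_limit M X Y {- int m..int s + int n} N YX"
proof -
  note M = assms(1) and N = assms(2) and K = assms(3)
  have Ym: "Y t \<in> borel_measurable M" and Xm: "X t \<in> borel_measurable M" for t
    using Y_stationary X_stationary by (auto simp: stationary_def)
  interpret T: tail_setting M \<epsilon> X Y \<Phi> \<Psi> \<phi> \<psi> s K M0 M1 Mneg \<epsilon>Y \<alpha> p
  proof (intro tail_setting.intro innovation_series.intro tail_setting_axioms.intro)
    show "AE \<omega> in M. X 0 \<omega> = \<Psi> (Y 0 \<omega>) (\<lambda>i\<in>{1..s}. \<epsilon> (int i) \<omega>)" using X[of 0] by simp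
    show "distr M borel (Y t) = distr M borel (Y 0)" for t by (rule stationary_marginal[OF Y_stationary])
  qed (fact Ym Xm assms)+
  interpret N: prob_space N by fact
  have M0m: "M0 \<in> borel_measurable K" by (rule T.M0_measurable)
  have cpos: "\<P>(\<omega> in M. \<bar>X 0 \<omega>\<bar> > x) > 0" for x by (rule regularly_varying_tails_pos[OF M Xm cond_1b])
  have crv: "((\<lambda>x. \<P>(\<omega> in M. \<bar>X 0 \<omega>\<bar> > u * x) / \<P>(\<omega> in M. \<bar>X 0 \<omega>\<bar> > x)) \<longlongrightarrow> u powr (-\<alpha>)) at_top" if "u > 0" for u
    using cond_1b that by (simp add: regularly_varying_tails_def)
  have cq: "((\<lambda>x. \<P>(\<omega> in M. \<bar>X 0 \<omega>\<bar> > x) / T.q x) \<longlongrightarrow> C) at_top" using cond_1c by (simp add: T.q_def)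
  have ABm: "A t \<in> borel_measurable N" "B t \<in> borel_measurable N" if "t \<noteq> 0" for t
  proof -
    have "(\<lambda>\<omega>. (A t \<omega>, B t \<omega>)) \<in> measurable N (borel \<Otimes>\<^sub>M borel)"
      using AB_indep that by (simp add: N.indep_vars_def)
    from measurable_compose[OF this measurable_fst] measurable_compose[OF this measurable_snd]
    show "A t \<in> borel_measurable N" "B t \<in> borel_measurable N" by simp_all
  qed
  have outside: "indep_outside N YX A B {- int i..int s + int k}" for i k
    by (rule indep_outside_interval[OF N YX AB_indep AB_YX_indep YX_forward YX_backward])
  \<comment> \<open>The interval is extended to the right first: \<open>forward_step\<close> is tied
    to the left end 0, whereas \<open>backward_step\<close> accepts any right end.\<close>
  have forward: "seq_limit M X Y {0..int s + int i} N YX" for i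
  proof (induction i)
    case 0
    show ?case using cond_3 exceedance_limit_iff_seq_limit[where M=M and N=N and X=X and Y=Y and Z=YX, OF M N Xm Ym YX cpos] by simp
  next
    case (Suc i)
    define k where "k = int s + int i"
    have k: "int s \<le> k" "k + 1 > int s" "k + 1 \<ge> 1" "k + 1 \<noteq> 0" "k \<in> {0..k}" "k + 1 \<notin> {0..k}" by (auto simp: k_def)
    have kS: "{0..int s + int (Suc i)} = {0..k+1}" by (auto simp: k_def)
    have sl: "seq_limit M X Y {0..k} N YX" using Suc by (simp add: k_def)
    have "indep_outside N YX A B {0..k}" using outside[of 0 i] by (simp add: k_def)
    from indep_outside_coordinate[OF N this k(6)]
    have ind: "indep_rv N borel (\<lambda>\<omega>. proj {0..k} (\<lambda>i. YX i \<omega>)) (borel \<Otimes>\<^sub>M borel) (\<lambda>\<omega>. (A (k+1) \<omega>, B (k+1) \<omega>))" .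
    have one: "(1::int) \<noteq> 0" by simp
    have law: "(\<integral>\<omega>. f (A (k+1) \<omega>) \<partial>N) = (\<integral>\<omega>. f (A 1 \<omega>) \<partial>N)" "(\<integral>\<omega>. f (B (k+1) \<omega>) \<partial>N) = (\<integral>\<omega>. f (B 1 \<omega>) \<partial>N)"
      if "f \<in> borel_measurable borel" for f :: "real \<Rightarrow> real"
      by (rule integral_pair_law[OF AB_pos[OF k(3)] ABm[OF k(4)] ABm[OF one] that])+
    show ?case unfolding kS
    proof (rule T.forward_step[OF N YX cpos sl k(1) ind])
      show "AE \<omega> in N. YX (k + 1) \<omega> = tail_step (YX k \<omega>) (A (k+1) \<omega>) (B (k+1) \<omega>)"
        using YX_forward[OF k(2)] by simp
      show "(AE \<omega> in N. YX k \<omega> \<le> 0) \<or> (\<forall>(g :: real \<Rightarrow> real) D. g \<in> borel_measurable borel \<longrightarrow> (\<forall>y. \<bar>g y\<bar> \<le> D) \<longrightarrow>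
        (\<integral>\<omega>. g (A (k + 1) \<omega>) \<partial>N) = (\<integral>\<omega>. g (\<phi> (\<epsilon> (k + 1) \<omega>) 1) \<partial>M))"
      \<comment> \<open>For \<open>p = 0\<close> the law of \<open>A\<close> is unspecified, but
        then the limit coordinate at \<open>k\<close> is almost surely not positive. For other
        \<open>p\<close>, division by \<open>p\<close> gives the law of the multiplier.\<close>
      proof (cases "p = 0")
        case True
        have "AE \<omega> in N. 1 * YX k \<omega> \<le> 0"
          by (rule limit_coordinate_nonpos[where M=M and X=X and Y=Y, OF M N Xm Ym YX cpos sl k(5)])
            (rule T.relative_tail_zero(1)[OF cq assms(16) _ True])
        then show ?thesis by simp
      next
        case False
        have "(\<integral>\<omega>. g (A (k + 1) \<omega>) \<partial>N) = (\<integral>\<omega>. g (\<phi> (\<epsilon> (k + 1) \<omega>) 1) \<partial>M)"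
          if g: "g \<in> borel_measurable borel" "\<forall>y. \<bar>g y\<bar> \<le> D" for g :: "real \<Rightarrow> real" and D
          using ratio_laws_integral(1)[OF N K AB_forward M0m M1(1) g(1) g(2)[rule_format]]
            T.forward_ratio_integral[of 1 g D "k+1"] g law(1)[OF g(1)] False M0(1) by simp
        then show ?thesis by blast
      qed
      show "(AE \<omega> in N. YX k \<omega> \<ge> 0) \<or> (\<forall>(g :: real \<Rightarrow> real) D. g \<in> borel_measurable borel \<longrightarrow> (\<forall>y. \<bar>g y\<bar> \<le> D) \<longrightarrow>
        (\<integral>\<omega>. g (B (k + 1) \<omega>) \<partial>N) = (\<integral>\<omega>. g (\<phi> (\<epsilon> (k + 1) \<omega>) (-1)) \<partial>M))"
      proof (cases "p = 1")
        case True
        have "AE \<omega> in N. (-1) * YX k \<omega> \<le> 0"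
          by (rule limit_coordinate_nonpos[where M=M and X=X and Y=Y, OF M N Xm Ym YX cpos sl k(5)])
            (rule T.relative_tail_zero(2)[OF cq assms(16) _ True])
        then show ?thesis by simp
      next
        case False
        have "(\<integral>\<omega>. g (B (k + 1) \<omega>) \<partial>N) = (\<integral>\<omega>. g (\<phi> (\<epsilon> (k + 1) \<omega>) (-1)) \<partial>M)"
          if g: "g \<in> borel_measurable borel" "\<forall>y. \<bar>g y\<bar> \<le> D" for g :: "real \<Rightarrow> real" and D
          using ratio_laws_integral(2)[OF N K AB_forward M0m M1(1) g(1) g(2)[rule_format]]
            T.forward_ratio_integral[of "-1" g D "k+1"] g law(2)[OF g(1)] False M0(2) by simp
        then show ?thesis by blast
      qed
    qed
  qed
  have "seq_limit M X Y {- int i..int s + int n} N YX" for i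
  proof (induction i)
    case 0
    show ?case using forward[of n] by simp
  next
    case (Suc i)
    define j where "j = - int i"
    let ?k = "int s + int n"
    have j: "j \<le> 0" "j \<le> ?k" "j - 1 \<le> -1" "j - 1 \<noteq> 0" "j - 1 \<notin> {j..?k}" "- (j - 1) > 0" by (auto simp: j_def)
    have jS: "- int (Suc i) = j - 1" by (simp add: j_def)
    have sl: "seq_limit M X Y {j..?k} N YX" using Suc by (simp add: j_def)
    have "indep_outside N YX A B {j..?k}" using outside[of i n] by (simp add: j_def)
    from indep_outside_coordinate[OF N this j(5)]
    have ind: "indep_rv N borel (\<lambda>\<omega>. proj {j..?k} (\<lambda>i. YX i \<omega>)) (borel \<Otimes>\<^sub>M borel) (\<lambda>\<omega>. (A (j - 1) \<omega>, B (j - 1) \<omega>))" .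
    have one: "(-1::int) \<noteq> 0" by simp
    have law: "(\<integral>\<omega>. f (A (j - 1) \<omega>) \<partial>N) = (\<integral>\<omega>. f (A (-1) \<omega>) \<partial>N)" "(\<integral>\<omega>. f (B (j - 1) \<omega>) \<partial>N) = (\<integral>\<omega>. f (B (-1) \<omega>) \<partial>N)"
      if "f \<in> borel_measurable borel" for f :: "real \<Rightarrow> real"
      by (rule integral_pair_law[OF AB_neg[OF j(3)] ABm[OF j(4)] ABm[OF one] that])+
    have rec: "AE \<omega> in N. YX (j - 1) \<omega> = tail_step (YX j \<omega>) (A (j - 1) \<omega>) (B (j - 1) \<omega>)"
      using YX_backward[OF j(6)] by simp
    show ?case unfolding jS
    \<comment> \<open>Degenerate \<open>p\<close> need no separate case here, as the laws enter
      multiplied by \<open>p\<close> and \<open>1 - p\<close>.\<close>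
    proof (rule T.backward_step[OF N ABm[OF j(4)] _ _ j(1,2) YX sl ind rec cpos crv assms(16) cq])
      fix f :: "real \<Rightarrow> real" and D
      assume f: "f \<in> borel_measurable borel" "\<And>y. \<bar>f y\<bar> \<le> D"
      show "(\<integral>\<omega>. f (A (j - 1) \<omega>) \<partial>N) * p = (\<integral>\<omega>. f (Mneg \<omega>) * indicator {\<omega>\<in>space K. M0 \<omega> = 1} \<omega> \<partial>K)"
        using ratio_laws_integral(1)[OF N K AB_backward M0m Mneg(1) f] law(1)[OF f(1)] M0(1) by simp
      show "(\<integral>\<omega>. f (B (j - 1) \<omega>) \<partial>N) * (1 - p) = (\<integral>\<omega>. f (- Mneg \<omega>) * indicator {\<omega>\<in>space K. M0 \<omega> = -1} \<omega> \<partial>K)"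
        using ratio_laws_integral(2)[OF N K AB_backward M0m Mneg(1) f] law(2)[OF f(1)] M0(2) by simp
    qed
  qed
  then show ?thesis
    using exceedance_limit_iff_seq_limit[where M=M and N=N and X=X and Y=Y and Z=YX, OF M N Xm Ym YX cpos] by blast
qed

end
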